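(* There exists a randomized algorithm in the $\mathsf{LOCAL}$ model which, given an $n$-vertex graph $G$ and a parameter $0<\varepsilon<1$, computes an $\left(\varepsilon, O\left(\frac{\log n}{\varepsilon}\right)\right)$ low-diameter decomposition of $G$ in $O\left(\frac{\log^3(1/\varepsilon)\log n}{\varepsilon}\right)$ rounds, and succeeds with probability $1-1/\operatorname{poly}(n)$.
   Context: The $\mathsf{LOCAL}$ model: the network is the graph $G$; computation proceeds in synchronous rounds; in each round every vertex receives messages from its neighbours, performs arbitrary local computation, and sends a message of arbitrary size to each neighbour. In the randomized variant, vertices have access to independent local random bits. All vertices initially know a number $\tilde n$ with $n\le \tilde n\le n^c$ for some universal constant $c\ge 1$. For $d>0$, an $(\varepsilon,d)$ low-diameter decomposition of $G$ is a partition $V(G)=D\cup S_1\cup\cdots\cup S_k$ such that (i) the sets $S_1,\dots,S_k$ are mutually non-adjacent (no edge joins $S_i$ and $S_j$ for $i\ne j$); (ii) for each $i$, the weak diameter $\max_{u,v\in S_i}\mathsf{dist}_G(u,v)$ is at most $d$; (iii) $|D|\le \varepsilon|V(G)|$. "With probability $1-1/\operatorname{poly}(n)$" means with probability at least $1-n^{-c'}$ for a suitably large constant $c'$.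
   Formalization: In the round bound, log(1/ε) is read as max(1, ln(1/ε)): as ε tends to 1 (e.g. ε = 1 − 1/n on a long cycle) the literal bound would force zero rounds, which is impossible; for ε bounded away from 1 it agrees up to constants. Vertices are natural numbers. *)

theory Defs
  imports "HOL-Probability.Probability" "Graph_Theory.Graph_Theory"
begin

section \<open>Low-diameter decompositions\<close>

text \<open>A finite simple graph is a \<^locale>\<open>pair_graph\<close>: an edge is a pair of opposite arcs. The
  distance is the infimum of the lengths of all walks, hence infinite between different components.\<close>

definition gdist :: "'v pair_pre_digraph \<Rightarrow> 'v \<Rightarrow> 'v \<Rightarrow> ereal" where
  "gdist G u v = wf_digraph.\<mu> (with_proj G) (\<lambda>_. 1) u v"

definition weak_diameter :: "'v pair_pre_digraph \<Rightarrow> 'v set \<Rightarrow> ereal" where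
  "weak_diameter G S = (SUP u\<in>S. SUP v\<in>S. gdist G u v)"

definition low_diameter_decomposition ::
    "'v pair_pre_digraph \<Rightarrow> real \<Rightarrow> real \<Rightarrow> 'v set \<Rightarrow> 'v set set \<Rightarrow> bool" where
  "low_diameter_decomposition G \<epsilon> d D \<S> \<longleftrightarrow>
     D \<union> \<Union>\<S> = pverts G \<and> D \<inter> \<Union>\<S> = {} \<and> disjoint \<S> \<and>
     (\<forall>S\<in>\<S>. \<forall>T\<in>\<S>. S \<noteq> T \<longrightarrow> (\<forall>u\<in>S. \<forall>v\<in>T. (u, v) \<notin> parcs G)) \<and>
     (\<forall>S\<in>\<S>. weak_diameter G S \<le> ereal d) \<and>
     real (card D) \<le> \<epsilon> * real (card (pverts G))"

section \<open>The randomized LOCAL model\<close>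

text \<open>Vertices are anonymous. A vertex of degree \<open>k\<close> sees its neighbours as ports \<open>0, \<dots>, k - 1\<close>
  and owns an infinite tape of random bits, to which its local computation has access in every
  round. In a round it sends \<open>send s i\<close> on each port \<open>i\<close>, where \<open>s\<close> is its state, and then updates
  the state from the list of messages received, in the order of the ports. After a fixed number of
  rounds it computes its output from its state.\<close>

type_synonym tape = "nat \<Rightarrow> bool"

record ('s, 'm, 'o) local_algorithm =
  init :: "nat \<Rightarrow> tape \<Rightarrow> 's"
  send :: "'s \<Rightarrow> nat \<Rightarrow> 'm"
  step :: "tape \<Rightarrow> 's \<Rightarrow> 'm list \<Rightarrow> 's"
  rounds :: nat
  result :: "'s \<Rightarrow> 'o"

definition port_numbering :: "'v pair_pre_digraph \<Rightarrow> ('v \<Rightarrow> 'v list) \<Rightarrow> bool" where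
  "port_numbering G P \<longleftrightarrow>
     (\<forall>v\<in>pverts G. distinct (P v) \<and> set (P v) = {u. (v, u) \<in> parcs G})"

definition port_to :: "('v \<Rightarrow> 'v list) \<Rightarrow> 'v \<Rightarrow> 'v \<Rightarrow> nat" where
  "port_to P u v = (THE i. i < length (P u) \<and> P u ! i = v)"

primrec state_after :: "('s, 'm, 'o) local_algorithm \<Rightarrow> ('v \<Rightarrow> 'v list) \<Rightarrow> ('v \<Rightarrow> tape) \<Rightarrow>
    nat \<Rightarrow> 'v \<Rightarrow> 's" where
  "state_after A P \<omega> 0 v = init A (length (P v)) (\<omega> v)"
| "state_after A P \<omega> (Suc t) v =
     step A (\<omega> v) (state_after A P \<omega> t v)
       (map (\<lambda>u. send A (state_after A P \<omega> t u) (port_to P u v)) (P v))"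

definition outcome :: "('s, 'm, 'o) local_algorithm \<Rightarrow> ('v \<Rightarrow> 'v list) \<Rightarrow> ('v \<Rightarrow> tape) \<Rightarrow> 'v \<Rightarrow> 'o" where
  "outcome A P \<omega> v = result A (state_after A P \<omega> (rounds A) v)"

definition tape_space :: "tape measure" where
  "tape_space = PiM UNIV (\<lambda>_. measure_pmf (bernoulli_pmf (1/2)))"

definition tapes :: "'v set \<Rightarrow> ('v \<Rightarrow> tape) measure" where
  "tapes V = PiM V (\<lambda>_. tape_space)"

text \<open>Local computation is otherwise arbitrary, but has to be a measurable function of the random
  bits. This is meant for countable state spaces.\<close>

definition measurable_algorithm :: "('s, 'm, 'o) local_algorithm \<Rightarrow> bool" where
  "measurable_algorithm A \<longleftrightarrow>
     (\<forall>k. init A k \<in> tape_space \<rightarrow>\<^sub>M count_space UNIV) \<and>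
     (\<forall>s ms. (\<lambda>\<rho>. step A \<rho> s ms) \<in> tape_space \<rightarrow>\<^sub>M count_space UNIV)"

text \<open>A vertex outputs \<^const>\<open>None\<close> to join \<open>D\<close>, and otherwise the name of its cluster.\<close>

definition outputs_ldd :: "'v pair_pre_digraph \<Rightarrow> real \<Rightarrow> real \<Rightarrow> ('v \<Rightarrow> nat option) \<Rightarrow> bool" where
  "outputs_ldd G \<epsilon> d f \<longleftrightarrow>
     low_diameter_decomposition G \<epsilon> d {v \<in> pverts G. f v = None}
       ((\<lambda>i. {v \<in> pverts G. f v = Some i}) ` {i. \<exists>v\<in>pverts G. f v = Some i})"

text \<open>The factor \<open>log (1/\<epsilon>)\<close> of an asymptotic bound, which by convention is at least 1: without this
  the bound would tend to 0 for fixed \<open>n\<close> and \<open>\<epsilon> \<rightarrow> 1\<close>, and so would ask for an algorithm that does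
  not communicate at all.\<close>

definition log_inv :: "real \<Rightarrow> real" where
  "log_inv \<epsilon> = max 1 (ln (1 / \<epsilon>))"

end

theory Submission
  imports Defs
begin

text \<open>Only the case of constant \<open>\<epsilon>\<close> needs randomness, applied to distances rounded to blocks of length
  \<open>2 h \<approx> 32/\<epsilon>\<close>. If clusters at pairwise distance more than \<open>2 h\<close> cover a fixed fraction of the
  vertices, each can grow until it meets a layer of relative size at most \<open>1/h\<close>, which is
  deleted. \<open>O(log (1/\<epsilon>))\<close> such rounds on the undecided vertices suffice.

  In a round, vertices are first sampled with probability about \<open>log N\<close> divided by the size of a ball
  of radius \<open>O(log N)\<close>. Each sampled vertex carves out a ball, with the sparsest boundary in a
  range of \<open>O(log N)\<close> radii. No vertex lies near more than \<open>O(log N)\<close> samples, so the boundaries are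
  small. The vertices without a sample nearby join the first ball among balls of geometric radii around
  these vertices, as in the network decomposition of Linial and Saks; each of them is on a
  boundary with probability at most a half. For concentration it is essential that all but a small
  fraction of the vertices without a nearby sample have few others of that kind in their
  neighbourhood (\<open>prob_many_crowded\<close>).

  By the locality of a round, all of this is computed from a ball of radius
  \<open>O(log (1/\<epsilon>) log N / \<epsilon>)\<close>, with random identifiers.\<close>

text \<open>The expected loss of a round is easy to bound; the difficulty is that the bound must
  fail with probability only of order \<open>exp (- s)\<close>, with \<open>s\<close> of order
  \<open>log N\<close>. Grazing events of vertices more than \<open>2 * r\<close> blocks apart
  involve disjoint sets of radii, so about \<open>s\<close> far-apart events would do. Picking them
  greedily requires that each vertex conflict with at most about
  \<open>t = card A / (80 * s)\<close> others. Sampling cannot guarantee this vertex by vertex: a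
  ball of \<open>t\<close> vertices is only sure of a constant expected number of samples,
  \<open>lam * t / card A = 87.5\<close>. Raising this to order \<open>s\<close> would need
  \<open>lam\<close>, hence \<open>R\<close>, of order \<open>s^2\<close>, one logarithm too much
  for the diameter. So vertices with too many unhit neighbours may exist, and only their number is
  bounded, by 1/16 of \<open>card A\<close>. All estimates concern finite families of geometric
  variables, and only lower bounds on success are carried over to the tapes.\<close>

section \<open>Counting dependent events in finite products\<close>

text \<open>Markov's inequality for a weighted count of the events \<open>T i\<close>. It replaces
  the union bound in \<open>prob_many_le\<close> and \<open>prob_many_crowded\<close>, where a bad
  outcome offers many choices of the next vertex, so that each choice can be given a small
  weight.\<close>

lemma prob_le_weighted_sum:
  fixes M :: "'b pmf"
  assumes "finite I" "\<And>i. i \<in> I \<Longrightarrow> 0 \<le> c i"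
    and "\<And>\<omega>. \<omega> \<in> S \<Longrightarrow> 1 \<le> (\<Sum>i\<in>I. c i * indicator (T i) \<omega>)"
  shows "measure M S \<le> (\<Sum>i\<in>I. c i * measure M (T i))"
proof -
  have "measure M S = (\<integral>\<omega>. indicator S \<omega> \<partial>M)"
    by simp
  also have "\<dots> \<le> (\<integral>\<omega>. (\<Sum>i\<in>I. c i * indicator (T i) \<omega>) \<partial>M)"
  proof (rule integral_mono)
    show "indicator S \<omega> \<le> (\<Sum>i\<in>I. c i * indicator (T i) \<omega>)" for \<omega>
      using assms by (cases "\<omega> \<in> S") (auto intro!: sum_nonneg)
  qed (auto intro!: Bochner_Integration.integrable_sum integrable_mult_right integrable_real_indicator simp: measure_pmf.emeasure_eq_measure)
  also have "\<dots> = (\<Sum>i\<in>I. c i * measure M (T i))"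
    by (subst Bochner_Integration.integral_sum)
       (auto intro!: integrable_mult_right integrable_real_indicator simp: measure_pmf.emeasure_eq_measure)
  finally show ?thesis .
qed

text \<open>Once the values outside \<open>C\<close> are fixed, \<open>H\<close> is decided and
  \<open>F\<close> still has probability at most \<open>q\<close>; integrating over these values
  gives the product. This stands in for conditional probability below.\<close>

lemma Pi_pmf_prob_conj_le:
  assumes I: "finite I" "C \<subseteq> I"
    and F: "\<And>g. measure (Pi_pmf C d p) {f. F (\<lambda>x. if x \<in> C then f x else g x)} \<le> q"
    and H: "\<And>f g. (\<And>x. x \<notin> C \<Longrightarrow> f x = g x) \<Longrightarrow> H f = H g"
  shows "measure (Pi_pmf I d p) {f. F f \<and> H f} \<le> q * measure (Pi_pmf I d p) {f. H f}"
proof -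
  have C: "finite C" "finite (I - C)"
    using I finite_subset by auto
  have q: "0 \<le> q"
    using F[of undefined] measure_nonneg order_trans by blast
  let ?A = "Pi_pmf (I - C) d p" and ?B = "Pi_pmf C d p"
  define mrg where "mrg = (\<lambda>(f,g) x. if x \<in> I - C then f x else g x :: 'b)"
  have eq: "Pi_pmf I d p = map_pmf mrg (pair_pmf ?A ?B)"
    using Pi_pmf_union[of "I - C" C d p] C I unfolding mrg_def by (simp add: Un_absorb2 Diff_disjoint Int_commute)
  have 1: "emeasure (Pi_pmf I d p) S = (\<integral>\<^sup>+a. emeasure ?B {b. mrg (a, b) \<in> S} \<partial>?A)" for S
  proof -
    have ind: "indicator (mrg -` S) (a, b) = (indicator {b. mrg (a, b) \<in> S} b :: ennreal)" for a b
      by (simp add: indicator_def)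
    have "emeasure (Pi_pmf I d p) S = (\<integral>\<^sup>+x. indicator (mrg -` S) x \<partial>pair_pmf ?A ?B)"
      by (simp add: eq)
    also have "\<dots> = (\<integral>\<^sup>+a. \<integral>\<^sup>+b. indicator {b. mrg (a, b) \<in> S} b \<partial>?B \<partial>?A)"
      by (subst nn_integral_pair_pmf') (simp only: ind)
    also have "\<dots> = (\<integral>\<^sup>+a. emeasure ?B {b. mrg (a, b) \<in> S} \<partial>?A)"
      by (subst nn_integral_indicator) auto
    finally show ?thesis .
  qed
  have "emeasure (Pi_pmf I d p) {f. F f \<and> H f} \<le> (\<integral>\<^sup>+a. ennreal q * emeasure ?B {b. mrg (a, b) \<in> {f. H f}} \<partial>?A)"
    unfolding 1
  proof (rule nn_integral_mono)
    fix a
    \<comment> \<open>Outside \<open>I\<close> the support of the product forces the default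
      \<open>d\<close>, so \<open>g\<close> is padded with \<open>d\<close>.\<close>
    define g where "g = (\<lambda>x. if x \<in> I - C then a x else d)"
    have m: "mrg (a, b) = (\<lambda>x. if x \<in> C then b x else g x)" if "b \<in> set_pmf ?B" for b
      using set_Pi_pmf_subset[of C d p] C that by (force simp: mrg_def g_def fun_eq_iff)
    have Hg: "H (mrg (a, b)) = H g" if "b \<in> set_pmf ?B" for b
      unfolding m[OF that] by (rule H) auto
    show "emeasure ?B {b. mrg (a, b) \<in> {f. F f \<and> H f}} \<le> ennreal q * emeasure ?B {b. mrg (a, b) \<in> {f. H f}}"
    proof (cases "H g")
      case True
      have "emeasure ?B {b. mrg (a, b) \<in> {f. F f \<and> H f}} \<le> emeasure ?B {f. F (\<lambda>x. if x \<in> C then f x else g x)}"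
        by (rule emeasure_mono_AE) (auto simp: AE_measure_pmf_iff m)
      also have "\<dots> \<le> ennreal q"
        using F[of g] by (simp add: measure_pmf.emeasure_eq_measure ennreal_leI)
      also have "\<dots> = ennreal q * emeasure ?B UNIV"
        by simp
      also have "\<dots> = ennreal q * emeasure ?B {b. mrg (a, b) \<in> {f. H f}}"
        by (intro arg_cong2[where f="(*)"] emeasure_eq_AE) (auto simp: AE_measure_pmf_iff Hg True)
      finally show ?thesis .
    next
      case False
      have "emeasure ?B {b. mrg (a, b) \<in> {f. F f \<and> H f}} = emeasure ?B {}"
        by (rule emeasure_eq_AE) (auto simp: AE_measure_pmf_iff Hg False)
      then show ?thesis by simp
    qed
  qed
  also have "\<dots> = ennreal q * emeasure (Pi_pmf I d p) {f. H f}"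
    unfolding 1 by (simp add: nn_integral_cmult)
  finally show ?thesis
    using q by (simp add: measure_pmf.emeasure_eq_measure flip: ennreal_mult')
qed

lemma Pi_pmf_prob_le:
  assumes "finite I" "C \<subseteq> I"
    and "\<And>g. measure (Pi_pmf C d p) {f. F (\<lambda>x. if x \<in> C then f x else g x)} \<le> q"
  shows "measure (Pi_pmf I d p) {f. F f} \<le> q"
  using Pi_pmf_prob_conj_le[OF assms, where H = "\<lambda>_. True"] by (simp add: measure_pmf.prob_space[simplified])

text \<open>One law serves all purposes: \<open>lev u \<le> X u\<close> samples \<open>u\<close>
  with probability \<open>(1/2) ^ lev u\<close>, the law is memoryless as the radii require, and it
  is the law of the initial run of ones among fair bits.\<close>

abbreviation geo :: "nat pmf" where
  "geo \<equiv> geometric_pmf (1/2)"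

abbreviation geos :: "'i set \<Rightarrow> ('i \<Rightarrow> nat) pmf" where
  "geos I \<equiv> Pi_pmf I 0 (\<lambda>_. geo)"

lemma geo_less: "measure geo {y. y < j} = 1 - (1/2) ^ j"
proof -
  have "measure geo {y. y < j} = (\<Sum>i<j. (1/2) ^ Suc i)"
    by (subst measure_measure_pmf_finite) (auto simp: lessThan_def)
  also have "\<dots> = 1 - (1/2) ^ j"
    by (induction j) (auto simp: field_simps)
  finally show ?thesis .
qed

lemma geo_atLeast: "measure geo {y. j \<le> y} = (1/2) ^ j"
proof -
  have "measure geo {y. j \<le> y} = 1 - measure geo {y. y < j}"
    by (subst measure_pmf.prob_compl[symmetric, simplified]) (auto intro!: arg_cong[where f="measure _"])
  then show ?thesis
    by (simp add: geo_less)
qed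

lemma measure_geos_Pi:
  assumes "finite I" "S \<subseteq> I"
  shows "measure (geos I) {y. \<forall>i\<in>S. y i \<in> B i} = (\<Prod>i\<in>S. measure geo (B i))"
proof -
  have "{y. \<forall>i\<in>S. y i \<in> B i} = Pi I (\<lambda>i. if i \<in> S then B i else UNIV)"
    using assms by (auto simp: Pi_iff split: if_splits)
  then have "measure (geos I) {y. \<forall>i\<in>S. y i \<in> B i} = (\<Prod>i\<in>I. measure geo (if i \<in> S then B i else UNIV))"
    using measure_Pi_pmf_Pi[OF assms(1), of "0::nat" "\<lambda>_. geo"] by simp
  also have "\<dots> = (\<Prod>i\<in>I. if i \<in> S then measure geo (B i) else 1)"
    by (intro prod.cong) auto
  finally show ?thesis
    using assms by (simp add: prod.If_cases Int_absorb1)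
qed

lemma measure_geos_component:
  assumes "finite I" "i \<in> I"
  shows "measure (geos I) {y. y i \<in> B} = measure geo B"
  using measure_geos_Pi[of I "{i}" "\<lambda>_. B"] assms by simp

text \<open>If at least \<open>x\<close> events occur, \<open>k\<close> pairwise non-conflicting
  ones can be picked one by one, because each pick rules out at most \<open>\<Delta>\<close>. At
  every step at least \<open>x - k * \<Delta>\<close> of the at most \<open>m\<close> vertices are
  eligible, so the weighted count costs a factor \<open>m / (x - k * \<Delta>)\<close>, while the
  \<open>k\<close> chosen events together have probability at most \<open>q ^ k\<close>.
  Independence enters only through this product bound.\<close>

lemma prob_many_le:
  fixes M :: "'b pmf" and Ev :: "'w \<Rightarrow> 'b \<Rightarrow> bool" and m x \<Delta> q :: real
  assumes fin: "finite W" and m: "real (card W) \<le> m"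
    and conf: "\<And>w. w \<in> W \<Longrightarrow> w \<in> N w" "\<And>w. w \<in> W \<Longrightarrow> real (card (N w \<inter> W)) \<le> \<Delta>"
    and far: "\<And>T. T \<subseteq> W \<Longrightarrow> (\<And>v w. v \<in> T \<Longrightarrow> w \<in> T \<Longrightarrow> v \<noteq> w \<Longrightarrow> v \<notin> N w) \<Longrightarrow>
               measure M {y. \<forall>w\<in>T. Ev w y} \<le> q ^ card T"
    and sym: "\<And>v w. v \<in> W \<Longrightarrow> w \<in> W \<Longrightarrow> v \<in> N w \<Longrightarrow> w \<in> N v"
    and x: "real k * \<Delta> < x" and q: "0 \<le> q" and \<Delta>: "0 \<le> \<Delta>"
  shows "measure M {y. x \<le> real (card {w\<in>W. Ev w y})} \<le> (m * q / (x - real k * \<Delta>)) ^ k"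
proof -
  define bad where "bad = {y. x \<le> real (card {w\<in>W. Ev w y})}"
  define d where "d = x - real k * \<Delta>"
  have d: "d > 0" using x by (simp add: d_def)
  have m0: "0 \<le> m" using m by linarith
  \<comment> \<open>\<open>T\<close> holds the events picked so far, and \<open>j\<close> is the
    number still to be picked.\<close>
  have main: "measure M {y. y \<in> bad \<and> (\<forall>w\<in>T. Ev w y)} \<le> (m / d) ^ j * q ^ k"
    if "j \<le> k" "T \<subseteq> W" "\<And>v w. v \<in> T \<Longrightarrow> w \<in> T \<Longrightarrow> v \<noteq> w \<Longrightarrow> v \<notin> N w" "card T + j = k" for j T
    using that
  proof (induction j arbitrary: T)
    case 0
    have "measure M {y. y \<in> bad \<and> (\<forall>w\<in>T. Ev w y)} \<le> measure M {y. \<forall>w\<in>T. Ev w y}"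
      by (rule measure_pmf.finite_measure_mono) auto
    also have "\<dots> \<le> q ^ card T"
      by (rule far) (use 0 in auto)
    finally show ?case using 0 by simp
  next
    case (Suc j)
    have finT: "finite T" using finite_subset[OF Suc.prems(2) fin] .
    define R where "R = W - (\<Union>v\<in>T. N v)"
    have finR: "finite R" using fin by (simp add: R_def)
    have "measure M {y. y \<in> bad \<and> (\<forall>w\<in>T. Ev w y)} \<le>
      (\<Sum>w\<in>R. (1 / d) * measure M {y. y \<in> bad \<and> (\<forall>v\<in>insert w T. Ev v y)})"
    proof (rule prob_le_weighted_sum[OF finR])
      show "0 \<le> 1 / d" using d by simp
      fix y assume y: "y \<in> {y. y \<in> bad \<and> (\<forall>w\<in>T. Ev w y)}"
      let ?D = "{w\<in>W. Ev w y}"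
      have "real (card (\<Union>v\<in>T. N v \<inter> W)) \<le> (\<Sum>v\<in>T. real (card (N v \<inter> W)))"
        using card_UN_le[OF finT, of "\<lambda>v. N v \<inter> W"] by (metis of_nat_le_iff of_nat_sum)
      also have "\<dots> \<le> (\<Sum>v\<in>T. \<Delta>)"
        using Suc.prems by (intro sum_mono conf) auto
      also have "\<dots> \<le> real k * \<Delta>"
        using Suc.prems \<Delta> by (auto intro!: mult_right_mono)
      finally have 1: "real (card (\<Union>v\<in>T. N v \<inter> W)) \<le> real k * \<Delta>" .
      have "card ?D \<le> card ((?D \<inter> R) \<union> (\<Union>v\<in>T. N v \<inter> W))"
        by (rule card_mono) (use finT fin finR in \<open>auto simp: R_def\<close>)
      also have "\<dots> \<le> card (?D \<inter> R) + card (\<Union>v\<in>T. N v \<inter> W)"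
        by (rule card_Un_le)
      finally have 2: "d \<le> real (card (?D \<inter> R))"
        using 1 y by (simp add: bad_def d_def)
      have "1 \<le> real (card (?D \<inter> R)) / d"
        using 2 d by simp
      also have "\<dots> = (\<Sum>w\<in>?D \<inter> R. 1 / d)"
        by simp
      also have "\<dots> = (\<Sum>w\<in>?D \<inter> R. 1 / d * indicator {y. y \<in> bad \<and> (\<forall>v\<in>insert w T. Ev v y)} y)"
        using y by (intro sum.cong) auto
      also have "\<dots> \<le> (\<Sum>w\<in>R. 1 / d * indicator {y. y \<in> bad \<and> (\<forall>v\<in>insert w T. Ev v y)} y)"
        using finR d by (intro sum_mono2) auto
      finally show "1 \<le> (\<Sum>w\<in>R. 1 / d * indicator {y. y \<in> bad \<and> (\<forall>v\<in>insert w T. Ev v y)} y)" .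
    qed
    also have "\<dots> \<le> (\<Sum>w\<in>R. (1 / d) * ((m / d) ^ j * q ^ k))"
    proof (intro sum_mono mult_left_mono)
      fix w assume w: "w \<in> R"
      have wW: "w \<in> W" and wN: "\<And>v. v \<in> T \<Longrightarrow> w \<notin> N v"
        using w by (auto simp: R_def)
      have wT: "w \<notin> T"
        using wN wW conf(1) by blast
      show "measure M {y. y \<in> bad \<and> (\<forall>v\<in>insert w T. Ev v y)} \<le> (m / d) ^ j * q ^ k"
      proof (rule Suc.IH)
        show "j \<le> k" "insert w T \<subseteq> W" "card (insert w T) + j = k"
          using Suc.prems(1,2,4) wW wT finT by auto
        fix u v assume "u \<in> insert w T" "v \<in> insert w T" "u \<noteq> v"
        then consider "u \<in> T" "v \<in> T" | "u = w" "v \<in> T" | "u \<in> T" "v = w"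
          by blast
        then show "u \<notin> N v"
        proof cases
          case 1
          then show ?thesis using Suc.prems(3) \<open>u \<noteq> v\<close> by blast
        next
          case 2
          then show ?thesis using wN by blast
        next
          case 3
          then show ?thesis using wN[of u] sym[of u w] wW Suc.prems(2) by blast
        qed
      qed
    qed (use d in auto)
    also have "\<dots> = real (card R) * ((1 / d) * ((m / d) ^ j * q ^ k))"
      by simp
    also have "\<dots> \<le> m * ((1 / d) * ((m / d) ^ j * q ^ k))"
    proof (rule mult_right_mono)
      have "card R \<le> card W" using fin by (auto intro: card_mono simp: R_def)
      then show "real (card R) \<le> m" using m by linarith
    qed (use d q m0 in auto)
    finally show ?case by (simp add: field_simps)
  qed
  have "measure M bad \<le> (m / d) ^ k * q ^ k"
    using main[of k "{}"] by simp
  then show ?thesis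
    by (simp add: bad_def d_def power_mult_distrib power_divide)
qed

text \<open>An exponential moment bound with base 2, by induction on \<open>S\<close>: either
  \<open>z\<close> samples are found without \<open>u\<close>, or \<open>u\<close> is sampled and
  the others supply \<open>z - 1\<close>. The first case does not ask that \<open>u\<close> be
  unsampled, hence factors \<open>1 + 2 * p\<close> where the moment itself has
  \<open>1 + p\<close>.\<close>

lemma prob_sampled_card_ge:
  assumes "finite I" "S \<subseteq> I"
  shows "measure (geos I) {y. z \<le> card {u\<in>S. lev u \<le> y u}} \<le> (\<Prod>u\<in>S. 1 + 2 * (1/2) ^ lev u) / 2 ^ z"
proof -
  have "finite S" using assms finite_subset by blast
  then show ?thesis using assms(2)
  proof (induction S arbitrary: z)
    case empty
    then show ?case by (cases z) auto
  next
    case (insert u S)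
    show ?case
    proof (cases z)
      case 0
      have "(1::real) \<le> (\<Prod>u\<in>insert u S. 1 + 2 * (1/2) ^ lev u)"
        by (intro prod_ge_1) auto
      then show ?thesis using 0 by (auto intro: order_trans[OF measure_pmf.prob_le_1])
    next
      case (Suc z')
      let ?P = "(\<Prod>u\<in>S. 1 + 2 * (1/2) ^ lev u) :: real"
      let ?c = "\<lambda>y. card {u\<in>S. lev u \<le> y u}"
      have "measure (geos I) {y. z \<le> card {v\<in>insert u S. lev v \<le> y v}} \<le>
            measure (geos I) ({y. z \<le> ?c y} \<union> {y. lev u \<le> y u \<and> z' \<le> ?c y})"
      proof (rule measure_pmf.finite_measure_mono)
        have "{v\<in>insert u S. lev v \<le> y v} = (if lev u \<le> y u then insert u {v\<in>S. lev v \<le> y v} else {v\<in>S. lev v \<le> y v})"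
          for y by auto
        then show "{y. z \<le> card {v\<in>insert u S. lev v \<le> y v}} \<subseteq> {y. z \<le> ?c y} \<union> {y. lev u \<le> y u \<and> z' \<le> ?c y}"
          using Suc insert by auto
      qed auto
      also have "\<dots> \<le> measure (geos I) {y. z \<le> ?c y} + measure (geos I) {y. lev u \<le> y u \<and> z' \<le> ?c y}"
        by (rule measure_Un_le) auto
      also have "measure (geos I) {y. lev u \<le> y u \<and> z' \<le> ?c y} \<le> (1/2) ^ lev u * measure (geos I) {y. z' \<le> ?c y}"
      proof (rule Pi_pmf_prob_conj_le[where C = "{u}"])
        show "measure (geos {u}) {f. lev u \<le> (if u \<in> {u} then f u else g u)} \<le> (1 / 2) ^ lev u" for g
          using measure_geos_component[of "{u}" u "{y. lev u \<le> y}"] by (simp add: geo_atLeast)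
        show "(z' \<le> ?c f) = (z' \<le> ?c g)" if "\<And>x. x \<notin> {u} \<Longrightarrow> f x = g x" for f g
        proof -
          have "f v = g v" if "v \<in> S" for v
            using that insert.hyps(2) \<open>\<And>x. x \<notin> {u} \<Longrightarrow> f x = g x\<close> by (metis singletonD)
          then have "{u \<in> S. lev u \<le> f u} = {u \<in> S. lev u \<le> g u}" by auto
          then show ?thesis by simp
        qed
      qed (use assms insert in auto)
      also have "measure (geos I) {y. z \<le> ?c y} + (1/2) ^ lev u * measure (geos I) {y. z' \<le> ?c y} \<le>
          ?P / 2 ^ z + (1/2) ^ lev u * (?P / 2 ^ z')"
        using insert by (intro add_mono mult_left_mono insert.IH) auto
      also have "\<dots> = (\<Prod>u\<in>insert u S. 1 + 2 * (1/2) ^ lev u) / 2 ^ z"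
        using insert Suc by (simp add: field_simps)
      finally show ?thesis by simp
    qed
  qed
qed

text \<open>If \<open>\<delta> u\<close> is the distance of \<open>u\<close> from a fixed vertex, this is the event that the first ball of
  random radius that reaches the vertex has it on its boundary.\<close>

definition grazed :: "nat set \<Rightarrow> (nat \<Rightarrow> nat) \<Rightarrow> (nat \<Rightarrow> nat) \<Rightarrow> bool" where
  "grazed S \<delta> y \<longleftrightarrow> (\<exists>u\<in>S. y u = \<delta> u \<and> (\<forall>v\<in>S. v < u \<longrightarrow> y v < \<delta> v))"

lemma grazed_cong: "(\<And>u. u \<in> S \<Longrightarrow> y u = y' u) \<Longrightarrow> grazed S \<delta> y = grazed S \<delta> y'"
  by (auto simp: grazed_def)

text \<open>Memorylessness: a ball that reaches the vertex at all ends exactly there with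
  probability 1/2, whatever its distance. The induction peels off the smallest centre, which has
  precedence; if its ball falls short, the other centres decide independently of it.\<close>

lemma prob_grazed:
  assumes "finite S" shows "measure (geos S) {y. grazed S \<delta> y} \<le> 1/2"
  using assms
proof (induction rule: finite_linorder_min_induct)
  case empty
  then show ?case by (simp add: grazed_def)
next
  case (insert b A)
  have nb: "b \<notin> A" using insert.hyps by auto
  have "{y. grazed (insert b A) \<delta> y} \<subseteq> {y. y b \<in> {\<delta> b}} \<union> {y. grazed A \<delta> y \<and> y b \<in> {..<\<delta> b}}"
    using insert.hyps by (auto simp: grazed_def)
  then have "measure (geos (insert b A)) {y. grazed (insert b A) \<delta> y} \<le>
    measure (geos (insert b A)) ({y. y b \<in> {\<delta> b}} \<union> {y. grazed A \<delta> y \<and> y b \<in> {..<\<delta> b}})"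
    by (intro measure_pmf.finite_measure_mono) auto
  also have "\<dots> \<le> measure (geos (insert b A)) {y. y b \<in> {\<delta> b}} +
     measure (geos (insert b A)) {y. grazed A \<delta> y \<and> y b \<in> {..<\<delta> b}}"
    by (rule measure_Un_le) auto
  also have "measure (geos (insert b A)) {y. grazed A \<delta> y \<and> y b \<in> {..<\<delta> b}}
       \<le> 1/2 * measure (geos (insert b A)) {y. y b \<in> {..<\<delta> b}}"
  proof (rule Pi_pmf_prob_conj_le[where C = A])
    show "measure (geos A) {f. grazed A \<delta> (\<lambda>x. if x \<in> A then f x else g x)} \<le> 1 / 2" for g
    proof -
      have "grazed A \<delta> (\<lambda>x. if x \<in> A then f x else g x) = grazed A \<delta> f" for f
        by (rule grazed_cong) auto
      then show ?thesis using insert.IH by simp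
    qed
  qed (use insert.hyps nb in auto)
  \<comment> \<open>With \<open>j = \<delta> b\<close> the sum is
    \<open>(1/2) ^ (j + 1) + 1/2 * (1 - (1/2) ^ j)\<close>, which is 1/2 for every
    \<open>j\<close>.\<close>
  also have "measure (geos (insert b A)) {y. y b \<in> {\<delta> b}} + 1/2 * measure (geos (insert b A)) {y. y b \<in> {..<\<delta> b}} = 1/2"
    using insert.hyps geo_less[of "\<delta> b"] by (subst (1 2) measure_geos_component) (auto simp: measure_pmf_single lessThan_def field_simps)
  finally show ?case by simp
qed

text \<open>\<open>grazed (S w)\<close> reads only coordinates in \<open>S w\<close>, so with
  disjoint sets the events can be split off one at a time.\<close>

lemma prob_all_grazed:
  assumes "finite I" "finite T" "\<And>w. w \<in> T \<Longrightarrow> S w \<subseteq> I" "\<And>v w. v \<in> T \<Longrightarrow> w \<in> T \<Longrightarrow> v \<noteq> w \<Longrightarrow> S v \<inter> S w = {}"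
  shows "measure (geos I) {y. \<forall>w\<in>T. grazed (S w) (\<delta> w) y} \<le> (1/2) ^ card T"
  using assms(2-4)
proof (induction T)
  case empty
  then show ?case by simp
next
  case (insert w T)
  have "measure (geos I) {y. grazed (S w) (\<delta> w) y \<and> (\<forall>v\<in>T. grazed (S v) (\<delta> v) y)} \<le>
     1/2 * measure (geos I) {y. \<forall>v\<in>T. grazed (S v) (\<delta> v) y}"
  proof (rule Pi_pmf_prob_conj_le[where C = "S w"])
    show "measure (geos (S w)) {f. grazed (S w) (\<delta> w) (\<lambda>x. if x \<in> S w then f x else g x)} \<le> 1 / 2" for g
    proof -
      have "grazed (S w) (\<delta> w) (\<lambda>x. if x \<in> S w then f x else g x) = grazed (S w) (\<delta> w) f" for f
        by (rule grazed_cong) auto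
      then show ?thesis using prob_grazed[of "S w" "\<delta> w"] insert.prems(1)[of w] assms(1) finite_subset[of "S w" I] by simp
    qed
    show "(\<forall>v\<in>T. grazed (S v) (\<delta> v) f) = (\<forall>v\<in>T. grazed (S v) (\<delta> v) g)" if "\<And>x. x \<notin> S w \<Longrightarrow> f x = g x" for f g
    proof (intro ball_cong refl grazed_cong)
      fix v u assume "v \<in> T" "u \<in> S v"
      then show "f u = g u" using insert by (intro that) blast
    qed
  qed (use assms insert in auto)
  also have "\<dots> \<le> 1/2 * (1/2) ^ card T"
    using insert by (intro mult_left_mono insert.IH) auto
  finally show ?case using insert by simp
qed

definition unhit :: "('a \<Rightarrow> 'a set) \<Rightarrow> ('a \<Rightarrow> nat) \<Rightarrow> 'a set \<Rightarrow> ('a \<Rightarrow> nat) \<Rightarrow> 'a set" where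
  "unhit N lev V y = {u\<in>V. \<forall>v\<in>N u. y v < lev v}"

text \<open>The numerical constants leave room for \<open>s \<le> exp s\<close> below. The induction explores the unsampled set
  from within: if many unhit vertices have large unhit degree, then by double counting the number of
  vertices that a random unhit vertex adds to any small unsampled set is large on average.\<close>

lemma prob_many_crowded:
  fixes N :: "'a \<Rightarrow> 'a set" and \<rho> t :: real
  assumes fin: "finite I" "V \<subseteq> I" and N: "\<And>u. u \<in> V \<Longrightarrow> N u \<subseteq> V" "\<And>u v. u \<in> V \<Longrightarrow> v \<in> N u \<Longrightarrow> u \<in> N v"
    and lev: "\<And>u. u \<in> V \<Longrightarrow> 1 - (1/2) ^ lev u \<le> exp (- \<rho>)"
    and t: "t > 0" "\<rho> * t \<ge> 256 / 3" and V: "V \<noteq> {}"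
  shows "measure (geos I) {y. real (card V) / 16 \<le> real (card {w\<in>unhit N lev V y. t < real (card (N w \<inter> unhit N lev V y))})}
    \<le> exp (- \<rho> * card V / 128)"
proof -
  define U where "U = unhit N lev V"
  define F where "F y = {w\<in>U y. t < real (card (N w \<inter> U y))}" for y
  define m where "m = real (card V)"
  define bad where "bad = {y. m / 16 \<le> real (card (F y))}"
  define new where "new A u = card (N u - A)" for A u
  \<comment> \<open>The potential keeps a quarter of \<open>\<rho> * a\<close> in reserve: the
    exploration stops at \<open>m / 32\<close> vertices, where this quarter is worth
    \<open>\<rho> * m / 128\<close>. The other three quarters pay for the weights
    \<open>c u\<close>.\<close>
  define G where "G a = exp (- \<rho> * (3/4 * a + m / 128))" for a :: real
  have finV: "finite V" using fin finite_subset by auto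
  have m: "m > 0" using V finV by (simp add: m_def card_gt_0_iff)
  have \<rho>: "\<rho> > 0" using t by (metis divide_pos_pos less_le_trans zero_less_mult_pos2 zero_less_numeral)
  have UV: "U y \<subseteq> V" for y by (auto simp: U_def unhit_def)
  have finU: "finite (U y)" for y using UV finV finite_subset by blast
  have finN: "finite (N u)" if "u \<in> V" for u using N(1)[OF that] finV finite_subset by blast
  have main: "measure (geos I) {y. y \<in> bad \<and> (\<forall>v\<in>A. y v < lev v)} \<le> G (card A)" if "A \<subseteq> V" for A
    using that
  proof (induction "card V - card A" arbitrary: A rule: less_induct)
    case less
    have finA: "finite A" using less.prems finV finite_subset by blast
    show ?case
    proof (cases "m / 32 \<le> card A")
      case True
      have "measure (geos I) {y. y \<in> bad \<and> (\<forall>v\<in>A. y v < lev v)} \<le> measure (geos I) {y. \<forall>v\<in>A. y v \<in> {z. z < lev v}}"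
        by (rule measure_pmf.finite_measure_mono) auto
      also have "\<dots> = (\<Prod>v\<in>A. 1 - (1/2) ^ lev v)"
        using fin less.prems by (subst measure_geos_Pi) (auto simp: geo_less)
      also have "\<dots> \<le> (\<Prod>v\<in>A. exp (- \<rho>))"
        using less.prems lev by (intro prod_mono) (auto simp: power_le_one)
      also have "\<dots> = exp (- \<rho> * card A)"
        by (simp add: exp_of_nat_mult[symmetric] mult.commute)
      also have "\<dots> \<le> G (card A)"
        unfolding G_def exp_le_cancel_iff using True \<rho> by (simp add: field_simps)
      finally show ?thesis .
    next
      case False
      \<comment> \<open>Only vertices whose neighbourhood adds at least \<open>t / 64\<close> new
        vertices are explored, with weight proportional to what they add.\<close>
      define J where "J = {u\<in>V. t / 64 \<le> new A u}"
      define c where "c u = 64 * new A u / (m * t)" for u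
      have finJ: "finite J" using finV by (simp add: J_def)
      have c0: "0 \<le> c u" for u using m t by (simp add: c_def)
      have "measure (geos I) {y. y \<in> bad \<and> (\<forall>v\<in>A. y v < lev v)} \<le>
        (\<Sum>u\<in>J. c u * measure (geos I) {y. y \<in> bad \<and> (\<forall>v\<in>A \<union> N u. y v < lev v)})"
      proof (rule prob_le_weighted_sum[OF finJ c0])
        fix y assume y: "y \<in> {y. y \<in> bad \<and> (\<forall>v\<in>A. y v < lev v)}"
        define B where "B = F y - A"
        have finB: "finite B" using finU by (auto simp: B_def F_def)
        have "real (card (F y)) \<le> real (card B) + card A"
          unfolding B_def using finA by (metis add.commute card_mono diff_card_le_card_Diff le_diff_conv of_nat_add of_nat_le_iff)
        then have B: "m / 32 \<le> real (card B)"
          using y False by (simp add: bad_def)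
        \<comment> \<open>Double counting of the pairs \<open>w \<in> B\<close>,
          \<open>u \<in> U y \<inter> N w\<close>. Each \<open>w\<close> is in more than
          \<open>t\<close> pairs; since \<open>B\<close> avoids \<open>A\<close>, each
          \<open>u\<close> is in at most \<open>new A u\<close>. Vertices outside \<open>J\<close>
          account for at most \<open>m * t / 64\<close>, half of the lower bound.\<close>
        have "m * t / 32 \<le> real (card B) * t"
          using B t by (simp add: field_simps)
        also have "\<dots> = (\<Sum>w\<in>B. t)"
          by simp
        also have "\<dots> \<le> (\<Sum>w\<in>B. real (card {u\<in>U y. u \<in> N w}))"
        proof (rule sum_mono)
          fix w assume "w \<in> B"
          moreover have "N w \<inter> U y = {u\<in>U y. u \<in> N w}" by auto
          ultimately show "t \<le> real (card {u\<in>U y. u \<in> N w})" by (auto simp: B_def F_def)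
        qed
        also have "\<dots> = (\<Sum>u\<in>U y. real (card {w\<in>B. u \<in> N w}))"
          using sum.swap_restrict[OF finB finU, where g = "\<lambda>_ _. 1::real" and R = "\<lambda>w u. u \<in> N w"] by simp
        also have "\<dots> \<le> (\<Sum>u\<in>U y. real (new A u))"
        proof (intro sum_mono of_nat_mono)
          fix u assume u: "u \<in> U y"
          then have "u \<in> V" using UV by auto
          then show "card {w\<in>B. u \<in> N w} \<le> new A u"
            unfolding new_def using N(2) UV[of y] finN by (intro card_mono) (auto simp: B_def F_def)
        qed
        also have "\<dots> = (\<Sum>u\<in>U y \<inter> J. real (new A u)) + (\<Sum>u\<in>U y - J. real (new A u))"
          using finU by (metis sum.Int_Diff)
        also have "(\<Sum>u\<in>U y - J. real (new A u)) \<le> (\<Sum>u\<in>U y - J. t / 64)"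
          using UV[of y] by (intro sum_mono) (auto simp: J_def)
        also have "\<dots> \<le> m * (t / 64)"
        proof -
          have "card (U y - J) \<le> card V" using UV finV by (intro card_mono) auto
          then show ?thesis using t by (simp add: m_def mult_right_mono)
        qed
        finally have "m * t / 64 \<le> (\<Sum>u\<in>U y \<inter> J. real (new A u))"
          by simp
        then have "1 \<le> (\<Sum>u\<in>U y \<inter> J. real (new A u)) * (64 / (m * t))"
          using m t by (simp add: field_simps)
        also have "\<dots> = (\<Sum>u\<in>U y \<inter> J. c u)"
          by (simp add: c_def sum_distrib_left sum_divide_distrib mult.commute)
        \<comment> \<open>That \<open>u\<close> is unhit means that nothing in \<open>N u\<close> is
          sampled, so the known unsampled set grows to \<open>A \<union> N u\<close>.\<close>
        also have "\<dots> = (\<Sum>u\<in>U y \<inter> J. c u * indicator {y. y \<in> bad \<and> (\<forall>v\<in>A \<union> N u. y v < lev v)} y)"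
          using y by (intro sum.cong) (auto simp: U_def unhit_def indicator_def)
        also have "\<dots> \<le> (\<Sum>u\<in>J. c u * indicator {y. y \<in> bad \<and> (\<forall>v\<in>A \<union> N u. y v < lev v)} y)"
          using finJ c0 by (intro sum_mono2) auto
        finally show "1 \<le> (\<Sum>u\<in>J. c u * indicator {y. y \<in> bad \<and> (\<forall>v\<in>A \<union> N u. y v < lev v)} y)" .
      qed
      also have "\<dots> \<le> (\<Sum>u\<in>J. G (card A) / m)"
      proof (rule sum_mono)
        fix u assume u: "u \<in> J"
        have uV: "u \<in> V" using u by (simp add: J_def)
        have new0: "new A u > 0" using u t by (cases "new A u") (auto simp: J_def)
        have cd: "card (A \<union> N u) = card A + new A u"
          unfolding new_def using finA finN[OF uV] by (metis Un_Diff_cancel card_Un_disjoint Diff_disjoint finite_Diff)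
        have le: "card (A \<union> N u) \<le> card V" using less.prems N(1)[OF uV] finV by (intro card_mono) auto
        \<comment> \<open>The weight \<open>c u\<close> is \<open>s / m\<close>. By
          \<open>\<rho> * t \<ge> 256 / 3\<close> the exponent gains
          \<open>3/4 * \<rho> * new A u \<ge> s\<close>, and \<open>s \<le> exp s\<close> cancels
          the weight up to \<open>1 / m\<close>, which the sum over \<open>J\<close>
          absorbs.\<close>
        define s where "s = 64 * new A u / t"
        have s: "s \<ge> 1" using u t by (simp add: s_def J_def field_simps)
        have "s \<le> exp s" using exp_ge_add_one_self[of s] by linarith
        also have "\<dots> \<le> exp (\<rho> * (3/4 * real (new A u)))"
        proof -
          have "s * (256/3) \<le> s * (\<rho> * t)"
            using t(2) s by (intro mult_left_mono) auto
          also have "s * (\<rho> * t) = 64 * \<rho> * new A u"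
            using t by (simp add: s_def)
          finally show ?thesis by simp
        qed
        finally have e: "s * exp (- \<rho> * (3/4 * real (new A u))) \<le> 1"
          by (simp add: exp_minus field_simps)
        have "measure (geos I) {y. y \<in> bad \<and> (\<forall>v\<in>A \<union> N u. y v < lev v)} \<le> G (card (A \<union> N u))"
          using less.prems N(1)[OF uV] new0 cd le by (intro less.hyps) auto
        also have "\<dots> = G (card A) * exp (- \<rho> * (3/4 * real (new A u)))"
          unfolding G_def cd exp_add[symmetric] by (simp add: field_simps)
        finally have "c u * measure (geos I) {y. y \<in> bad \<and> (\<forall>v\<in>A \<union> N u. y v < lev v)} \<le>
           c u * (G (card A) * exp (- \<rho> * (3/4 * real (new A u))))"
          using c0 by (rule mult_left_mono)
        also have "\<dots> = (G (card A) / m) * (s * exp (- \<rho> * (3/4 * real (new A u))))"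
          by (simp add: c_def s_def)
        also have "\<dots> \<le> (G (card A) / m) * 1"
          using e m by (intro mult_left_mono) (auto simp: G_def)
        finally show "c u * measure (geos I) {y. y \<in> bad \<and> (\<forall>v\<in>A \<union> N u. y v < lev v)} \<le> G (card A) / m"
          by simp
      qed
      also have "\<dots> = (card J / m) * G (card A)"
        by simp
      also have "\<dots> \<le> 1 * G (card A)"
      proof (rule mult_right_mono)
        have "card J \<le> card V" using finV by (intro card_mono) (auto simp: J_def)
        then show "card J / m \<le> 1" using m by (simp add: m_def)
      qed (simp add: G_def)
      finally show ?thesis by simp
    qed
  qed
  show ?thesis
    using main[of "{}"] by (simp add: bad_def G_def m_def F_def U_def)
qed

section \<open>Balls of a relation and thin layers\<close>

definition nball :: "'a rel \<Rightarrow> nat \<Rightarrow> 'a \<Rightarrow> 'a set" where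
  "nball E r x = {y. \<exists>n\<le>r. (x, y) \<in> E ^^ n}"

lemma nball_refl [simp]: "x \<in> nball E r x"
  unfolding nball_def by (auto intro!: exI[of _ 0])

lemma nball_mono: "i \<le> j \<Longrightarrow> nball E i x \<subseteq> nball E j x"
  unfolding nball_def using le_trans by blast

lemma nball_trans:
  assumes "y \<in> nball E i x" "z \<in> nball E j y" "i + j \<le> k" shows "z \<in> nball E k x"
proof -
  obtain m n where "m \<le> i" "n \<le> j" "(x, y) \<in> E ^^ m" "(y, z) \<in> E ^^ n"
    using assms unfolding nball_def by auto
  then show ?thesis
    using assms(3) unfolding nball_def by (auto intro!: exI[of _ "m + n"] simp: relpow_add)
qed

lemma nball_1: "(x, y) \<in> E \<Longrightarrow> y \<in> nball E 1 x"
  unfolding nball_def by (auto intro!: exI[of _ 1])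

lemma sym_relpow: "sym E \<Longrightarrow> (x, y) \<in> E ^^ n \<Longrightarrow> (y, x) \<in> E ^^ n"
proof (induction n arbitrary: y)
  case (Suc n)
  then obtain z where "(x, z) \<in> E ^^ n" "(z, y) \<in> E" by auto
  then have "(z, x) \<in> E ^^ n" "(y, z) \<in> E" using Suc by (auto dest: symD)
  then show ?case by (rule relpow_Suc_I2[rotated])
qed auto

lemma nball_sym: "sym E \<Longrightarrow> y \<in> nball E r x \<longleftrightarrow> x \<in> nball E r y"
  unfolding nball_def mem_Collect_eq using sym_relpow[of E x y] sym_relpow[of E y x] by metis

text \<open>Pigeonhole: the \<open>n\<close> layers above \<open>f k\<close> are disjoint parts of
  \<open>f (k + n)\<close>, so the thinnest has at most the average size. This serves both the cut
  of a sampled ball and the growth of a cluster.\<close>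

lemma card_arg_min_layer:
  fixes f :: "nat \<Rightarrow> 'a set" and k n :: nat
  assumes "\<And>i j. i \<le> j \<Longrightarrow> f i \<subseteq> f j" "\<And>i. finite (f i)" "n > 0"
  defines "l \<equiv> arg_min_on (\<lambda>j. card (f j - f (j - 1))) {k+1..k+n}"
  shows "l \<in> {k+1..k+n}" "n * card (f l - f (l - 1)) \<le> card (f (k + n))"
proof -
  let ?g = "\<lambda>j. card (f j - f (j - 1))"
  show "l \<in> {k+1..k+n}"
    unfolding l_def using assms(3) by (intro arg_min_if_finite) auto
  have tele: "(\<Sum>j\<in>{k+1..k+i}. ?g j) + card (f k) = card (f (k + i))" for i
  proof (induction i)
    case (Suc i)
    have "f (k + i) \<subseteq> f (k + Suc i)"
      by (rule assms(1)) simp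
    then have "?g (k + Suc i) + card (f (k + i)) = card (f (k + Suc i))"
      using assms(2) by (simp add: card_Diff_subset card_mono)
    then show ?case using Suc by simp
  qed simp
  have "n * ?g l = (\<Sum>j\<in>{k+1..k+n}. ?g l)"
    by simp
  also have "\<dots> \<le> (\<Sum>j\<in>{k+1..k+n}. ?g j)"
    unfolding l_def using assms(3) by (intro sum_mono arg_min_least) auto
  also have "\<dots> \<le> card (f (k + n))"
    using tele[of n] by linarith
  finally show "n * ?g l \<le> card (f (k + n))" .
qed

section \<open>One round of carving\<close>

text \<open>Distances are measured in blocks of length \<open>2 h\<close>. \<open>A\<close> is the set of vertices that are still
  undecided.\<close>

locale carving =
  fixes h r R lam :: nat and E :: "nat rel" and A :: "nat set" and X G :: "nat \<Rightarrow> nat"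
begin

definition wid :: nat where "wid = 2 * r + R"

text \<open>Bounds the distance from a vertex to the centre of its cluster: at most \<open>h\<close>
  steps to a core vertex, then at most \<open>wid\<close> blocks to its owner.\<close>

definition reach :: nat where "reach = wid * (2 * h) + h"

text \<open>Only the members of the ball are restricted to \<open>A\<close>; walks may pass through
  decided vertices. Hence the diameter bound is a weak one.\<close>

definition bl :: "nat \<Rightarrow> nat \<Rightarrow> nat set" where
  "bl j u = nball E (j * (2 * h)) u \<inter> A"

definition bdist :: "nat \<Rightarrow> nat \<Rightarrow> nat" where
  "bdist w u = (LEAST j. u \<in> bl j w)"

text \<open>A vertex is sampled with probability \<open>1/2 ^ lev u\<close>, about \<open>lam\<close> divided by the size of its ball.\<close>

definition lev :: "nat \<Rightarrow> nat" where
  "lev u = (LEAST e. card (bl (2 * wid) u) \<le> 2 ^ (e + 1) * lam)"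

definition samp :: "nat set" where
  "samp = {u\<in>A. lev u \<le> X u}"

definition unc :: "nat set" where
  "unc = {u\<in>A. bl (2 * r) u \<inter> samp = {}}"

text \<open>The radii start above \<open>2 * r\<close>, so that a sampled ball covers every vertex
  that its centre keeps out of \<open>unc\<close>.\<close>

definition cut :: "nat \<Rightarrow> nat" where
  "cut u = arg_min_on (\<lambda>j. card (bl j u - bl (j - 1) u)) {2 * r + 1..2 * r + R}"

text \<open>Truncation at \<open>r\<close> bounds the balls deterministically, as locality requires;
  it has no effect as long as all \<open>G u\<close> are below \<open>r\<close>.\<close>

definition rad :: "nat \<Rightarrow> nat" where
  "rad u = (if u \<in> samp then cut u else min r (G u))"

definition cand :: "nat \<Rightarrow> nat set" where
  "cand w = {u\<in>samp \<union> unc. u \<in> bl (rad u) w}"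

definition own :: "nat \<Rightarrow> nat" where
  "own w = (if cand w \<inter> samp = {} then LEAST u. u \<in> cand w else LEAST u. u \<in> cand w \<inter> samp)"

text \<open>The margin of one block inside the owner's ball is the Linial-Saks rule that keeps cores
  of different owners apart.\<close>

definition core :: "nat set" where
  "core = {w\<in>A. cand w \<noteq> {} \<and> 0 < rad (own w) \<and> own w \<in> bl (rad (own w) - 1) w}"

definition nb :: "nat \<Rightarrow> nat \<Rightarrow> nat set" where
  "nb j c = {x\<in>A \<inter> nball E reach c. \<exists>w\<in>core. own w = c \<and> w \<in> nball E j x}"

definition grow :: "nat \<Rightarrow> nat" where
  "grow c = arg_min_on (\<lambda>j. card (nb j c - nb (j - 1) c)) {1..h}"

text \<open>A vertex has three possible fates: within distance \<open>grow c - 1\<close> of the core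
  of some centre \<open>c\<close> it joins the cluster of \<open>c\<close>, at distance exactly
  \<open>grow c\<close> it is deleted, and otherwise it stays undecided.\<close>

definition rest :: "nat set" where
  "rest = {x\<in>A. \<forall>c\<in>nball E reach x. x \<notin> nb (grow c) c}"

definition cluster :: "nat \<Rightarrow> nat set" where
  "cluster x = {c\<in>nball E reach x. x \<in> nb (grow c - 1) c}"

lemma rad_le: "R > 0 \<Longrightarrow> rad u \<le> wid"
  using arg_min_if_finite(1)[of "{2 * r + 1..2 * r + R}" "\<lambda>j. card (bl j u - bl (j - 1) u)"]
  by (auto simp: rad_def wid_def cut_def)

lemma grow_le: "h > 0 \<Longrightarrow> grow c \<le> h"
  using arg_min_if_finite(1)[of "{1..h}" "\<lambda>j. card (nb j c - nb (j - 1) c)"]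
  by (auto simp: grow_def)

lemma own_in_cand: "cand w \<noteq> {} \<Longrightarrow> own w \<in> cand w"
  unfolding own_def using LeastI_ex[of "\<lambda>u. u \<in> cand w"] LeastI_ex[of "\<lambda>u. u \<in> cand w \<inter> samp"] by auto

end

locale finite_carving = carving +
  assumes sym: "sym E" and fin: "finite A" and pos: "h > 0" "r > 0" "R > 0" "lam > 0"
begin

lemma bl_subset: "bl j u \<subseteq> A" and finite_bl [simp]: "finite (bl j u)"
  using fin by (auto simp: bl_def)

lemma bl_mono: "i \<le> j \<Longrightarrow> bl i u \<subseteq> bl j u"
  unfolding bl_def using nball_mono[OF mult_le_mono1, of i j E "2 * h" u] by auto

lemma bl_sym: "u \<in> A \<Longrightarrow> v \<in> A \<Longrightarrow> u \<in> bl j v \<longleftrightarrow> v \<in> bl j u"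
  unfolding bl_def using nball_sym[OF sym] by auto

lemma bl_trans: "u \<in> bl i v \<Longrightarrow> w \<in> bl j u \<Longrightarrow> i + j \<le> k \<Longrightarrow> w \<in> bl k v"
  unfolding bl_def using nball_trans[of u E "i * (2 * h)" v w "j * (2 * h)" "k * (2 * h)"]
  by (auto simp flip: add_mult_distrib)

lemma bl_refl [simp]: "u \<in> A \<Longrightarrow> u \<in> bl j u"
  by (auto simp: bl_def)

lemma samp_subset: "samp \<subseteq> A" and unc_subset: "unc \<subseteq> A"
  by (auto simp: samp_def unc_def)

lemma finite_samp [simp]: "finite samp" and finite_unc [simp]: "finite unc"
  using samp_subset unc_subset fin finite_subset by auto

lemma unc_not_samp: "u \<in> unc \<Longrightarrow> u \<notin> samp"
  using bl_refl[of u "2 * r"] by (fastforce simp: unc_def simp del: bl_refl)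

lemma cut_bounds: "2 * r + 1 \<le> cut u" "cut u \<le> wid"
  and card_cut: "R * card (bl (cut u) u - bl (cut u - 1) u) \<le> card (bl wid u)"
  using card_arg_min_layer[of "\<lambda>j. bl j u" R "2 * r"] pos bl_mono by (auto simp: cut_def wid_def)

lemma cand_unc: "w \<in> A \<Longrightarrow> w \<notin> unc \<Longrightarrow> cand w \<inter> samp \<noteq> {}"
proof -
  assume w: "w \<in> A" "w \<notin> unc"
  then obtain u where u: "u \<in> bl (2 * r) w" "u \<in> samp" by (auto simp: unc_def)
  then have "u \<in> bl (rad u) w"
    using bl_mono[of "2 * r" "cut u"] cut_bounds[of u] by (auto simp: rad_def)
  then show ?thesis using u by (auto simp: cand_def)
qed

lemma cand_nonempty: "w \<in> A \<Longrightarrow> cand w \<noteq> {}"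
proof (cases "w \<in> unc")
  case True
  then have "w \<in> cand w" using unc_subset by (auto simp: cand_def)
  then show ?thesis by auto
qed (use cand_unc in auto)

text \<open>The order in which \<open>own w\<close> is the least candidate.\<close>

definition before :: "nat \<Rightarrow> nat \<Rightarrow> bool" where
  "before u v \<longleftrightarrow> (u \<in> samp \<and> v \<notin> samp) \<or> ((u \<in> samp \<longleftrightarrow> v \<in> samp) \<and> u < v)"

lemma before_total: "u \<noteq> v \<Longrightarrow> before u v \<or> before v u"
  by (auto simp: before_def)

lemma own_samp_iff: "cand w \<noteq> {} \<Longrightarrow> own w \<in> samp \<longleftrightarrow> cand w \<inter> samp \<noteq> {}"
  unfolding own_def using LeastI_ex[of "\<lambda>u. u \<in> cand w"] LeastI_ex[of "\<lambda>u. u \<in> cand w \<inter> samp"] by auto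

lemma own_first: "u \<in> cand w \<Longrightarrow> \<not> before u (own w)"
proof -
  assume u: "u \<in> cand w"
  show ?thesis
  proof (cases "cand w \<inter> samp = {}")
    case True
    then have "own w \<le> u" "own w \<notin> samp" "u \<notin> samp"
      using u own_samp_iff[of w] by (auto simp: own_def intro: Least_le)
    then show ?thesis by (auto simp: before_def)
  next
    case False
    then have "own w \<in> samp" using u own_samp_iff[of w] by auto
    moreover have "own w \<le> u" if "u \<in> samp"
      using False u that by (auto simp: own_def intro: Least_le)
    ultimately show ?thesis by (auto simp: before_def)
  qed
qed

text \<open>Let \<open>own w\<close> come before \<open>own w'\<close>. If \<open>w'\<close> were
  within one block of \<open>w\<close>, the spare block at \<open>w\<close> would make
  \<open>own w\<close> a candidate of \<open>w'\<close>, which would then not have chosen a later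
  one.\<close>

lemma core_separated:
  assumes "w \<in> core" "w' \<in> core" "own w \<noteq> own w'"
  shows "w' \<notin> nball E (2 * h) w"
proof -
  have *: "w' \<notin> nball E (2 * h) w" if "w \<in> core" "w' \<in> core" "before (own w) (own w')" for w w'
  proof
    assume d: "w' \<in> nball E (2 * h) w"
    let ?u = "own w"
    have u: "?u \<in> samp \<union> unc" "?u \<in> bl (rad ?u - 1) w" "rad ?u > 0"
      using that own_in_cand[of w] by (auto simp: core_def cand_def)
    have "w' \<in> A" "w \<in> A" using that by (auto simp: core_def)
    then have "w \<in> bl 1 w'" using d nball_sym[OF sym] by (auto simp: bl_def)
    then have "?u \<in> bl (rad ?u) w'" by (rule bl_trans[of w 1 w' ?u "rad ?u - 1"]) (use u in auto)
    then have "?u \<in> cand w'" using u by (auto simp: cand_def)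
    then show False using own_first that by blast
  qed
  show ?thesis
    using *[of w w'] *[of w' w] assms before_total[OF assms(3)] nball_sym[OF sym] by blast
qed

lemma core_subset: "core \<subseteq> A" and finite_core [simp]: "finite core"
  using fin finite_subset[of core A] by (auto simp: core_def)

lemma own_reach: "w \<in> core \<Longrightarrow> own w \<in> nball E (wid * (2 * h)) w"
  using nball_mono[of "(rad (own w) - 1) * (2 * h)" "wid * (2 * h)" E w] rad_le[OF pos(3), of "own w"]
  by (force simp: core_def bl_def)

lemma nb_iff:
  assumes "j \<le> h"
  shows "x \<in> nb j c \<longleftrightarrow> x \<in> A \<and> (\<exists>w\<in>core. own w = c \<and> w \<in> nball E j x)"
    and "x \<in> nb j c \<Longrightarrow> c \<in> nball E reach x"
proof -
  have 1: "c \<in> nball E reach x" if "w \<in> core" "own w = c" "w \<in> nball E j x" for w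
    using nball_trans[OF that(3), of c "wid * (2 * h)" reach] own_reach that assms by (auto simp: reach_def)
  show "x \<in> nb j c \<longleftrightarrow> x \<in> A \<and> (\<exists>w\<in>core. own w = c \<and> w \<in> nball E j x)"
    using 1 nball_sym[OF sym] by (auto simp: nb_def)
  then show "x \<in> nb j c \<Longrightarrow> c \<in> nball E reach x"
    using 1 by auto
qed

lemma nb_mono: "i \<le> j \<Longrightarrow> nb i c \<subseteq> nb j c"
  unfolding nb_def using nball_mono[of i j E] by blast

lemma nb_subset: "nb j c \<subseteq> A" and finite_nb [simp]: "finite (nb j c)"
  using fin finite_subset[of "nb j c" A] by (auto simp: nb_def)

text \<open>Two core vertices within \<open>h\<close> of \<open>x\<close> are within one block of
  each other, so \<open>core_separated\<close> gives them the same owner. This is why a block has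
  length \<open>2 * h\<close>.\<close>

lemma nb_unique:
  assumes "x \<in> nb i c" "x \<in> nb j c'" "i \<le> h" "j \<le> h" shows "c = c'"
proof (rule ccontr)
  assume ne: "c \<noteq> c'"
  obtain w w' where w: "w \<in> core" "own w = c" "w \<in> nball E i x" "w' \<in> core" "own w' = c'" "w' \<in> nball E j x"
    using assms by (auto simp: nb_def)
  have "w' \<in> nball E (2 * h) w"
    by (rule nball_trans[of x E i w w' j]) (use w assms nball_sym[OF sym] in auto)
  then show False using core_separated[of w w'] w ne by auto
qed

lemma grow_bounds: "1 \<le> grow c" "grow c \<le> h"
  and card_grow: "h * card (nb (grow c) c - nb (grow c - 1) c) \<le> card (nb h c)"
  using card_arg_min_layer[of "\<lambda>j. nb j c" h 0] pos nb_mono by (auto simp: grow_def)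

lemma rest_iff: "x \<in> rest \<longleftrightarrow> x \<in> A \<and> (\<forall>c. x \<notin> nb (grow c) c)"
  using nb_iff(2) grow_bounds by (fastforce simp: rest_def)

lemma cluster_iff: "c \<in> cluster x \<longleftrightarrow> x \<in> nb (grow c - 1) c"
  using nb_iff(2)[of "grow c - 1" x c] grow_bounds[of c] by (auto simp: cluster_def)

lemma cluster_reach: "c \<in> cluster x \<Longrightarrow> c \<in> nball E reach x"
  by (auto simp: cluster_def)

lemma cluster_subset: "c \<in> cluster x \<Longrightarrow> x \<in> A"
  using nb_subset by (auto simp: cluster_def)

lemma cluster_unique: "c \<in> cluster x \<Longrightarrow> c' \<in> cluster x \<Longrightarrow> c = c'"
  unfolding cluster_iff by (erule (1) nb_unique) (use grow_bounds le_diff_conv trans_le_add1 in blast)+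

lemma cluster_not_rest: "c \<in> cluster x \<Longrightarrow> x \<notin> rest"
  using nb_mono[of "grow c - 1" "grow c" c] by (auto simp: rest_iff cluster_iff)

text \<open>A neighbour of a vertex within \<open>grow c - 1\<close> of the core is within
  \<open>grow c\<close> of it, hence in the same cluster or in the deleted layer, which shields the
  cluster from the others and from later rounds.\<close>

lemma cluster_neighbour:
  assumes c: "c \<in> cluster x" and xy: "(x, y) \<in> E" and y: "y \<in> A"
  shows "y \<notin> rest" "c' \<in> cluster y \<Longrightarrow> c' = c"
proof -
  have g: "1 \<le> grow c" "grow c \<le> h" "grow c - 1 \<le> h" using grow_bounds[of c] by auto
  obtain w where w: "w \<in> core" "own w = c" "w \<in> nball E (grow c - 1) x"
    using c g by (auto simp: cluster_iff nb_iff(1))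
  have "w \<in> nball E (grow c) y"
    by (rule nball_trans[of x E 1 y w "grow c - 1"]) (use w g nball_1[OF xy] nball_sym[OF sym] in auto)
  then have *: "y \<in> nb (grow c) c"
    using w g y by (auto simp: nb_iff(1))
  then show "y \<notin> rest" by (auto simp: rest_iff)
  show "c' = c" if "c' \<in> cluster y"
    using nb_unique[OF _ *] that g grow_bounds[of c'] unfolding cluster_iff by auto
qed

text \<open>By \<open>nb_unique\<close> the sets \<open>nb h c\<close> are disjoint for different
  centres, and each loses a layer of at most a \<open>1/h\<close> fraction of its size.\<close>

lemma card_deleted: "h * card {x\<in>A - rest. cluster x = {}} \<le> card A"
proof -
  let ?C = "own ` core"
  let ?L = "\<lambda>c. nb (grow c) c - nb (grow c - 1) c"
  have sub: "{x\<in>A - rest. cluster x = {}} \<subseteq> (\<Union>c\<in>?C. ?L c)"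
  proof
    fix x assume "x \<in> {x\<in>A - rest. cluster x = {}}"
    then obtain c where c: "x \<in> nb (grow c) c" "c \<notin> cluster x" by (auto simp: rest_iff)
    then have "c \<in> ?C" by (auto simp: nb_def)
    with c show "x \<in> (\<Union>c\<in>?C. ?L c)" by (auto simp: cluster_iff)
  qed
  have "h * card {x\<in>A - rest. cluster x = {}} \<le> h * card (\<Union>c\<in>?C. ?L c)"
    using sub by (intro mult_le_mono2 card_mono) auto
  also have "\<dots> \<le> h * (\<Sum>c\<in>?C. card (?L c))"
    by (intro mult_le_mono2 card_UN_le) auto
  also have "\<dots> \<le> (\<Sum>c\<in>?C. card (nb h c))"
    unfolding sum_distrib_left by (intro sum_mono card_grow)
  also have "\<dots> = card (\<Union>c\<in>?C. nb h c)"
    using nb_unique[of _ h _ h] by (intro card_UN_disjoint[symmetric]) auto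
  also have "\<dots> \<le> card A"
    using fin nb_subset by (intro card_mono) auto
  finally show ?thesis .
qed

lemma card_rest: "card rest \<le> card (A - core)"
proof (rule card_mono)
  have "w \<in> nb (grow (own w)) (own w)" if "w \<in> core" for w
    using that grow_bounds[of "own w"] core_subset by (auto simp: nb_iff(1))
  then show "rest \<subseteq> A - core" by (fastforce simp: rest_iff)
qed (use fin in auto)

text \<open>Such a vertex lies in the cut layer of its owner, which is at most \<open>1/R\<close> of
  \<open>bl wid u\<close>. Counting pairs of a vertex and a sample within \<open>wid\<close> from
  both sides, these balls have total size at most \<open>8 * lam * card A\<close>, and
  \<open>R = 64 * lam\<close> leaves 1/8.\<close>

lemma card_cut_by_sample:
  assumes few: "\<And>w. w \<in> A \<Longrightarrow> card (bl wid w \<inter> samp) \<le> 8 * lam" and R: "R = 64 * lam"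
  shows "8 * card {w\<in>A - core. own w \<in> samp} \<le> card A"
proof -
  let ?L = "\<lambda>u. bl (cut u) u - bl (cut u - 1) u"
  have sub: "{w\<in>A - core. own w \<in> samp} \<subseteq> (\<Union>u\<in>samp. ?L u)"
  proof
    fix w assume w: "w \<in> {w\<in>A - core. own w \<in> samp}"
    let ?u = "own w"
    have u: "?u \<in> bl (cut ?u) w" "?u \<in> A" "rad ?u = cut ?u"
      using own_in_cand[OF cand_nonempty, of w] w samp_subset by (auto simp: cand_def rad_def)
    have "?u \<notin> bl (cut ?u - 1) w"
      using w u cut_bounds[of ?u] cand_nonempty[of w] by (auto simp: core_def)
    then show "w \<in> (\<Union>u\<in>samp. ?L u)"
      using u w bl_sym[of w ?u] by auto
  qed
  have "R * card {w\<in>A - core. own w \<in> samp} \<le> R * (\<Sum>u\<in>samp. card (?L u))"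
    using card_mono[OF _ sub] card_UN_le[of samp ?L] finite_samp
    by (intro mult_le_mono2) (meson finite_Diff finite_UN_I finite_bl order_trans)
  also have "\<dots> \<le> (\<Sum>u\<in>samp. card (bl wid u))"
    unfolding sum_distrib_left by (intro sum_mono card_cut)
  also have "\<dots> = (\<Sum>u\<in>samp. card {w\<in>A. w \<in> bl wid u})"
    using bl_subset by (intro sum.cong arg_cong[where f = card]) auto
  also have "\<dots> = (\<Sum>w\<in>A. card {u\<in>samp. w \<in> bl wid u})"
    using sum.swap_restrict[OF finite_samp fin, where g = "\<lambda>_ _. 1::nat" and R = "\<lambda>u w. w \<in> bl wid u"] by simp
  also have "\<dots> \<le> (\<Sum>w\<in>A. 8 * lam)"
  proof (rule sum_mono)
    fix w assume w: "w \<in> A"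
    then have "{u\<in>samp. w \<in> bl wid u} = bl wid w \<inter> samp" using bl_sym samp_subset by blast
    then show "card {u\<in>samp. w \<in> bl wid u} \<le> 8 * lam" using few w by simp
  qed
  finally show ?thesis using R pos by simp
qed

text \<open>Without a sampled candidate, the owner is the smallest centre whose ball reaches
  \<open>w\<close>, and outside the core it reaches \<open>w\<close> only with its boundary. As all
  radii are below \<open>r\<close>, centres in \<open>bl r w\<close> decide this, so that far-apart
  vertices depend on disjoint sets of radii.\<close>

lemma uncovered_grazed:
  assumes w: "w \<in> A - core" "own w \<notin> samp" and G: "\<And>u. u \<in> A \<Longrightarrow> G u < r"
  shows "w \<in> unc" "grazed (unc \<inter> bl r w) (bdist w) G"
proof -
  let ?u = "own w"
  have ne: "cand w \<noteq> {}" using w cand_nonempty by auto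
  have no: "cand w \<inter> samp = {}" using w own_samp_iff[OF ne] by auto
  show "w \<in> unc" using no w cand_unc by auto
  have rad: "rad u = G u" if "u \<in> unc" for u
    using that G[of u] unc_subset unc_not_samp by (auto simp: rad_def)
  have u: "?u \<in> unc" "?u \<in> bl (G ?u) w"
    using own_in_cand[OF ne] w rad[of ?u] by (auto simp: cand_def)
  have least: "bdist w v \<le> j" if "v \<in> bl j w" for v j
    using that unfolding bdist_def by (rule Least_le)
  have at: "v \<in> bl (bdist w v) w" if "v \<in> bl j w" for v j
    using that unfolding bdist_def by (rule LeastI)
  have "G ?u = bdist w ?u"
  proof (rule ccontr)
    assume "G ?u \<noteq> bdist w ?u"
    then have lt: "bdist w ?u < G ?u" using least[OF u(2)] by auto
    then have "bdist w ?u \<le> G ?u - 1" by linarith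
    then have "?u \<in> bl (G ?u - 1) w" using at[OF u(2)] bl_mono by blast
    then have "w \<in> core" using w ne lt rad[OF u(1)] by (auto simp: core_def)
    then show False using w by auto
  qed
  moreover have "?u \<in> bl r w"
    using u G[of ?u] unc_subset bl_mono[of "G ?u" r] by (auto simp: less_imp_le subset_iff)
  moreover have "G v < bdist w v" if "v \<in> unc \<inter> bl r w" "v < ?u" for v
  proof (rule ccontr)
    assume "\<not> G v < bdist w v"
    then have "v \<in> bl (G v) w" using at[of v r] that bl_mono[of "bdist w v" "G v" w] by auto
    then have "v \<in> cand w" using that rad[of v] by (auto simp: cand_def)
    then show False using own_first[of v w] that w unc_not_samp by (auto simp: before_def)
  qed
  ultimately show "grazed (unc \<inter> bl r w) (bdist w) G"
    using u by (auto simp: grazed_def)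
qed

lemma card_rest_le:
  assumes "\<And>w. w \<in> A \<Longrightarrow> card (bl wid w \<inter> samp) \<le> 8 * lam" "R = 64 * lam" "\<And>u. u \<in> A \<Longrightarrow> G u < r"
  shows "8 * card rest \<le> card A + 8 * card {w\<in>unc. grazed (unc \<inter> bl r w) (bdist w) G}"
proof -
  have "A - core \<subseteq> {w\<in>A - core. own w \<in> samp} \<union> {w\<in>unc. grazed (unc \<inter> bl r w) (bdist w) G}"
    using uncovered_grazed assms(3) by blast
  then have "card (A - core) \<le> card ({w\<in>A - core. own w \<in> samp} \<union> {w\<in>unc. grazed (unc \<inter> bl r w) (bdist w) G})"
    using fin by (intro card_mono) auto
  also have "\<dots> \<le> card {w\<in>A - core. own w \<in> samp} + card {w\<in>unc. grazed (unc \<inter> bl r w) (bdist w) G}"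
    by (rule card_Un_le)
  finally show ?thesis
    using card_cut_by_sample[OF assms(1,2)] card_rest by linarith
qed

end

section \<open>Failure probability of one round\<close>

text \<open>The constants: \<open>R\<close> limits the loss at sampled balls to 1/8;
  \<open>lam / 80 = 87.5 * s\<close> exceeds \<open>256 / 3 * s\<close>, as
  \<open>prob_many_crowded\<close> requires for the \<open>t\<close> below; and
  \<open>r = 3 * s\<close> makes a union bound over at most \<open>exp s\<close> radii
  succeed.\<close>

locale alive_set =
  fixes h r R lam s :: nat and E :: "nat rel" and A :: "nat set"
  assumes sym: "sym E" and fin: "finite A" and ne: "A \<noteq> {}" and pos: "h > 0" "s > 0"
    and r: "r = 3 * s" and lam: "lam = 7000 * s" and R: "R = 64 * lam"
begin

lemma finite_carving: "finite_carving h r R lam E A"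
  by unfold_locales (use sym fin pos r lam R in auto)

sublocale C: finite_carving h r R lam E A X G for X G
  by (rule finite_carving)

abbreviation "lev \<equiv> carving.lev h r R lam E A"
abbreviation "samp \<equiv> carving.samp h r R lam E A"
abbreviation "unc \<equiv> carving.unc h r R lam E A"
abbreviation "bl \<equiv> carving.bl h E A"
abbreviation "wid \<equiv> carving.wid r R"
abbreviation "rest \<equiv> carving.rest h r R lam E A"
abbreviation "bdist \<equiv> carving.bdist h E A"

text \<open>Chosen so that the \<open>5 * s\<close> picks in \<open>prob_lost\<close> rule out at
  most \<open>5 * s * t = card A / 16\<close> vertices.\<close>

definition t :: real where "t = real (card A) / (80 * real s)"

definition crowded :: "(nat \<Rightarrow> nat) \<Rightarrow> nat set" where
  "crowded X = {w\<in>unc X. t < real (card (bl (2 * r) w \<inter> unc X))}"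

definition bad_sample :: "(nat \<Rightarrow> nat) \<Rightarrow> bool" where
  "bad_sample X \<longleftrightarrow> (\<exists>w\<in>A. 8 * lam < card (bl wid w \<inter> samp X)) \<or> real (card A) / 16 \<le> real (card (crowded X))"

definition lost :: "(nat \<Rightarrow> nat) \<Rightarrow> (nat \<Rightarrow> nat) \<Rightarrow> nat set" where
  "lost X G = {w\<in>unc X - crowded X. grazed (unc X \<inter> bl r w) (bdist w) G}"

text \<open>The budget of a round: 1/8 for the cuts of sampled balls, 1/16 for crowded vertices,
  11/16 for the other grazed ones, together 7/8. The expectation of the last is at most half of
  \<open>card A\<close>; the rest is room for concentration.\<close>

definition bad_radii :: "(nat \<Rightarrow> nat) \<Rightarrow> (nat \<Rightarrow> nat) \<Rightarrow> bool" where
  "bad_radii X G \<longleftrightarrow> (\<exists>u\<in>A. r \<le> G u) \<or> 11/16 * real (card A) \<le> real (card (lost X G))"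

lemma card_pos: "0 < card A"
  using fin ne by (simp add: card_gt_0_iff)

lemma card_rest_le:
  assumes "\<not> bad_sample X" "\<not> bad_radii X G"
  shows "8 * card (rest X G) \<le> 7 * card A"
proof -
  let ?g = "{w\<in>unc X. grazed (unc X \<inter> bl r w) (bdist w) G}"
  have "8 * card (rest X G) \<le> card A + 8 * card ?g"
    using assms by (intro C.card_rest_le[OF _ R]) (auto simp: bad_sample_def bad_radii_def not_le not_less)
  moreover have "card ?g \<le> card (crowded X \<union> lost X G)"
    by (rule card_mono) (use finite_subset[OF _ C.finite_unc] in \<open>auto simp: lost_def crowded_def\<close>)
  moreover have "card (crowded X \<union> lost X G) \<le> card (crowded X) + card (lost X G)"
    by (rule card_Un_le)
  moreover have "real (card (crowded X)) < card A / 16" "real (card (lost X G)) < 11/16 * real (card A)"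
    using assms by (auto simp: bad_sample_def bad_radii_def)
  ultimately have "real (8 * card (rest X G)) \<le> real (7 * card A)"
    by linarith
  then show ?thesis by linarith
qed

lemma card_bl_le: "card (bl (2 * wid) u) \<le> 2 ^ (lev u + 1) * lam"
proof -
  let ?n = "card (bl (2 * wid) u)"
  have "?n \<le> 2 ^ (?n + 1)"
    using less_exp[of "?n + 1"] by linarith
  also have "\<dots> \<le> 2 ^ (?n + 1) * lam"
    using pos lam by simp
  finally show ?thesis
    unfolding C.lev_def by (rule LeastI)
qed

lemma less_card_bl: "lev u > 0 \<Longrightarrow> 2 ^ lev u * lam < card (bl (2 * wid) u)"
proof -
  assume "lev u > 0"
  then have "lev u - 1 < lev u" "lev u - 1 + 1 = lev u" by auto
  then show ?thesis
    using not_less_Least[of "lev u - 1" "\<lambda>e. card (bl (2 * wid) u) \<le> 2 ^ (e + 1) * lam"]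
    unfolding C.lev_def[symmetric] by (metis not_le)
qed

text \<open>For \<open>u\<close> in \<open>bl wid w\<close> the ball of radius
  \<open>2 * wid\<close> around \<open>u\<close>, which sets its level, contains all of
  \<open>bl wid w\<close>. So \<open>u\<close> is sampled with probability at most
  \<open>2 * lam / card (bl wid w)\<close>, the expected count is at most \<open>2 * lam\<close>,
  and the moment bound gives \<open>(exp 4 / 2 ^ 8) ^ lam\<close>.\<close>

lemma prob_many_sampled:
  assumes I: "finite I" "A \<subseteq> I" and w: "w \<in> A"
  shows "measure (geos I) {X. 8 * lam < card (bl wid w \<inter> samp X)} \<le> (1/2) ^ lam"
proof -
  let ?S = "bl wid w"
  have S: "?S \<noteq> {}" "?S \<subseteq> A" using w C.bl_subset C.bl_refl[OF w] by blast+
  have "measure (geos I) {X. 8 * lam < card (?S \<inter> samp X)} \<le> measure (geos I) {X. 8 * lam \<le> card {u\<in>?S. lev u \<le> X u}}"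
  proof (rule measure_pmf.finite_measure_mono)
    have "?S \<inter> samp X = {u\<in>?S. lev u \<le> X u}" for X
      using S by (auto simp: C.samp_def)
    then show "{X. 8 * lam < card (?S \<inter> samp X)} \<subseteq> {X. 8 * lam \<le> card {u\<in>?S. lev u \<le> X u}}"
      by auto
  qed auto
  also have "\<dots> \<le> (\<Prod>u\<in>?S. 1 + 2 * (1/2) ^ lev u) / 2 ^ (8 * lam)"
    using I S by (intro prob_sampled_card_ge) auto
  also have "\<dots> \<le> exp (4 * real lam) / 2 ^ (8 * lam)"
  proof (rule divide_right_mono)
    have "(\<Prod>u\<in>?S. 1 + 2 * (1/2) ^ lev u) \<le> (\<Prod>u\<in>?S. exp (4 * real lam / real (card ?S)))"
    proof (intro prod_mono conjI)
      fix u assume u: "u \<in> ?S"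
      have "?S \<subseteq> bl (2 * wid) u"
        using u w S C.bl_sym[of u w wid] C.bl_trans[of w wid u _ wid "2 * wid"] by auto
      then have "card ?S \<le> card (bl (2 * wid) u)"
        by (intro card_mono) auto
      also have "\<dots> \<le> 2 ^ (lev u + 1) * lam"
        by (rule card_bl_le)
      finally have "real (card ?S) \<le> real (2 ^ (lev u + 1) * lam)"
        by (rule of_nat_mono)
      then have "2 * (1/2) ^ lev u \<le> 4 * real lam / real (card ?S)"
        using S by (simp add: field_simps power_one_over card_gt_0_iff)
      then show "1 + 2 * (1/2) ^ lev u \<le> exp (4 * real lam / real (card ?S))"
        using exp_ge_add_one_self[of "4 * real lam / real (card ?S)"] by linarith
    qed auto
    also have "\<dots> = exp (4 * real lam)"
      using S by (simp flip: exp_of_nat_mult add: card_gt_0_iff)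
    finally show "(\<Prod>u\<in>?S. 1 + 2 * (1/2) ^ lev u) \<le> exp (4 * real lam)" .
  qed auto
  also have "\<dots> = (exp 1 ^ 4 / 2 ^ 8) ^ lam"
    by (simp add: power_divide power_mult flip: exp_of_nat_mult)
  also have "\<dots> \<le> (1/2) ^ lam"
  proof (rule power_mono)
    have "exp 1 ^ 4 \<le> (3::real) ^ 4"
      using exp_le by (intro power_mono) auto
    then show "exp 1 ^ 4 / 2 ^ 8 \<le> (1/2 :: real)" by simp
  qed auto
  finally show ?thesis .
qed

lemma unhit_eq: "unhit (bl (2 * r)) lev A X = unc X"
proof -
  have "unhit (bl (2 * r)) lev A X = {u\<in>A. \<forall>v\<in>bl (2 * r) u. \<not> lev v \<le> X v}"
    by (auto simp: unhit_def not_le)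
  also have "\<dots> = unc X"
    using C.bl_subset unfolding C.unc_def C.samp_def by blast
  finally show ?thesis .
qed

text \<open>\<open>prob_many_crowded\<close> with \<open>\<rho> = lam / card A\<close>: vertices of
  level 0 are always sampled, and the others with probability at least \<open>\<rho>\<close>,
  because no ball exceeds \<open>A\<close>.\<close>

lemma prob_crowded:
  assumes I: "finite I" "A \<subseteq> I"
  shows "measure (geos I) {X. real (card A) / 16 \<le> real (card (crowded X))} \<le> exp (- real s)"
proof -
  have "measure (geos I) {X. real (card A) / 16 \<le> real (card {w\<in>unhit (bl (2 * r)) lev A X. t < real (card (bl (2 * r) w \<inter> unhit (bl (2 * r)) lev A X))})}
    \<le> exp (- (real lam / real (card A)) * real (card A) / 128)"
  proof (rule prob_many_crowded[OF I])
    show "1 - (1/2) ^ lev u \<le> exp (- (real lam / real (card A)))" if "u \<in> A" for u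
    proof (cases "lev u = 0")
      case False
      have "2 ^ lev u * lam < card (bl (2 * wid) u)"
        using False by (intro less_card_bl) auto
      also have "\<dots> \<le> card A"
        using fin C.bl_subset by (intro card_mono) auto
      finally have "real (2 ^ lev u * lam) \<le> real (card A)"
        by linarith
      then have "lam / card A \<le> (1/2) ^ lev u"
        using card_pos by (simp add: field_simps power_one_over)
      then show ?thesis
        using exp_ge_add_one_self[of "- (lam / card A)"] by linarith
    qed simp
    show "256 / 3 \<le> real lam / real (card A) * t"
      using pos card_pos lam by (simp add: t_def)
    show "u \<in> bl (2 * r) v" if "u \<in> A" "v \<in> bl (2 * r) u" for u v
      using that C.bl_subset C.bl_sym by blast
    show "0 < t"
      using pos card_pos by (simp add: t_def)
  qed (use C.bl_subset ne in auto)
  also have "\<dots> \<le> exp (- real s)"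
    using card_pos lam by simp
  finally show ?thesis
    unfolding unhit_eq crowded_def .
qed

lemma prob_bad_sample:
  assumes I: "finite I" "A \<subseteq> I"
  shows "measure (geos I) {X. bad_sample X} \<le> real (card A) * (1/2) ^ lam + exp (- real s)"
proof -
  have "{X. bad_sample X} = (\<Union>w\<in>A. {X. 8 * lam < card (bl wid w \<inter> samp X)}) \<union> {X. real (card A) / 16 \<le> real (card (crowded X))}"
    by (auto simp: bad_sample_def)
  then have "measure (geos I) {X. bad_sample X} \<le>
      measure (geos I) (\<Union>w\<in>A. {X. 8 * lam < card (bl wid w \<inter> samp X)}) + measure (geos I) {X. real (card A) / 16 \<le> real (card (crowded X))}"
    by (simp add: measure_Un_le)
  also have "measure (geos I) (\<Union>w\<in>A. {X. 8 * lam < card (bl wid w \<inter> samp X)}) \<le>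
     (\<Sum>w\<in>A. measure (geos I) {X. 8 * lam < card (bl wid w \<inter> samp X)})"
    by (rule measure_UNION_le) (use fin in auto)
  also have "\<dots> \<le> (\<Sum>w\<in>A. (1/2) ^ lam)"
    using prob_many_sampled[OF I] by (intro sum_mono)
  finally show ?thesis
    using prob_crowded[OF I] by simp
qed

text \<open>\<open>prob_many_le\<close> with \<open>k = 5 * s\<close>, \<open>q = 1/2\<close> and
  conflict radius \<open>2 * r\<close>, beyond which the balls of radius \<open>r\<close> that
  govern grazing are disjoint. Without the crowded vertices, each vertex has at most
  \<open>t\<close> conflicts.\<close>

lemma prob_lost:
  assumes I: "finite I" "A \<subseteq> I"
  shows "measure (geos I) {G. 11/16 * real (card A) \<le> real (card (lost X G))} \<le> exp (- real s)"
proof -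
  define W where "W = unc X - crowded X"
  have WA: "W \<subseteq> A" using C.unc_subset by (auto simp: W_def)
  have "measure (geos I) {G. 11/16 * real (card A) \<le> real (card {w\<in>W. grazed (unc X \<inter> bl r w) (bdist w) G})}
     \<le> (real (card A) * (1/2) / (11/16 * real (card A) - real (5 * s) * t)) ^ (5 * s)"
  proof (rule prob_many_le[where N = "bl (2 * r)"])
    show "finite W" using WA fin finite_subset by auto
    show "real (card W) \<le> card A" using WA fin by (simp add: card_mono)
    show "w \<in> bl (2 * r) w" if "w \<in> W" for w using that WA by auto
    show "real (card (bl (2 * r) w \<inter> W)) \<le> t" if "w \<in> W" for w
    proof -
      have "card (bl (2 * r) w \<inter> W) \<le> card (bl (2 * r) w \<inter> unc X)"
        by (intro card_mono) (auto simp: W_def)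
      then show ?thesis using that by (auto simp: W_def crowded_def)
    qed
    show "measure (geos I) {y. \<forall>w\<in>T. grazed (unc X \<inter> bl r w) (bdist w) y} \<le> (1/2) ^ card T"
      if T: "T \<subseteq> W" "\<And>v w. v \<in> T \<Longrightarrow> w \<in> T \<Longrightarrow> v \<noteq> w \<Longrightarrow> v \<notin> bl (2 * r) w" for T
    proof (rule prob_all_grazed[OF I(1)])
      show "finite T" using finite_subset[OF subset_trans[OF T(1) WA] fin] .
      show "unc X \<inter> bl r w \<subseteq> I" for w using I C.unc_subset by blast
      show "(unc X \<inter> bl r v) \<inter> (unc X \<inter> bl r w) = {}" if vw: "v \<in> T" "w \<in> T" "v \<noteq> w" for v w
      proof -
        have False if u: "u \<in> bl r v" "u \<in> bl r w" for u
        proof -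
          have "u \<in> A" "v \<in> A" using subsetD[OF C.bl_subset u(1)] subsetD[OF WA subsetD[OF T(1) vw(1)]] .
          then have "v \<in> bl r u" using u(1) C.bl_sym[of u v r] by simp
          then have "v \<in> bl (2 * r) w" using u(2) C.bl_trans[of u r w v r "2 * r"] by simp
          then show False using T(2)[OF vw] by simp
        qed
        then show ?thesis by auto
      qed
    qed
    show "w \<in> bl (2 * r) v" if "v \<in> W" "w \<in> W" "v \<in> bl (2 * r) w" for v w
      using that WA C.bl_sym by blast
    show "real (5 * s) * t < 11/16 * real (card A)" using pos card_pos by (simp add: t_def)
    show "0 \<le> t" by (simp add: t_def)
  qed simp
  also have "11/16 * real (card A) - real (5 * s) * t = 10/16 * real (card A)"
    using pos by (simp add: t_def field_simps)
  \<comment> \<open>The ratio 4/5 explains the five picks per unit of \<open>s\<close>: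
    \<open>(4/5) ^ 5 < 1/3 \<le> exp (-1)\<close>.\<close>
  also have "(real (card A) * (1/2) / (10/16 * real (card A))) ^ (5 * s) = ((4/5) ^ 5) ^ s"
    using card_pos by (simp add: power_mult)
  also have "\<dots> \<le> exp (-1) ^ s"
  proof (rule power_mono)
    have "exp (-1) \<ge> (1/3 :: real)" using exp_le by (simp add: exp_minus field_simps)
    then show "(4/5) ^ 5 \<le> exp (-1 :: real)" by (simp add: power_divide)
  qed simp
  also have "\<dots> = exp (- real s)"
    by (simp flip: exp_of_nat_mult)
  finally show ?thesis
    unfolding lost_def W_def .
qed

lemma prob_bad_radii:
  assumes I: "finite I" "A \<subseteq> I"
  shows "measure (geos I) {G. bad_radii X G} \<le> real (card A) * (1/2) ^ r + exp (- real s)"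
proof -
  have "{G. bad_radii X G} = (\<Union>u\<in>A. {G. G u \<in> {y. r \<le> y}}) \<union> {G. 11/16 * real (card A) \<le> real (card (lost X G))}"
    by (auto simp: bad_radii_def)
  then have "measure (geos I) {G. bad_radii X G} \<le>
      measure (geos I) (\<Union>u\<in>A. {G. G u \<in> {y. r \<le> y}}) + measure (geos I) {G. 11/16 * real (card A) \<le> real (card (lost X G))}"
    by (simp add: measure_Un_le)
  also have "measure (geos I) (\<Union>u\<in>A. {G. G u \<in> {y. r \<le> y}}) \<le> (\<Sum>u\<in>A. measure (geos I) {G. G u \<in> {y. r \<le> y}})"
    by (rule measure_UNION_le) (use fin in auto)
  also have "\<dots> = (\<Sum>u\<in>A. (1/2) ^ r)"
    using I by (intro sum.cong refl) (subst measure_geos_component, auto simp: geo_atLeast)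
  finally show ?thesis
    using prob_lost[OF I, of X] unfolding sum_constant by linarith
qed

end

section \<open>Iterating the round\<close>

locale repeated_carving =
  fixes h r R lam :: nat and E :: "nat rel" and A0 :: "nat set" and X G :: "nat \<Rightarrow> nat \<Rightarrow> nat"
begin

primrec alive :: "nat \<Rightarrow> nat set" where
  "alive 0 = A0"
| "alive (Suc \<tau>) = carving.rest h r R lam E (alive \<tau>) (X \<tau>) (G \<tau>)"

definition clus :: "nat \<Rightarrow> nat \<Rightarrow> nat set" where
  "clus \<tau> = carving.cluster h r R lam E (alive \<tau>) (X \<tau>) (G \<tau>)"

text \<open>A cluster is named by its round and its centre. In the finite setting both
  \<open>LEAST\<close> operators select the only possible value
  (\<open>clus_unique\<close>).\<close>

definition out :: "nat \<Rightarrow> nat \<Rightarrow> nat option" where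
  "out K x = (if \<exists>\<tau><K. clus \<tau> x \<noteq> {}
     then Some (let \<tau> = LEAST \<tau>. clus \<tau> x \<noteq> {} in prod_encode (\<tau>, LEAST c. c \<in> clus \<tau> x)) else None)"

end

locale finite_repeated_carving = repeated_carving +
  assumes sym: "sym E" and fin: "finite A0" and pos: "h > 0" "r > 0" "R > 0" "lam > 0"
begin

abbreviation reach :: nat where
  "reach \<equiv> carving.reach h r R"

lemma alive_Suc_subset: "alive (Suc \<tau>) \<subseteq> alive \<tau>"
  by (auto simp: carving.rest_def)

lemma alive_antimono: "i \<le> j \<Longrightarrow> alive j \<subseteq> alive i"
  by (rule lift_Suc_antimono_le[of alive, OF alive_Suc_subset])

lemma finite_alive: "finite (alive \<tau>)"
  using finite_subset[OF alive_antimono[of 0 \<tau>]] fin by simp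

sublocale C: finite_carving h r R lam E "alive \<tau>" "X \<tau>" "G \<tau>" for \<tau>
  by unfold_locales (use sym pos finite_alive in auto)

lemma clus_alive: "c \<in> clus \<tau> x \<Longrightarrow> x \<in> alive \<tau> - alive (Suc \<tau>)"
  using C.cluster_subset[of c \<tau> x] C.cluster_not_rest[of c \<tau> x] by (simp add: clus_def)

lemma clus_unique:
  assumes "c \<in> clus \<tau> x" "c' \<in> clus \<tau>' x" shows "\<tau> = \<tau>'" "c = c'"
proof -
  show "\<tau> = \<tau>'"
  proof (rule ccontr)
    assume "\<tau> \<noteq> \<tau>'"
    then have "Suc \<tau> \<le> \<tau>' \<or> Suc \<tau>' \<le> \<tau>" by auto
    then show False
      using alive_antimono[of "Suc \<tau>" \<tau>'] alive_antimono[of "Suc \<tau>'" \<tau>] clus_alive[OF assms(1)] clus_alive[OF assms(2)]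
      by blast
  qed
  then show "c = c'"
    using C.cluster_unique[of c \<tau> x c'] assms by (simp add: clus_def)
qed

lemma out_Some_iff: "out K x = Some i \<longleftrightarrow> (\<exists>\<tau><K. \<exists>c\<in>clus \<tau> x. i = prod_encode (\<tau>, c))"
proof -
  have *: "out K x = Some (prod_encode (\<tau>, c))" if "\<tau> < K" "c \<in> clus \<tau> x" for \<tau> c
  proof -
    have "(LEAST \<tau>. clus \<tau> x \<noteq> {}) = \<tau>"
    proof (rule Least_equality)
      fix \<tau>' assume "clus \<tau>' x \<noteq> {}"
      then obtain c' where "c' \<in> clus \<tau>' x" by blast
      then show "\<tau> \<le> \<tau>'" using clus_unique(1)[OF that(2)] by simp
    qed (use that in blast)
    moreover have "(LEAST c. c \<in> clus \<tau> x) = c"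
    proof (rule Least_equality)
      fix c' assume "c' \<in> clus \<tau> x"
      then show "c \<le> c'" using clus_unique(2)[OF that(2)] by simp
    qed (rule that)
    ultimately show ?thesis
      using that by (auto simp: out_def)
  qed
  show ?thesis
  proof
    assume o: "out K x = Some i"
    then obtain \<tau> c where "\<tau> < K" "c \<in> clus \<tau> x" by (auto simp: out_def split: if_splits)
    then show "\<exists>\<tau><K. \<exists>c\<in>clus \<tau> x. i = prod_encode (\<tau>, c)" using * o by fastforce
  qed (use * in auto)
qed

text \<open>An undecided vertex next to a cluster of round \<open>\<tau>\<close> does not survive
  that round, so neighbours cannot be clustered in different rounds; within one round
  \<open>cluster_neighbour\<close> applies.\<close>

lemma out_neighbour:
  assumes xy: "(x, y) \<in> E" and i: "out K x = Some i" and j: "out K y = Some j"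
  shows "i = j"
proof -
  have no: False if c: "c \<in> clus \<tau> x" "c' \<in> clus \<tau>' y" and xy: "(x, y) \<in> E" and lt: "\<tau> < \<tau>'" for c c' \<tau> \<tau>' x y
  proof -
    have "y \<in> alive (Suc \<tau>)" using clus_alive[OF c(2)] alive_antimono[of "Suc \<tau>" \<tau>'] lt by auto
    then show False
      using C.cluster_neighbour(1)[of c \<tau> x y] c xy alive_Suc_subset by (auto simp: clus_def)
  qed
  obtain \<tau> c \<tau>' c' where c: "c \<in> clus \<tau> x" "i = prod_encode (\<tau>, c)" "c' \<in> clus \<tau>' y" "j = prod_encode (\<tau>', c')"
    using i j unfolding out_Some_iff by blast
  have "\<tau> = \<tau>'"
    using no[OF c(1,3) xy] no[OF c(3,1) symD[OF sym xy]] by (meson linorder_neqE_nat)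
  moreover have "c' = c"
    using C.cluster_neighbour(2)[of c \<tau> x y c'] c xy clus_alive[OF c(3)] \<open>\<tau> = \<tau>'\<close> by (auto simp: clus_def)
  ultimately show ?thesis using c by simp
qed

lemma out_near:
  assumes "out K x = Some i" "out K y = Some i"
  shows "y \<in> nball E (2 * reach) x"
proof -
  obtain \<tau> c where c: "c \<in> clus \<tau> x" "c \<in> clus \<tau> y"
    using assms unfolding out_Some_iff by (auto simp: prod_encode_eq)
  then have "c \<in> nball E reach x" "y \<in> nball E reach c"
    using C.cluster_reach[of c \<tau>] nball_sym[OF sym] by (auto simp: clus_def)
  then show ?thesis by (rule nball_trans) simp
qed

text \<open>Round \<open>\<tau>\<close> deletes a \<open>1/h\<close> fraction of at most
  \<open>(7/8) ^ \<tau> * card A0\<close> vertices. The geometric series is at most 8, so the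
  deletions do not grow with \<open>K\<close>; the vertices never decided add
  \<open>(7/8) ^ K\<close>.\<close>

lemma card_out_None:
  assumes shrink: "\<And>\<tau>. \<tau> < K \<Longrightarrow> 8 * card (alive (Suc \<tau>)) \<le> 7 * card (alive \<tau>)"
  shows "real (card {x\<in>A0. out K x = None}) \<le> (8 / h + (7/8) ^ K) * card A0"
proof -
  define del where "del \<tau> = {x\<in>alive \<tau> - alive (Suc \<tau>). clus \<tau> x = {}}" for \<tau>
  have fdel: "finite (del \<tau>)" for \<tau> using finite_alive by (simp add: del_def)
  have size: "real (card (alive \<tau>)) \<le> (7/8) ^ \<tau> * card A0" if "\<tau> \<le> K" for \<tau>
    using that
  proof (induction \<tau>)
    case (Suc \<tau>)
    have "8 * real (card (alive (Suc \<tau>))) \<le> 7 * real (card (alive \<tau>))"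
      using shrink[of \<tau>] Suc.prems by linarith
    then show ?case using Suc by simp
  qed simp
  have sub: "{x\<in>A0. out K x = None} \<subseteq> (\<Union>\<tau><K. del \<tau>) \<union> alive K"
  proof
    fix x assume x: "x \<in> {x\<in>A0. out K x = None}"
    show "x \<in> (\<Union>\<tau><K. del \<tau>) \<union> alive K"
    proof (cases "x \<in> alive K")
      case False
      have "\<exists>\<tau><k. x \<in> alive \<tau> - alive (Suc \<tau>)" if "x \<notin> alive k" for k
        using that
      proof (induction k)
        case (Suc k)
        then show ?case using less_Suc_eq by (cases "x \<in> alive k") auto
      qed (use x in simp)
      then obtain \<tau> where \<tau>: "\<tau> < K" "x \<in> alive \<tau> - alive (Suc \<tau>)" using False by blast
      have "clus \<tau> x = {}" using x \<tau>(1) by (auto simp: out_def split: if_splits)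
      then show ?thesis using \<tau> by (auto simp: del_def)
    qed auto
  qed
  have del: "real (card (del \<tau>)) \<le> (7/8) ^ \<tau> * card A0 / h" if "\<tau> < K" for \<tau>
  proof -
    have "h * card (del \<tau>) \<le> card (alive \<tau>)"
      using C.card_deleted[of \<tau>] by (simp add: del_def clus_def)
    then have "real (h * card (del \<tau>)) \<le> real (card (alive \<tau>))"
      by (rule of_nat_mono)
    also have "\<dots> \<le> (7/8) ^ \<tau> * card A0" using that by (intro size) auto
    finally show ?thesis using pos by (simp add: field_simps)
  qed
  have "card {x\<in>A0. out K x = None} \<le> card ((\<Union>\<tau><K. del \<tau>) \<union> alive K)"
    using sub fdel finite_alive by (intro card_mono) auto
  also have "\<dots> \<le> (\<Sum>\<tau><K. card (del \<tau>)) + card (alive K)"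
    using card_Un_le[of "\<Union>\<tau><K. del \<tau>" "alive K"] card_UN_le[OF finite_lessThan, of del K] by linarith
  finally have "real (card {x\<in>A0. out K x = None}) \<le> (\<Sum>\<tau><K. real (card (del \<tau>))) + card (alive K)"
    by (simp only: of_nat_sum[symmetric] of_nat_add[symmetric] of_nat_le_iff)
  also have "\<dots> \<le> (\<Sum>\<tau><K. (7/8) ^ \<tau> * card A0 / h) + (7/8) ^ K * card A0"
    by (intro add_mono sum_mono del size) auto
  also have "(\<Sum>\<tau><K. (7/8) ^ \<tau> * card A0 / h) = (\<Sum>\<tau><K. (7/8) ^ \<tau>) * (card A0 / h)"
    by (simp add: sum_distrib_right sum_divide_distrib)
  also have "(\<Sum>\<tau><K. (7/8) ^ \<tau>) \<le> (8 :: real)"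
  proof -
    have "(\<Sum>\<tau><K. (7/8) ^ \<tau>) = 8 * (1 - (7/8 :: real) ^ K)"
      by (subst sum_gp_strict) (auto simp: field_simps)
    then show ?thesis by simp
  qed
  then have "(\<Sum>\<tau><K. (7/8) ^ \<tau>) * (card A0 / h) \<le> 8 * (card A0 / h)"
    by (intro mult_right_mono) auto
  finally show ?thesis by (simp add: algebra_simps)
qed

end

section \<open>Locality\<close>

lemma arg_min_on_cong:
  assumes "\<And>x. x \<in> S \<Longrightarrow> f x = g x" shows "arg_min_on f S = arg_min_on g S"
proof -
  have "is_arg_min f (\<lambda>x. x \<in> S) = is_arg_min g (\<lambda>x. x \<in> S)"
    using assms by (auto simp: is_arg_min_def fun_eq_iff)
  then show ?thesis by (simp add: arg_min_on_def arg_min_def)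
qed

text \<open>Instance 2 is the actual run, instance 1 the run that a vertex simulates from its view.
  With \<open>D\<close> the reach, samples depend on radius \<open>2 * D\<close>, \<open>unc\<close>
  on \<open>3 * D\<close>, owners and cores on \<open>4 * D\<close>, the sets \<open>nb j c\<close>
  on \<open>6 * D\<close> around \<open>c\<close>, and the fate of a vertex on
  \<open>7 * D\<close>.\<close>

locale two_carvings =
  fixes h r R lam :: nat and E1 E2 :: "nat rel" and A1 A2 :: "nat set" and X1 X2 G1 G2 :: "nat \<Rightarrow> nat"
  assumes h: "h > 0" and R: "R > 0"
begin

definition agree :: "nat \<Rightarrow> nat \<Rightarrow> bool" where
  "agree q x \<longleftrightarrow> (\<forall>y\<in>nball E2 q x. E1 `` {y} = E2 `` {y} \<and> (y \<in> A1 \<longleftrightarrow> y \<in> A2) \<and> X1 y = X2 y \<and> G1 y = G2 y)"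

lemma agree_at: "agree q x \<Longrightarrow> y \<in> nball E2 j x \<Longrightarrow> j + q' \<le> q \<Longrightarrow> agree q' y"
  unfolding agree_def using nball_trans[of y E2 j x _ q' q] by blast

lemma agree_mono: "agree q x \<Longrightarrow> q' \<le> q \<Longrightarrow> agree q' x"
  using agree_at[of q x x 0 q'] by simp

lemma agree_self:
  assumes "agree q x" shows "x \<in> A1 \<longleftrightarrow> x \<in> A2" "X1 x = X2 x" "G1 x = G2 x"
  using assms nball_refl[of x E2 q] by (auto simp: agree_def)

lemma agree_nball:
  assumes a: "agree q x" and "j \<le> q" shows "nball E1 j x = nball E2 j x"
proof -
  have "(x, y) \<in> E1 ^^ n \<longleftrightarrow> (x, y) \<in> E2 ^^ n" if "n \<le> q" for n y
    using that
  proof (induction n arbitrary: y)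
    case (Suc n)
    have "(z, y) \<in> E1 \<longleftrightarrow> (z, y) \<in> E2" if "(x, z) \<in> E2 ^^ n" for z
    proof -
      have "z \<in> nball E2 q x" using that Suc.prems by (auto simp: nball_def intro!: exI[of _ n])
      then have "E1 `` {z} = E2 `` {z}" using a by (auto simp: agree_def)
      then show ?thesis by blast
    qed
    then show ?case using Suc by (auto simp: relcomp_unfold)
  qed simp
  then show ?thesis using assms(2) unfolding nball_def by auto
qed

abbreviation "D \<equiv> carving.reach h r R"
abbreviation "wid \<equiv> carving.wid r R"

sublocale C1: carving h r R lam E1 A1 X1 G1 .
sublocale C2: carving h r R lam E2 A2 X2 G2 .

lemma wid_le: "j \<le> wid \<Longrightarrow> j * (2 * h) \<le> D"
  by (simp add: C1.reach_def trans_le_add1)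

lemma bl_agree:
  assumes "agree q x" "j * (2 * h) \<le> q" shows "C1.bl j x = C2.bl j x"
proof -
  have "y \<in> A1 \<longleftrightarrow> y \<in> A2" if "y \<in> nball E2 q x" for y
    using assms(1) that by (auto simp: agree_def)
  then show ?thesis
    unfolding C1.bl_def C2.bl_def agree_nball[OF assms] using nball_mono[OF assms(2), of E2 x] by blast
qed

lemma bl_near: "u \<in> C2.bl j w \<Longrightarrow> j \<le> wid \<Longrightarrow> u \<in> nball E2 D w"
  using nball_mono[OF wid_le, of j E2 w] by (auto simp: C2.bl_def)

lemma lev_agree: "agree (2 * D) u \<Longrightarrow> C1.lev u = C2.lev u"
  unfolding C1.lev_def C2.lev_def
  using bl_agree[of "2 * D" u "2 * wid"] mult_le_mono2[OF wid_le[of wid], of 2] by (simp only: mult.assoc)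

lemma samp_agree: "agree (2 * D) u \<Longrightarrow> u \<in> C1.samp \<longleftrightarrow> u \<in> C2.samp"
  using lev_agree agree_self by (simp add: C1.samp_def C2.samp_def)

lemma unc_agree:
  assumes a: "agree (3 * D) u" shows "u \<in> C1.unc \<longleftrightarrow> u \<in> C2.unc"
proof -
  have r: "2 * r \<le> wid" by (simp add: C1.wid_def)
  have "v \<in> C1.samp \<longleftrightarrow> v \<in> C2.samp" if "v \<in> C2.bl (2 * r) u" for v
    using bl_near[OF that r] by (intro samp_agree agree_at[OF a]) auto
  moreover have "C1.bl (2 * r) u = C2.bl (2 * r) u"
    using r by (intro bl_agree[OF a] order_trans[OF wid_le]) auto
  ultimately show ?thesis
    using agree_self[OF a] unfolding C1.unc_def C2.unc_def by auto
qed

lemma cut_agree: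
  assumes a: "agree D u" shows "C1.cut u = C2.cut u"
  unfolding C1.cut_def C2.cut_def
proof (rule arg_min_on_cong)
  fix j assume "j \<in> {2 * r + 1..2 * r + R}"
  then have "j \<le> wid" by (simp add: C1.wid_def)
  then show "card (C1.bl j u - C1.bl (j - 1) u) = card (C2.bl j u - C2.bl (j - 1) u)"
    using bl_agree[OF a wid_le, of j] bl_agree[OF a wid_le, of "j - 1"] by simp
qed

lemma rad_agree: "agree (2 * D) u \<Longrightarrow> C1.rad u = C2.rad u"
  using samp_agree cut_agree[OF agree_mono] agree_self by (simp add: C1.rad_def C2.rad_def)

lemma cand_agree:
  assumes a: "agree (4 * D) w" shows "C1.cand w = C2.cand w"
proof -
  have "u \<in> C1.cand w \<longleftrightarrow> u \<in> C2.cand w" if "u \<in> nball E2 D w" for u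
  proof -
    have a': "agree (3 * D) u" by (rule agree_at[OF a that]) simp
    have "C1.rad u = C2.rad u" by (rule rad_agree[OF agree_mono[OF a']]) simp
    moreover have "C1.bl (C2.rad u) w = C2.bl (C2.rad u) w"
      using C2.rad_le[OF R, of u] by (intro bl_agree[OF a] order_trans[OF wid_le]) auto
    moreover have "u \<in> C1.samp \<longleftrightarrow> u \<in> C2.samp" by (rule samp_agree[OF agree_mono[OF a']]) simp
    ultimately show ?thesis
      using unc_agree[OF a'] by (simp add: C1.cand_def C2.cand_def)
  qed
  moreover have "u \<in> nball E2 D w" if "u \<in> C2.cand w" for u
    using bl_near[OF _ C2.rad_le[OF R]] that by (auto simp: C2.cand_def)
  moreover have "u \<in> nball E2 D w" if "u \<in> C1.cand w" for u
  proof -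
    have "u \<in> C1.bl (C1.rad u) w" using that by (simp add: C1.cand_def)
    also have "C1.bl (C1.rad u) w = C2.bl (C1.rad u) w"
      using C1.rad_le[OF R, of u] by (intro bl_agree[OF a] order_trans[OF wid_le]) auto
    finally show ?thesis using C1.rad_le[OF R] by (rule bl_near)
  qed
  ultimately show ?thesis by blast
qed

lemma cand_near: "u \<in> C2.cand w \<Longrightarrow> u \<in> nball E2 D w"
  using bl_near[OF _ C2.rad_le[OF R]] by (auto simp: C2.cand_def)

lemma own_agree:
  assumes a: "agree (4 * D) w" shows "C1.own w = C2.own w"
proof -
  have "u \<in> C1.samp \<longleftrightarrow> u \<in> C2.samp" if "u \<in> C2.cand w" for u
    using cand_near[OF that] by (intro samp_agree agree_at[OF a]) auto
  then have "C2.cand w \<inter> C1.samp = C2.cand w \<inter> C2.samp" by blast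
  then show ?thesis by (simp add: C1.own_def C2.own_def cand_agree[OF a])
qed

lemma core_agree:
  assumes a: "agree (4 * D) w" shows "w \<in> C1.core \<longleftrightarrow> w \<in> C2.core"
proof (cases "C2.cand w = {}")
  case True
  then show ?thesis using cand_agree[OF a] by (simp add: C1.core_def C2.core_def)
next
  case False
  let ?u = "C2.own w"
  have "agree (2 * D) ?u"
    using cand_near[OF C2.own_in_cand[OF False]] by (rule agree_at[OF a]) simp
  then have rad: "C1.rad ?u = C2.rad ?u" by (rule rad_agree)
  have "C1.bl (C2.rad ?u - 1) w = C2.bl (C2.rad ?u - 1) w"
    using C2.rad_le[OF R, of ?u] by (intro bl_agree[OF a] order_trans[OF wid_le]) auto
  then show ?thesis
    using agree_self[OF a] rad by (simp add: C1.core_def C2.core_def own_agree[OF a] cand_agree[OF a])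
qed

lemma h_le: "h \<le> D"
  by (simp add: C1.reach_def)

lemma nb_agree:
  assumes a: "agree (6 * D) c" and j: "j \<le> h" shows "C1.nb j c = C2.nb j c"
proof -
  have "(x \<in> A1 \<and> (\<exists>w\<in>C1.core. C1.own w = c \<and> w \<in> nball E1 j x)) \<longleftrightarrow>
        (x \<in> A2 \<and> (\<exists>w\<in>C2.core. C2.own w = c \<and> w \<in> nball E2 j x))" if x: "x \<in> nball E2 D c" for x
  proof -
    have a': "agree (5 * D) x" by (rule agree_at[OF a x]) simp
    have n: "nball E1 j x = nball E2 j x" using j h_le by (intro agree_nball[OF a']) simp
    have "(w \<in> C1.core \<longleftrightarrow> w \<in> C2.core) \<and> C1.own w = C2.own w" if "w \<in> nball E2 j x" for w
    proof -
      have "agree (4 * D) w" by (rule agree_at[OF a' that]) (use j h_le in simp)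
      then show ?thesis using core_agree own_agree by blast
    qed
    then show ?thesis using agree_self(1)[OF a'] unfolding n by (metis (no_types, lifting))
  qed
  moreover have "nball E1 D c = nball E2 D c" by (rule agree_nball[OF a]) simp
  ultimately show ?thesis unfolding C1.nb_def C2.nb_def by blast
qed

lemma grow_agree:
  assumes a: "agree (6 * D) c" shows "C1.grow c = C2.grow c"
  unfolding C1.grow_def C2.grow_def
  using nb_agree[OF a] by (intro arg_min_on_cong) auto

lemma rest_agree:
  assumes a: "agree (7 * D) x" shows "x \<in> C1.rest \<longleftrightarrow> x \<in> C2.rest"
proof -
  have "C1.nb (C1.grow c) c = C2.nb (C2.grow c) c" if "c \<in> nball E2 D x" for c
  proof -
    have a': "agree (6 * D) c" by (rule agree_at[OF a that]) simp
    show ?thesis using nb_agree[OF a' C2.grow_le[OF h]] grow_agree[OF a'] by simp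
  qed
  moreover have "nball E1 D x = nball E2 D x" by (rule agree_nball[OF a]) simp
  ultimately show ?thesis using agree_self[OF a] by (simp add: C1.rest_def C2.rest_def)
qed

lemma cluster_agree:
  assumes a: "agree (7 * D) x" shows "C1.cluster x = C2.cluster x"
proof -
  have "C1.nb (C1.grow c - 1) c = C2.nb (C2.grow c - 1) c" if "c \<in> nball E2 D x" for c
  proof -
    have a': "agree (6 * D) c" by (rule agree_at[OF a that]) simp
    show ?thesis using nb_agree[OF a', of "C2.grow c - 1"] C2.grow_le[OF h, of c] grow_agree[OF a'] by simp
  qed
  moreover have "nball E1 D x = nball E2 D x" by (rule agree_nball[OF a]) simp
  ultimately show ?thesis unfolding C1.cluster_def C2.cluster_def by auto
qed

end

text \<open>A round is decided within radius \<open>7 * reach\<close>, but from the set left by the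
  previous round, so the radii add up over the \<open>K\<close> rounds.\<close>

lemma out_local:
  fixes h r R lam :: nat and E1 E2 :: "nat rel" and A1 A2 :: "nat set" and X1 X2 G1 G2 :: "nat \<Rightarrow> nat \<Rightarrow> nat"
  assumes h: "h > 0" and R: "R > 0"
    and agree: "\<And>y. y \<in> nball E2 (7 * carving.reach h r R * K) x \<Longrightarrow>
      E1 `` {y} = E2 `` {y} \<and> (y \<in> A1 \<longleftrightarrow> y \<in> A2) \<and> (\<forall>\<tau>. X1 \<tau> y = X2 \<tau> y \<and> G1 \<tau> y = G2 \<tau> y)"
  shows "repeated_carving.out h r R lam E1 A1 X1 G1 K x = repeated_carving.out h r R lam E2 A2 X2 G2 K x"
proof -
  interpret S1: repeated_carving h r R lam E1 A1 X1 G1 .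
  interpret S2: repeated_carving h r R lam E2 A2 X2 G2 .
  let ?q = "7 * carving.reach h r R"
  interpret T: two_carvings h r R lam E1 E2 "S1.alive \<tau>" "S2.alive \<tau>" "X1 \<tau>" "X2 \<tau>" "G1 \<tau>" "G2 \<tau>" for \<tau>
    by unfold_locales (use h R in auto)
  have ag: "T.agree \<tau> q y"
    if "\<And>z. z \<in> nball E2 q y \<Longrightarrow> z \<in> S1.alive \<tau> \<longleftrightarrow> z \<in> S2.alive \<tau>" "y \<in> nball E2 j x" "j + q \<le> ?q * K" for q \<tau> y j
    unfolding T.agree_def using agree that nball_trans[OF that(2), of _ q "?q * K"] by blast
  \<comment> \<open>At distance \<open>j\<close> from \<open>x\<close> there is room for
    \<open>\<tau>\<close> rounds, each of which looks \<open>?q\<close> further.\<close>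
  have al: "y \<in> S1.alive \<tau> \<longleftrightarrow> y \<in> S2.alive \<tau>" if "y \<in> nball E2 j x" "j + ?q * \<tau> \<le> ?q * K" for y \<tau> j
    using that
  proof (induction \<tau> arbitrary: y j)
    case 0
    then show ?case using agree[of y] nball_mono[of j "?q * K" E2 x] by auto
  next
    case (Suc \<tau>)
    have "T.agree \<tau> ?q y"
    proof (rule ag)
      fix z assume "z \<in> nball E2 ?q y"
      then have "z \<in> nball E2 (j + ?q) x" using Suc.prems by (auto intro: nball_trans)
      then show "z \<in> S1.alive \<tau> \<longleftrightarrow> z \<in> S2.alive \<tau>" using Suc.prems by (intro Suc.IH[of _ "j + ?q"]) auto
    qed (use Suc.prems in auto)
    then show ?case using T.rest_agree by simp
  qed
  have "S1.clus \<tau> x = S2.clus \<tau> x" if "\<tau> < K" for \<tau>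
  proof -
    have "Suc \<tau> \<le> K" using that by simp
    then have "?q * Suc \<tau> \<le> ?q * K" by (rule mult_le_mono2)
    then have le: "?q + ?q * \<tau> \<le> ?q * K" by simp
    have "T.agree \<tau> ?q x"
    proof (rule ag[where j = 0])
      show "z \<in> S1.alive \<tau> \<longleftrightarrow> z \<in> S2.alive \<tau>" if "z \<in> nball E2 ?q x" for z
        using that le by (rule al)
      show "0 + ?q \<le> ?q * K" using le by linarith
    qed simp
    then show ?thesis unfolding S1.clus_def S2.clus_def by (rule T.cluster_agree)
  qed note eq = this
  show ?thesis
  proof (cases "\<exists>\<tau><K. S2.clus \<tau> x \<noteq> {}")
    case True
    then obtain \<tau>0 where \<tau>0: "\<tau>0 < K" "S2.clus \<tau>0 x \<noteq> {}" by blast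
    let ?l = "LEAST \<tau>. S2.clus \<tau> x \<noteq> {}"
    have l: "?l \<le> \<tau>0" "S2.clus ?l x \<noteq> {}"
      using \<tau>0(2) by (rule Least_le, rule LeastI)
    have "(LEAST \<tau>. S1.clus \<tau> x \<noteq> {}) = ?l"
    proof (rule Least_equality)
      show "S1.clus ?l x \<noteq> {}" using l \<tau>0 eq by simp
      fix \<tau> assume "S1.clus \<tau> x \<noteq> {}"
      then show "?l \<le> \<tau>"
        using eq[of \<tau>] \<tau>0 l by (cases "\<tau> < K") (auto intro: Least_le)
    qed
    then show ?thesis
      using True eq l \<tau>0 by (auto simp: S1.out_def S2.out_def Let_def)
  next
    case False
    then show ?thesis using eq by (auto simp: S1.out_def S2.out_def)
  qed
qed

section \<open>Gathering neighbourhoods\<close>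

text \<open>The tape is split into infinitely many rows by \<open>prod_encode\<close>, each giving
  one geometric variable. The default 0 concerns a row of ones only, an event of probability
  0.\<close>

definition streak :: "nat \<Rightarrow> tape \<Rightarrow> nat" where
  "streak \<beta> \<rho> = (if \<exists>i. \<not> \<rho> (prod_encode (\<beta>, i)) then LEAST i. \<not> \<rho> (prod_encode (\<beta>, i)) else 0)"

definition label :: "nat \<Rightarrow> tape \<Rightarrow> nat list" where
  "label b \<rho> = map (\<lambda>\<beta>. streak \<beta> \<rho>) [0..<b]"

type_synonym knowledge = "nat list \<times> (nat list \<times> nat list) list"

definition absorb :: "knowledge \<Rightarrow> knowledge list \<Rightarrow> knowledge" where
  "absorb k ks = (fst k, snd k @ map (\<lambda>k'. (fst k, fst k')) ks @ concat (map snd ks))"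

text \<open>All random bits are read at the start. A message is the sender's whole state in unary,
  as message size is unrestricted, and \<open>F\<close> receives the view as a set, free of the port
  order.\<close>

definition gather :: "nat \<Rightarrow> nat \<Rightarrow> (nat list \<Rightarrow> (nat list \<times> nat list) set \<Rightarrow> nat option) \<Rightarrow>
    (nat, bool list, nat option) local_algorithm" where
  "gather b T F = \<lparr>
     init = \<lambda>k \<rho>. to_nat (label b \<rho>, [] :: (nat list \<times> nat list) list),
     send = \<lambda>s i. replicate s True,
     step = \<lambda>\<rho> s ms. to_nat (absorb (from_nat s) (map (\<lambda>m. from_nat (length m)) ms)),
     rounds = T,
     result = \<lambda>s. case from_nat s of (l, k) \<Rightarrow> F l (set k)\<rparr>"

text \<open>An arc becomes known to its tail in the first round and then travels one step per round,
  so after \<open>t\<close> rounds the known arcs are those starting within distance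
  \<open>t - 1\<close>. The list \<open>k\<close> is specified only up to its set, because its order
  depends on the ports.\<close>

lemma state_after_gather:
  assumes P: "\<And>v. v \<in> V \<Longrightarrow> set (P v) = {u. (v, u) \<in> Ar}" and Ar: "Ar \<subseteq> V \<times> V" and v: "v \<in> V"
  shows "\<exists>k. state_after (gather b T F) P \<omega> t v = to_nat (label b (\<omega> v), k) \<and>
    set k = {(label b (\<omega> x), label b (\<omega> y)) | x y. (\<exists>n<t. (v, x) \<in> Ar ^^ n) \<and> (x, y) \<in> Ar}"
  using v
proof (induction t arbitrary: v)
  case 0
  then show ?case by (auto simp: gather_def)
next
  case (Suc t)
  let ?l = "\<lambda>v. label b (\<omega> v)"
  define K where "K v = (SOME k. state_after (gather b T F) P \<omega> t v = to_nat (?l v, k) \<and>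
    set k = {(?l x, ?l y) | x y. (\<exists>n<t. (v, x) \<in> Ar ^^ n) \<and> (x, y) \<in> Ar})" for v
  have K: "state_after (gather b T F) P \<omega> t v = to_nat (?l v, K v)"
    "set (K v) = {(?l x, ?l y) | x y. (\<exists>n<t. (v, x) \<in> Ar ^^ n) \<and> (x, y) \<in> Ar}" if "v \<in> V" for v
    using someI_ex[OF Suc.IH[OF that]] unfolding K_def by blast+
  have PV: "u \<in> V" if "u \<in> set (P v)" for u
    using that P[OF Suc.prems] Ar by auto
  have "state_after (gather b T F) P \<omega> (Suc t) v =
    to_nat (absorb (?l v, K v) (map (\<lambda>u. (?l u, K u)) (P v)))"
    using K[OF Suc.prems] K PV by (simp add: gather_def o_def cong: map_cong)
  moreover have "set (snd (absorb (?l v, K v) (map (\<lambda>u. (?l u, K u)) (P v)))) =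
     {(?l x, ?l y) | x y. (\<exists>n<Suc t. (v, x) \<in> Ar ^^ n) \<and> (x, y) \<in> Ar}" (is "?A = ?B")
  proof -
    have "?A = set (K v) \<union> (\<lambda>u. (?l v, ?l u)) ` set (P v) \<union> (\<Union>u\<in>set (P v). set (K u))"
      by (auto simp: absorb_def)
    also have "\<dots> = ?B"
    proof (intro equalityI subsetI)
      fix z assume "z \<in> set (K v) \<union> (\<lambda>u. (?l v, ?l u)) ` set (P v) \<union> (\<Union>u\<in>set (P v). set (K u))"
      then consider "z \<in> set (K v)" | u where "u \<in> set (P v)" "z = (?l v, ?l u)"
        | u where "u \<in> set (P v)" "z \<in> set (K u)" by blast
      then show "z \<in> ?B"
      proof cases
        case 1
        then show ?thesis using K(2)[OF Suc.prems] less_SucI by blast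
      next
        case 2
        then have "(v, u) \<in> Ar" using P[OF Suc.prems] by simp
        then have "z = (?l v, ?l u) \<and> (\<exists>n<Suc t. (v, v) \<in> Ar ^^ n) \<and> (v, u) \<in> Ar"
          using 2(2) by (auto intro!: exI[of _ "0::nat"])
        then show ?thesis by blast
      next
        case 3
        then obtain x y n where x: "z = (?l x, ?l y)" "n < t" "(u, x) \<in> Ar ^^ n" "(x, y) \<in> Ar"
          using K(2)[OF PV] by blast
        have "(v, u) \<in> Ar" using 3 P[OF Suc.prems] by simp
        then have "(v, x) \<in> Ar ^^ Suc n" using x(3) by (rule relpow_Suc_I2)
        then show ?thesis using x by (auto simp del: relpow.simps intro!: exI[of _ "Suc n"])
      qed
    next
      fix z assume "z \<in> ?B"
      then obtain x y n where x: "z = (?l x, ?l y)" "n < Suc t" "(v, x) \<in> Ar ^^ n" "(x, y) \<in> Ar"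
        by blast
      show "z \<in> set (K v) \<union> (\<lambda>u. (?l v, ?l u)) ` set (P v) \<union> (\<Union>u\<in>set (P v). set (K u))"
      proof (cases n)
        case 0
        then show ?thesis using x P[OF Suc.prems] by auto
      next
        case (Suc m)
        then obtain u where u: "(v, u) \<in> Ar" "(u, x) \<in> Ar ^^ m"
          using x(3) relpow_Suc_D2 by metis
        then have "u \<in> set (P v)" using P[OF \<open>v \<in> V\<close>] by simp
        moreover have "z \<in> set (K u)"
          using K(2)[OF PV[OF \<open>u \<in> set (P v)\<close>]] x u Suc by auto
        ultimately show ?thesis by blast
      qed
    qed
    finally show ?thesis .
  qed
  ultimately show ?case
    by (intro exI[of _ "snd (absorb (?l v, K v) (map (\<lambda>u. (?l u, K u)) (P v)))"]) (simp add: absorb_def)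
qed

lemma outcome_gather:
  assumes P: "\<And>v. v \<in> V \<Longrightarrow> set (P v) = {u. (v, u) \<in> Ar}" and Ar: "Ar \<subseteq> V \<times> V" and v: "v \<in> V"
  shows "outcome (gather b T F) P \<omega> v = F (label b (\<omega> v))
    {(label b (\<omega> x), label b (\<omega> y)) | x y. (\<exists>n<T. (v, x) \<in> Ar ^^ n) \<and> (x, y) \<in> Ar}"
proof -
  obtain k where "state_after (gather b T F) P \<omega> T v = to_nat (label b (\<omega> v), k) \<and>
    set k = {(label b (\<omega> x), label b (\<omega> y)) | x y. (\<exists>n<T. (v, x) \<in> Ar ^^ n) \<and> (x, y) \<in> Ar}"
    by (rule exE[OF state_after_gather[OF assms]])
  then show ?thesis
    by (simp add: outcome_def gather_def)
qed

text \<open>The first \<open>len\<close> entries of a label identify a vertex, the later ones are its random choices.\<close>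

definition ident :: "nat \<Rightarrow> nat list \<Rightarrow> nat" where
  "ident len l = to_nat (take len l)"

text \<open>A vertex simulates all rounds on its view, with every number taken as undecided at first
  (\<open>UNIV\<close>). Its own label is inserted because a vertex without neighbours occurs in no
  arc. For known identifiers \<open>SOME\<close> finds the right label if identifiers are
  injective.\<close>

definition decide :: "nat \<Rightarrow> nat \<Rightarrow> nat \<Rightarrow> nat \<Rightarrow> nat \<Rightarrow> nat \<Rightarrow> nat list \<Rightarrow> (nat list \<times> nat list) set \<Rightarrow> nat option" where
  "decide h r R lam len K l k =
    (let lab = (\<lambda>i. SOME a. a \<in> insert l (Domain k \<union> Range k) \<and> ident len a = i)
     in repeated_carving.out h r R lam {(ident len a, ident len a') | a a'. (a, a') \<in> k} UNIV
          (\<lambda>\<tau> i. lab i ! (len + 2 * \<tau>)) (\<lambda>\<tau> i. lab i ! (len + 2 * \<tau> + 1)) K (ident len l))"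

lemma relpow_image_inj:
  assumes inj: "inj_on f V" and Ar: "Ar \<subseteq> V \<times> V" and v: "v \<in> V"
    and y: "(f v, y) \<in> {(f x, f y) | x y. (x, y) \<in> Ar} ^^ n"
  shows "\<exists>x\<in>V. y = f x \<and> (v, x) \<in> Ar ^^ n"
  using y
proof (induction n arbitrary: y)
  case 0
  then show ?case using v by auto
next
  case (Suc n)
  then obtain z where z: "(f v, z) \<in> {(f x, f y) | x y. (x, y) \<in> Ar} ^^ n" "(z, y) \<in> {(f x, f y) | x y. (x, y) \<in> Ar}"
    by auto
  then obtain x where x: "x \<in> V" "z = f x" "(v, x) \<in> Ar ^^ n" using Suc.IH by blast
  obtain x' y' where "z = f x'" "y = f y'" "(x', y') \<in> Ar" using z by auto
  moreover have "x' = x" using calculation x inj Ar by (auto dest: inj_onD)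
  ultimately show ?case using x Ar by (auto intro!: bexI[of _ y'])
qed

text \<open>\<open>out_local\<close> asks for agreement up to distance \<open>7 * reach * K\<close>,
  including the arcs that leave vertices at exactly this distance; hence the \<open>+ 1\<close> in
  \<open>T\<close>.\<close>

lemma decide_eq:
  fixes lb :: "'v \<Rightarrow> nat list" and len :: nat
  defines "vid \<equiv> \<lambda>v. ident len (lb v)"
  assumes inj: "inj_on vid V" and Ar: "Ar \<subseteq> V \<times> V" and v: "v \<in> V" and h: "h > 0" and R: "R > 0"
    and T: "T = 7 * carving.reach h r R * K + 1"
  shows "decide h r R lam len K (lb v) {(lb x, lb y) | x y. (\<exists>n<T. (v, x) \<in> Ar ^^ n) \<and> (x, y) \<in> Ar} =
    repeated_carving.out h r R lam {(vid x, vid y) | x y. (x, y) \<in> Ar} (vid ` V)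
      (\<lambda>\<tau> i. if i \<in> vid ` V then lb (the_inv_into V vid i) ! (len + 2 * \<tau>) else 0)
      (\<lambda>\<tau> i. if i \<in> vid ` V then lb (the_inv_into V vid i) ! (len + 2 * \<tau> + 1) else 0) K (vid v)"
proof -
  define k where "k = {(lb x, lb y) | x y. (\<exists>n<T. (v, x) \<in> Ar ^^ n) \<and> (x, y) \<in> Ar}"
  define E1 where "E1 = {(ident len a, ident len a') | a a'. (a, a') \<in> k}"
  define E2 where "E2 = {(vid x, vid y) | x y. (x, y) \<in> Ar}"
  define lab where "lab i = (SOME a. a \<in> insert (lb v) (Domain k \<union> Range k) \<and> ident len a = i)" for i
  note walk = relpow_image_inj[OF inj Ar v, folded E2_def]
  have "repeated_carving.out h r R lam E1 UNIV (\<lambda>\<tau> i. lab i ! (len + 2 * \<tau>)) (\<lambda>\<tau> i. lab i ! (len + 2 * \<tau> + 1)) K (vid v) =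
    repeated_carving.out h r R lam E2 (vid ` V)
      (\<lambda>\<tau> i. if i \<in> vid ` V then lb (the_inv_into V vid i) ! (len + 2 * \<tau>) else 0)
      (\<lambda>\<tau> i. if i \<in> vid ` V then lb (the_inv_into V vid i) ! (len + 2 * \<tau> + 1) else 0) K (vid v)"
  proof (rule out_local[OF h R])
    fix y assume "y \<in> nball E2 (7 * carving.reach h r R * K) (vid v)"
    then obtain n where n: "n < T" "(vid v, y) \<in> E2 ^^ n" unfolding nball_def T using less_Suc_eq_le by auto
    then obtain x where x: "x \<in> V" "y = vid x" "(v, x) \<in> Ar ^^ n" using walk by blast
    have k_lb: "\<exists>x\<in>V. a = lb x" if "a \<in> insert (lb v) (Domain k \<union> Range k)" for a
      using that v Ar by (auto simp: k_def)
    \<comment> \<open>A vertex reached by a walk of positive length is the head of a known arc;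
      \<open>v\<close> itself is covered by \<open>insert\<close>.\<close>
    have "lb x \<in> insert (lb v) (Domain k \<union> Range k)"
    proof (cases n)
      case 0
      then show ?thesis using x by simp
    next
      case (Suc m)
      then obtain z where "(v, z) \<in> Ar ^^ m" "(z, x) \<in> Ar" using x(3) by auto
      moreover have "m < T" using n Suc by simp
      ultimately have "(lb z, lb x) \<in> k" unfolding k_def by blast
      then show ?thesis by auto
    qed
    then have "lb x \<in> insert (lb v) (Domain k \<union> Range k) \<and> ident len (lb x) = y"
      by (simp add: x(2) vid_def)
    then have laby: "lab y \<in> insert (lb v) (Domain k \<union> Range k) \<and> ident len (lab y) = y"
      unfolding lab_def by (rule someI)
    then obtain x' where x': "x' \<in> V" "lab y = lb x'" using k_lb by blast
    then have "vid x' = vid x" using laby x(2) by (simp add: vid_def)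
    then have lab: "lab y = lb x" using x' inj_onD[OF inj _ x'(1) x(1)] by simp
    have inv: "the_inv_into V vid y = x" using inj x by (simp add: the_inv_into_f_f)
    have "E1 `` {y} = E2 `` {y}"
    proof (intro equalityI subsetI)
      fix z assume "z \<in> E1 `` {y}"
      then show "z \<in> E2 `` {y}" by (auto simp: E1_def E2_def k_def vid_def)
    next
      fix z assume "z \<in> E2 `` {y}"
      then obtain x' y' where z: "(x', y') \<in> Ar" "vid x' = vid x" "z = vid y'" using x(2) by (auto simp: E2_def)
      then have "x' = x" using inj x(1) Ar by (auto dest: inj_onD)
      then have "(lb x, lb y') \<in> k" using z x n by (auto simp: k_def)
      then show "z \<in> E1 `` {y}" using x(2) z by (auto simp: E1_def vid_def)
    qed
    then show "E1 `` {y} = E2 `` {y} \<and> (y \<in> UNIV \<longleftrightarrow> y \<in> vid ` V) \<and>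
      (\<forall>\<tau>. lab y ! (len + 2 * \<tau>) = (if y \<in> vid ` V then lb (the_inv_into V vid y) ! (len + 2 * \<tau>) else 0) \<and>
           lab y ! (len + 2 * \<tau> + 1) = (if y \<in> vid ` V then lb (the_inv_into V vid y) ! (len + 2 * \<tau> + 1) else 0))"
      using lab inv x by simp
  qed
  then show ?thesis
    unfolding decide_def Let_def k_def[symmetric] lab_def E1_def E2_def vid_def .
qed

section \<open>Geometric random variables from the tapes\<close>

abbreviation coin :: "bool measure" where
  "coin \<equiv> measure_pmf (bernoulli_pmf (1/2))"

interpretation coins: product_prob_space "\<lambda>_ :: nat. coin" UNIV
  by unfold_locales

lemma prob_space_tape_space: "prob_space tape_space"
  unfolding tape_space_def by (rule coins.P.prob_space_axioms)

lemma space_tape_space [simp]: "space tape_space = UNIV"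
  by (simp add: tape_space_def space_PiM)

lemma tape_component [measurable]: "Measurable.pred tape_space (\<lambda>\<rho>. \<rho> j)"
proof -
  have "(\<lambda>\<rho>. \<rho> j) \<in> tape_space \<rightarrow>\<^sub>M coin"
    unfolding tape_space_def by (rule measurable_component_singleton) simp
  then show ?thesis by simp
qed

lemma measurable_streak [measurable]: "streak \<beta> \<in> tape_space \<rightarrow>\<^sub>M count_space UNIV"
  unfolding streak_def by measurable

lemma measurable_label: "label b \<in> tape_space \<rightarrow>\<^sub>M count_space UNIV"
  unfolding measurable_count_space_eq2_countable
proof (intro conjI ballI)
  fix a
  have "label b -` {a} \<inter> space tape_space = {\<rho> \<in> space tape_space. length a = b \<and> (\<forall>\<beta><b. streak \<beta> \<rho> = a ! \<beta>)}"
  proof -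
    have "label b \<rho> = a \<longleftrightarrow> length a = b \<and> (\<forall>\<beta><b. streak \<beta> \<rho> = a ! \<beta>)" for \<rho>
      by (subst list_eq_iff_nth_eq) (auto simp: label_def)
    then show ?thesis by auto
  qed
  also have "\<dots> \<in> sets tape_space"
    by measurable
  finally show "label b -` {a} \<inter> space tape_space \<in> sets tape_space" .
qed auto

lemma emeasure_tape_cylinder:
  assumes "finite J"
  shows "emeasure tape_space {\<rho>. \<forall>j\<in>J. \<rho> j = c j} = ennreal ((1/2) ^ card J)"
proof -
  have "emeasure tape_space {\<rho>. \<forall>j\<in>J. \<rho> j = c j} =
    emeasure (PiM UNIV (\<lambda>_ :: nat. coin)) {\<rho> \<in> space (PiM UNIV (\<lambda>_. coin)). \<forall>j\<in>J. \<rho> j \<in> {c j}}"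
    by (simp add: tape_space_def space_PiM)
  also have "\<dots> = (\<Prod>j\<in>J. emeasure coin {c j})"
    using assms by (intro coins.emeasure_PiM_Collect) auto
  also have "\<dots> = (\<Prod>j\<in>J. ennreal (1/2))"
    by (intro prod.cong refl) (simp add: emeasure_pmf_single pmf_bernoulli_True pmf_bernoulli_False bernoulli_pmf.rep_eq split: bool.split)
  also have "\<dots> = ennreal ((1/2) ^ card J)"
    by (subst prod_ennreal) auto
  finally show ?thesis .
qed

definition streaks :: "'v set \<Rightarrow> nat \<Rightarrow> ('v \<Rightarrow> tape) \<Rightarrow> 'v \<times> nat \<Rightarrow> nat" where
  "streaks V b \<omega> = (\<lambda>(v, \<beta>). if v \<in> V \<and> \<beta> < b then streak \<beta> (\<omega> v) else 0)"

lemma prob_space_tapes: "prob_space (tapes V)"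
  unfolding tapes_def by (rule prob_space_PiM) (rule prob_space_tape_space)

lemma measurable_streaks_eq:
  assumes "finite V"
  shows "{\<omega> \<in> space (tapes V). streaks V b \<omega> = y} \<in> sets (tapes V)"
proof -
  have [measurable]: "(\<lambda>\<omega>. \<omega> v) \<in> tapes V \<rightarrow>\<^sub>M tape_space" if "v \<in> V" for v
    unfolding tapes_def using that by (rule measurable_component_singleton)
  have "{\<omega> \<in> space (tapes V). streaks V b \<omega> = y} =
    (if \<forall>v \<beta>. v \<in> V \<and> \<beta> < b \<or> y (v, \<beta>) = 0
     then {\<omega> \<in> space (tapes V). \<forall>v\<in>V. \<forall>\<beta><b. streak \<beta> (\<omega> v) = y (v, \<beta>)} else {})"
    by (auto simp: streaks_def fun_eq_iff)
  also have "\<dots> \<in> sets (tapes V)"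
  proof -
    have "{\<omega> \<in> space (tapes V). \<forall>v\<in>V. \<forall>\<beta><b. streak \<beta> (\<omega> v) = y (v, \<beta>)} \<in> sets (tapes V)"
      using assms by measurable
    moreover have "(if c then B else {}) \<in> sets M" if "B \<in> sets M" for c B and M :: "('a \<Rightarrow> tape) measure"
      using that by simp
    ultimately show ?thesis by blast
  qed
  finally show ?thesis .
qed

text \<open>The value \<open>y (v, \<beta>)\<close> is forced by the first
  \<open>Suc (y (v, \<beta>))\<close> bits of its row, so \<open>y\<close> is forced on a cylinder
  whose measure is exactly the product probability. A lower bound suffices for transferring success
  probabilities and avoids discussing rows of ones only.\<close>

lemma pmf_le_streaks:
  assumes V: "finite V" and y: "\<And>v \<beta>. \<not> (v \<in> V \<and> \<beta> < b) \<Longrightarrow> y (v, \<beta>) = 0"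
  shows "ennreal (pmf (geos (V \<times> {..<b})) y) \<le> emeasure (tapes V) {\<omega> \<in> space (tapes V). streaks V b \<omega> = y}"
proof -
  interpret tape: prob_space tape_space by (rule prob_space_tape_space)
  interpret T: product_prob_space "\<lambda>_ :: 'a. tape_space" V
    by unfold_locales
  define J where "J v = prod_encode ` (SIGMA \<beta>:{..<b}. {..y (v, \<beta>)})" for v
  define C where "C v = {\<rho>. \<forall>j\<in>J v. \<rho> j = (snd (prod_decode j) < y (v, fst (prod_decode j)))}" for v
  have finJ: "finite (J v)" for v by (simp add: J_def)
  have "card (J v) = (\<Sum>\<beta><b. Suc (y (v, \<beta>)))" for v
    unfolding J_def by (subst card_image) (auto simp: inj_prod_encode)
  then have meas: "emeasure tape_space (C v) = ennreal (\<Prod>\<beta><b. (1/2) ^ Suc (y (v, \<beta>)))" for v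
    unfolding C_def using finJ by (subst emeasure_tape_cylinder) (auto simp: power_sum)
  have sets: "C v \<in> sets tape_space" for v
  proof -
    have "{\<rho> \<in> space tape_space. \<forall>j\<in>J v. \<rho> j = (snd (prod_decode j) < y (v, fst (prod_decode j)))} \<in> sets tape_space"
      using finJ[of v] by measurable
    then show ?thesis by (simp add: C_def)
  qed
  have "pmf (geos (V \<times> {..<b})) y = (\<Prod>(v, \<beta>)\<in>V \<times> {..<b}. (1/2) ^ Suc (y (v, \<beta>)))"
  proof (subst pmf_Pi')
    show "y x = 0" if "x \<notin> V \<times> {..<b}" for x
      using y[of "fst x" "snd x"] that by (cases x) auto
  qed (use V in \<open>auto intro!: prod.cong\<close>)
  also have "\<dots> = (\<Prod>v\<in>V. \<Prod>\<beta><b. (1/2) ^ Suc (y (v, \<beta>)))"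
    by (rule prod.cartesian_product[symmetric])
  finally have "ennreal (pmf (geos (V \<times> {..<b})) y) = (\<Prod>v\<in>V. emeasure tape_space (C v))"
    by (simp add: meas prod_ennreal prod_nonneg)
  also have "\<dots> = emeasure (tapes V) (Pi\<^sub>E V C)"
    unfolding tapes_def using V sets by (intro T.emeasure_PiM[symmetric]) auto
  also have "\<dots> \<le> emeasure (tapes V) {\<omega> \<in> space (tapes V). streaks V b \<omega> = y}"
  proof (rule emeasure_mono[OF _ measurable_streaks_eq[OF V]])
    show "Pi\<^sub>E V C \<subseteq> {\<omega> \<in> space (tapes V). streaks V b \<omega> = y}"
    proof
      fix \<omega> assume \<omega>: "\<omega> \<in> Pi\<^sub>E V C"
      have "streak \<beta> (\<omega> v) = y (v, \<beta>)" if v: "v \<in> V" "\<beta> < b" for v \<beta>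
      proof -
        have c: "\<omega> v (prod_encode (\<beta>, i)) \<longleftrightarrow> i < y (v, \<beta>)" if "i \<le> y (v, \<beta>)" for i
        proof -
          have "prod_encode (\<beta>, i) \<in> J v" using that v by (auto simp: J_def)
          moreover have "\<omega> v \<in> C v" using \<omega> v by auto
          ultimately show ?thesis by (auto simp: C_def)
        qed
        have "(LEAST i. \<not> \<omega> v (prod_encode (\<beta>, i))) = y (v, \<beta>)"
        proof (rule Least_equality)
          show "y (v, \<beta>) \<le> i" if "\<not> \<omega> v (prod_encode (\<beta>, i))" for i
            using c[of i] that by linarith
        qed (use c in simp)
        moreover have "\<not> \<omega> v (prod_encode (\<beta>, y (v, \<beta>)))" using c by simp
        ultimately show ?thesis by (auto simp: streak_def)
      qed
      then show "\<omega> \<in> {\<omega> \<in> space (tapes V). streaks V b \<omega> = y}"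
        using \<omega> y by (auto simp: streaks_def fun_eq_iff tapes_def space_PiM PiE_def)
    qed
  qed
  finally show ?thesis .
qed

lemma streaks_range:
  assumes "finite V"
  shows "countable (PiE_dflt (V \<times> {..<b}) (0 :: nat) (\<lambda>_. UNIV))" "streaks V b \<omega> \<in> PiE_dflt (V \<times> {..<b}) 0 (\<lambda>_. UNIV)"
proof -
  have "countable ((\<lambda>h x. if x \<in> V \<times> {..<b} then h x else 0) ` (PiE (V \<times> {..<b}) (\<lambda>_. UNIV :: nat set)))"
    using assms by (intro countable_image countable_PiE) auto
  then show "countable (PiE_dflt (V \<times> {..<b}) (0 :: nat) (\<lambda>_. UNIV))"
    by (simp only: dflt_image_PiE)
  show "streaks V b \<omega> \<in> PiE_dflt (V \<times> {..<b}) 0 (\<lambda>_. UNIV)"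
    by (auto simp: PiE_dflt_def streaks_def)
qed

text \<open>Finitely many streaks have only countably many joint values, so every set
  \<open>S\<close> gives a measurable event, and \<open>pmf_le_streaks\<close> can be summed over
  its values.\<close>

lemma tapes_event:
  fixes V :: "'v set" and S b
  assumes V: "finite V"
  defines "evt \<equiv> {\<omega> \<in> space (tapes V). streaks V b \<omega> \<in> S}"
  shows "evt \<in> sets (tapes V)" and "measure (geos (V \<times> {..<b})) S \<le> measure (tapes V) evt"
proof -
  interpret T: prob_space "tapes V" by (rule prob_space_tapes)
  define Y where "Y = PiE_dflt (V \<times> {..<b}) (0 :: nat) (\<lambda>_. UNIV) \<inter> S"
  define slice where "slice y = {\<omega> \<in> space (tapes V). streaks V b \<omega> = y}" for y
  have Y: "countable Y" using streaks_range(1)[OF V] by (auto simp: Y_def intro: countable_subset)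
  have evt: "evt = (\<Union>y\<in>Y. slice y)"
    using streaks_range(2)[OF V] by (auto simp: evt_def Y_def slice_def)
  have slice: "slice y \<in> sets (tapes V)" for y
    unfolding slice_def by (rule measurable_streaks_eq[OF V])
  show "evt \<in> sets (tapes V)"
    unfolding evt using Y slice by auto
  have "emeasure (geos (V \<times> {..<b})) S = emeasure (geos (V \<times> {..<b})) Y"
    using set_Pi_pmf_subset[of "V \<times> {..<b}" 0 "\<lambda>_. geo"] V
    by (intro emeasure_eq_AE) (auto simp: AE_measure_pmf_iff Y_def PiE_dflt_def)
  also have "\<dots> = (\<integral>\<^sup>+y. pmf (geos (V \<times> {..<b})) y \<partial>count_space Y)"
    by (rule nn_integral_pmf[symmetric])
  also have "\<dots> \<le> (\<integral>\<^sup>+y. emeasure (tapes V) (slice y) \<partial>count_space Y)"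
    unfolding slice_def using pmf_le_streaks[OF V] by (intro nn_integral_mono) (auto simp: Y_def PiE_dflt_def)
  also have "\<dots> = emeasure (tapes V) evt"
    unfolding evt using Y slice
    by (intro emeasure_UN_countable[symmetric]) (auto simp: disjoint_family_on_def slice_def)
  finally show "measure (geos (V \<times> {..<b})) S \<le> measure (tapes V) evt"
    by (simp add: measure_pmf.emeasure_eq_measure T.emeasure_eq_measure)
qed

section \<open>The success probability\<close>

lemma (in repeated_carving) alive_cong:
  assumes "\<And>\<sigma>. \<sigma> < \<tau> \<Longrightarrow> X' \<sigma> = X \<sigma>" "\<And>\<sigma>. \<sigma> < \<tau> \<Longrightarrow> G' \<sigma> = G \<sigma>"
  shows "repeated_carving.alive h r R lam E A0 X' G' \<tau> = alive \<tau>"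
  using assms
proof (induction \<tau>)
  case 0
  show ?case by (simp add: repeated_carving.alive.simps)
next
  case (Suc \<tau>)
  then show ?case by (simp add: repeated_carving.alive.simps)
qed

lemma geos_reindex:
  fixes \<kappa> :: "nat \<Rightarrow> 'a \<times> nat"
  assumes fin: "finite V" and inj: "inj_on \<kappa> V"
  shows "measure (geos (\<kappa> ` V)) {f. Q (\<lambda>i. if i \<in> V then f (\<kappa> i) else 0)} = measure (geos V) {f. Q f}"
proof -
  \<comment> \<open>Reindexing needs a total map that sends everything outside \<open>V\<close>
    outside the image of \<open>\<kappa>\<close>. The dummy index \<open>c\<close> is such a target,
    where the default 0 is read.\<close>
  have "finite (snd ` \<kappa> ` V)" using fin by simp
  then obtain m where m: "m \<notin> snd ` \<kappa> ` V" using ex_new_if_finite infinite_UNIV_nat by blast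
  define c where "c = (undefined :: 'a, m)"
  have c: "c \<notin> \<kappa> ` V" using m imageI[of c "\<kappa> ` V" snd] by (auto simp: c_def)
  define g where "g i = (if i \<in> V then \<kappa> i else c)" for i
  have bij: "bij_betw g V (\<kappa> ` V)"
    using inj by (auto simp: bij_betw_def inj_on_def g_def)
  have "geos V = map_pmf (\<lambda>f. f \<circ> g) (geos (\<kappa> ` V))"
    using fin bij c by (intro Pi_pmf_bij_betw) (auto simp: g_def)
  then have "measure (geos V) {f. Q f} = measure (geos (\<kappa> ` V)) {f. Q (f \<circ> g)}"
    by (simp add: vimage_def)
  also have "\<dots> = measure (geos (\<kappa> ` V)) {f. Q (\<lambda>i. if i \<in> V then f (\<kappa> i) else 0)}"
  proof (rule measure_pmf.finite_measure_eq_AE)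
    show "AE f in geos (\<kappa> ` V). f \<in> {f. Q (f \<circ> g)} \<longleftrightarrow> f \<in> {f. Q (\<lambda>i. if i \<in> V then f (\<kappa> i) else 0)}"
    proof (subst AE_measure_pmf_iff, intro ballI)
      fix f assume "f \<in> set_pmf (geos (\<kappa> ` V))"
      then have "\<forall>x. x \<notin> \<kappa> ` V \<longrightarrow> f x = 0"
        using set_Pi_pmf_subset[of "\<kappa> ` V" 0 "\<lambda>_. geo"] fin by blast
      then have "f c = 0" using c by blast
      then have "f \<circ> g = (\<lambda>i. if i \<in> V then f (\<kappa> i) else 0)" by (auto simp: g_def fun_eq_iff)
      then show "f \<in> {f. Q (f \<circ> g)} \<longleftrightarrow> f \<in> {f. Q (\<lambda>i. if i \<in> V then f (\<kappa> i) else 0)}" by simp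
    qed
  qed auto
  finally show ?thesis by simp
qed

text \<open>Entry \<open>\<beta>\<close> of the label of \<open>v\<close> is \<open>y (v, \<beta>)\<close>.\<close>

locale random_labels =
  fixes V :: "'v set" and Ar :: "('v \<times> 'v) set" and h r R lam s len K :: nat
  assumes finV: "finite V" and Ar: "Ar \<subseteq> V \<times> V" "sym Ar"
    and pos: "h > 0" "s > 0" and r: "r = 3 * s" and lam: "lam = 7000 * s" and R: "R = 64 * lam"
begin

definition vid :: "('v \<times> nat \<Rightarrow> nat) \<Rightarrow> 'v \<Rightarrow> nat" where
  "vid y v = to_nat (map (\<lambda>\<beta>. y (v, \<beta>)) [0..<len])"

definition entry :: "('v \<times> nat \<Rightarrow> nat) \<Rightarrow> nat \<Rightarrow> nat \<Rightarrow> nat" where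
  "entry y \<beta> i = (if i \<in> vid y ` V then y (the_inv_into V (vid y) i, \<beta>) else 0)"

definition graph :: "('v \<times> nat \<Rightarrow> nat) \<Rightarrow> nat rel" where
  "graph y = {(vid y u, vid y v) | u v. (u, v) \<in> Ar}"

abbreviation samples :: "('v \<times> nat \<Rightarrow> nat) \<Rightarrow> nat \<Rightarrow> nat \<Rightarrow> nat" where
  "samples y \<tau> \<equiv> entry y (len + 2 * \<tau>)"

abbreviation radii :: "('v \<times> nat \<Rightarrow> nat) \<Rightarrow> nat \<Rightarrow> nat \<Rightarrow> nat" where
  "radii y \<tau> \<equiv> entry y (len + 2 * \<tau> + 1)"

abbreviation undecided :: "('v \<times> nat \<Rightarrow> nat) \<Rightarrow> nat \<Rightarrow> nat set" where
  "undecided y \<equiv> repeated_carving.alive h r R lam (graph y) (vid y ` V) (samples y) (radii y)"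

abbreviation indices :: "('v \<times> nat) set" where
  "indices \<equiv> V \<times> {..<len + 2 * K}"

lemma finite_repeated_carving: "finite_repeated_carving h r R lam (graph y) (vid y ` V)"
proof
  show "sym (graph y)" using Ar(2) by (auto simp: graph_def sym_def)
qed (use finV pos r lam R in auto)

lemma alive_subset: "undecided y \<tau> \<subseteq> vid y ` V" and finite_alive: "finite (undecided y \<tau>)"
proof -
  interpret finite_repeated_carving h r R lam "graph y" "vid y ` V" "samples y" "radii y"
    by (rule finite_repeated_carving)
  show "undecided y \<tau> \<subseteq> vid y ` V" using alive_antimono[of 0 \<tau>] by (simp add: repeated_carving.alive.simps)
  show "finite (undecided y \<tau>)" by (rule finite_alive)
qed

lemma alive_set: "undecided y \<tau> \<noteq> {} \<Longrightarrow> alive_set h r R lam s (graph y) (undecided y \<tau>)"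
  using finite_repeated_carving[of y] finite_alive pos r lam R
  by (simp add: alive_set_def finite_repeated_carving_def)

definition bad :: "nat \<Rightarrow> ('v \<times> nat \<Rightarrow> nat) \<Rightarrow> bool" where
  "bad \<tau> y \<longleftrightarrow> inj_on (vid y) V \<and> undecided y \<tau> \<noteq> {} \<and>
     (alive_set.bad_sample h r R lam s (graph y) (undecided y \<tau>) (samples y \<tau>) \<or>
      alive_set.bad_radii h r R lam s (graph y) (undecided y \<tau>) (samples y \<tau>) (radii y \<tau>))"

lemma card_alive_le: "card (undecided y \<tau>) \<le> card V"
  using card_mono[OF _ alive_subset[of y \<tau>]] card_image_le[OF finV, of "vid y"] finV
  by (meson finite_imageI order_trans)

text \<open>Freeze all label entries except number \<open>\<beta>\<close>. By
  \<open>len \<le> \<beta>\<close> the identifiers are frozen too, and if they are injective, the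
  remaining column is a fresh geometric family indexed by identifiers. So a bound for one round with
  fixed history carries over to random labels.\<close>

lemma prob_bad_block:
  assumes \<beta>: "len \<le> \<beta>" "\<beta> < len + 2 * K"
    and A: "\<And>y y'. \<forall>x. snd x \<noteq> \<beta> \<longrightarrow> y x = y' x \<Longrightarrow> Ev y = Ev' y' (entry y \<beta>)"
    and Ev': "\<And>y. inj_on (vid y) V \<Longrightarrow> measure (geos (vid y ` V)) {X. Ev' y X} \<le> q" and q: "0 \<le> q"
  shows "measure (geos indices) {y. inj_on (vid y) V \<and> Ev y} \<le> q"
proof (rule Pi_pmf_prob_le[where C = "V \<times> {\<beta>}"])
  fix g :: "'v \<times> nat \<Rightarrow> nat"
  define mrg where "mrg = (\<lambda>f x. if x \<in> V \<times> {\<beta>} then f x else g x)"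
  have same: "\<forall>x. snd x \<noteq> \<beta> \<longrightarrow> mrg f x = g x" for f
    by (auto simp: mrg_def)
  have vid: "vid (mrg f) = vid g" for f
    using \<beta> by (auto simp: vid_def fun_eq_iff same intro!: arg_cong[where f = to_nat])
  show "measure (geos (V \<times> {\<beta>})) {f. inj_on (vid (\<lambda>x. if x \<in> V \<times> {\<beta>} then f x else g x)) V \<and>
      Ev (\<lambda>x. if x \<in> V \<times> {\<beta>} then f x else g x)} \<le> q"
  proof (cases "inj_on (vid g) V")
    case True
    define \<kappa> where "\<kappa> i = (the_inv_into V (vid g) i, \<beta>)" for i
    have \<kappa>: "\<kappa> ` vid g ` V = V \<times> {\<beta>}" "inj_on \<kappa> (vid g ` V)"
      using True by (auto simp: \<kappa>_def image_iff the_inv_into_f_f inj_on_def)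
    have ent: "entry (mrg f) \<beta> = (\<lambda>i. if i \<in> vid g ` V then f (\<kappa> i) else 0)" for f
    proof -
      have "mrg f (v, \<beta>) = f (v, \<beta>)" if "v \<in> V" for v using that by (simp add: mrg_def)
      then show ?thesis
        unfolding entry_def vid \<kappa>_def using the_inv_into_into[OF True _ subset_refl] by (simp add: fun_eq_iff)
    qed
    have "measure (geos (V \<times> {\<beta>})) {f. inj_on (vid (mrg f)) V \<and> Ev (mrg f)} =
      measure (geos (\<kappa> ` vid g ` V)) {f. Ev' g (\<lambda>i. if i \<in> vid g ` V then f (\<kappa> i) else 0)}"
      using True A[OF same] by (simp add: vid ent \<kappa>)
    also have "\<dots> = measure (geos (vid g ` V)) {X. Ev' g X}"
      using finV \<kappa> by (intro geos_reindex) auto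
    finally show ?thesis
      using Ev'[OF True] unfolding mrg_def by linarith
  next
    case False
    have "{f. inj_on (vid (mrg f)) V \<and> Ev (mrg f)} = {}" using False by (simp add: vid)
    then show ?thesis using q unfolding mrg_def by (simp only: measure_empty)
  qed
qed (use finV \<beta> in auto)

lemma entry_cong:
  assumes "\<forall>x. snd x \<noteq> \<beta> \<longrightarrow> y x = y' x" "len \<le> \<beta>"
  shows "vid y = vid y'" "graph y = graph y'" "\<gamma> \<noteq> \<beta> \<Longrightarrow> entry y \<gamma> = entry y' \<gamma>"
proof -
  show 1: "vid y = vid y'"
    using assms by (auto simp: vid_def fun_eq_iff intro!: arg_cong[where f = to_nat])
  then show "graph y = graph y'" by (simp add: graph_def)
  show "entry y \<gamma> = entry y' \<gamma>" if "\<gamma> \<noteq> \<beta>"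
    using assms that by (auto simp: entry_def 1 fun_eq_iff)
qed

lemma alive_entry_cong:
  assumes "\<forall>x. snd x \<noteq> \<beta> \<longrightarrow> y x = y' x" "len + 2 * \<tau> \<le> \<beta>"
  shows "undecided y \<tau> = undecided y' \<tau>"
proof -
  have "len \<le> \<beta>" using assms(2) by simp
  note c = entry_cong[OF assms(1) this]
  have "undecided y \<tau> = repeated_carving.alive h r R lam (graph y') (vid y' ` V) (samples y) (radii y) \<tau>"
    by (simp add: c(1,2))
  also have "\<dots> = undecided y' \<tau>"
  proof (rule repeated_carving.alive_cong)
    fix \<sigma> assume "\<sigma> < \<tau>"
    then have "len + 2 * \<sigma> \<noteq> \<beta>" "len + 2 * \<sigma> + 1 \<noteq> \<beta>" using assms(2) by auto
    then show "samples y \<sigma> = samples y' \<sigma>" "radii y \<sigma> = radii y' \<sigma>"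
      by (auto intro: c(3))
  qed
  finally show ?thesis .
qed

text \<open>\<open>prob_bad_block\<close> is used twice: for the samples with the history fixed, and
  for the radii with history and samples fixed. The undecided set depends on earlier columns
  only.\<close>

lemma prob_bad:
  assumes \<tau>: "\<tau> < K"
  shows "measure (geos indices) {y. bad \<tau> y} \<le>
    (real (card V) * (1/2) ^ lam + exp (- real s)) + (real (card V) * (1/2) ^ r + exp (- real s))"
proof -
  let ?q1 = "real (card V) * (1/2) ^ lam + exp (- real s)" and ?q2 = "real (card V) * (1/2) ^ r + exp (- real s)"
  define S where "S y X \<longleftrightarrow> undecided y \<tau> \<noteq> {} \<and> alive_set.bad_sample h r R lam s (graph y) (undecided y \<tau>) X" for y X
  define G where "G y X \<longleftrightarrow> undecided y \<tau> \<noteq> {} \<and> alive_set.bad_radii h r R lam s (graph y) (undecided y \<tau>) (samples y \<tau>) X" for y X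
  have "measure (geos indices) {y. inj_on (vid y) V \<and> S y (samples y \<tau>)} \<le> ?q1"
  proof (rule prob_bad_block[where \<beta> = "len + 2 * \<tau>" and Ev' = S])
    show "S y (samples y \<tau>) = S y' (samples y \<tau>)" if "\<forall>x. snd x \<noteq> len + 2 * \<tau> \<longrightarrow> y x = y' x" for y y'
      using alive_entry_cong[OF that, of \<tau>] entry_cong(2)[OF that] by (simp add: S_def)
    show "measure (geos (vid y ` V)) {X. S y X} \<le> ?q1" for y
    proof (cases "undecided y \<tau> = {}")
      case False
      interpret alive_set h r R lam s "graph y" "undecided y \<tau>" by (rule alive_set[OF False])
      have "measure (geos (vid y ` V)) {X. bad_sample X} \<le> real (card (undecided y \<tau>)) * (1/2) ^ lam + exp (- real s)"
        using finV alive_subset by (intro prob_bad_sample) auto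
      also have "\<dots> \<le> ?q1"
        using card_alive_le by (intro add_mono mult_right_mono) auto
      finally show ?thesis using False by (simp add: S_def)
    qed (simp add: S_def)
  qed (use \<tau> in auto)
  moreover have "measure (geos indices) {y. inj_on (vid y) V \<and> G y (radii y \<tau>)} \<le> ?q2"
  proof (rule prob_bad_block[where \<beta> = "len + 2 * \<tau> + 1" and Ev' = G])
    show "G y (radii y \<tau>) = G y' (radii y \<tau>)" if "\<forall>x. snd x \<noteq> len + 2 * \<tau> + 1 \<longrightarrow> y x = y' x" for y y'
      using alive_entry_cong[OF that, of \<tau>] entry_cong(2)[OF that] entry_cong(3)[OF that, of "len + 2 * \<tau>"]
      by (simp add: G_def)
    show "measure (geos (vid y ` V)) {X. G y X} \<le> ?q2" for y
    proof (cases "undecided y \<tau> = {}")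
      case False
      interpret alive_set h r R lam s "graph y" "undecided y \<tau>" by (rule alive_set[OF False])
      have "measure (geos (vid y ` V)) {X. bad_radii (samples y \<tau>) X} \<le> real (card (undecided y \<tau>)) * (1/2) ^ r + exp (- real s)"
        using finV alive_subset by (intro prob_bad_radii) auto
      also have "\<dots> \<le> ?q2"
        using card_alive_le by (intro add_mono mult_right_mono) auto
      finally show ?thesis using False by (simp add: G_def)
    qed (simp add: G_def)
  qed (use \<tau> in auto)
  moreover have "{y. bad \<tau> y} = {y. inj_on (vid y) V \<and> S y (samples y \<tau>)} \<union> {y. inj_on (vid y) V \<and> G y (radii y \<tau>)}"
    by (auto simp: bad_def S_def G_def)
  ultimately show ?thesis
    using measure_Un_le[of "{y. inj_on (vid y) V \<and> S y (samples y \<tau>)}" "geos indices" "{y. inj_on (vid y) V \<and> G y (radii y \<tau>)}"]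
    by simp
qed

text \<open>A birthday bound: no value of \<open>geo\<close> has probability above 1/2, so each of
  the \<open>len\<close> entries of \<open>u\<close> matches that of another vertex with probability
  at most 1/2.\<close>

lemma prob_not_inj: "measure (geos indices) {y. \<not> inj_on (vid y) V} \<le> real (card V) ^ 2 * (1/2) ^ len"
proof -
  let ?D = "{(u, v) \<in> V \<times> V. u \<noteq> v}"
  let ?T = "\<lambda>p. {y :: 'v \<times> nat \<Rightarrow> nat. \<forall>\<beta><len. y (fst p, \<beta>) = y (snd p, \<beta>)}"
  have fin: "finite ?D" by (rule finite_subset[of _ "V \<times> V"]) (use finV in auto)
  have "{y. \<not> inj_on (vid y) V} \<subseteq> (\<Union>p\<in>?D. ?T p)"
    by (auto simp: inj_on_def vid_def)
  then have "measure (geos indices) {y. \<not> inj_on (vid y) V} \<le> measure (geos indices) (\<Union>p\<in>?D. ?T p)"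
    by (intro measure_pmf.finite_measure_mono) auto
  also have "\<dots> \<le> (\<Sum>p\<in>?D. measure (geos indices) (?T p))"
    by (rule measure_UNION_le) (use fin in auto)
  also have "\<dots> \<le> (\<Sum>p\<in>?D. (1/2) ^ len)"
  proof (rule sum_mono)
    fix p assume p: "p \<in> ?D"
    obtain u v where uv: "p = (u, v)" "u \<in> V" "v \<in> V" "u \<noteq> v" using p by auto
    show "measure (geos indices) (?T p) \<le> (1/2) ^ len"
    proof (rule Pi_pmf_prob_le[where C = "{u} \<times> {..<len}"])
      fix g :: "'v \<times> nat \<Rightarrow> nat"
      have "measure (geos ({u} \<times> {..<len})) {f. \<forall>\<beta><len. (if (fst p, \<beta>) \<in> {u} \<times> {..<len} then f (fst p, \<beta>) else g (fst p, \<beta>)) =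
          (if (snd p, \<beta>) \<in> {u} \<times> {..<len} then f (snd p, \<beta>) else g (snd p, \<beta>))} =
        measure (geos ({u} \<times> {..<len})) {f. \<forall>i\<in>{u} \<times> {..<len}. f i \<in> {g (v, snd i)}}"
        using uv by (intro arg_cong[where f = "measure _"]) auto
      also have "\<dots> = (\<Prod>i\<in>{u} \<times> {..<len}. measure geo {g (v, snd i)})"
        by (rule measure_geos_Pi) auto
      also have "\<dots> \<le> (\<Prod>i\<in>{u} \<times> {..<len}. 1/2)"
        by (intro prod_mono) (auto simp: measure_pmf_single power_le_one)
      also have "\<dots> = (1/2) ^ len" by simp
      finally show "measure (geos ({u} \<times> {..<len})) {f. \<forall>\<beta><len. (if (fst p, \<beta>) \<in> {u} \<times> {..<len} then f (fst p, \<beta>) else g (fst p, \<beta>)) =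
          (if (snd p, \<beta>) \<in> {u} \<times> {..<len} then f (snd p, \<beta>) else g (snd p, \<beta>))} \<le> (1/2) ^ len" .
    qed (use finV uv in auto)
  qed
  also have "\<dots> \<le> real (card V) ^ 2 * (1/2) ^ len"
  proof -
    have "card ?D \<le> card (V \<times> V)" using finV by (intro card_mono) auto
    then have "real (card ?D) \<le> real (card V) ^ 2"
      by (simp add: card_cartesian_product power2_eq_square flip: of_nat_mult)
    then show ?thesis by (simp add: mult_right_mono)
  qed
  finally show ?thesis .
qed

definition good :: "('v \<times> nat \<Rightarrow> nat) \<Rightarrow> bool" where
  "good y \<longleftrightarrow> inj_on (vid y) V \<and> (\<forall>\<tau><K. 8 * card (undecided y (Suc \<tau>)) \<le> 7 * card (undecided y \<tau>))"

lemma prob_good: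
  "1 - (real (card V) ^ 2 * (1/2) ^ len +
     real K * ((real (card V) * (1/2) ^ lam + exp (- real s)) + (real (card V) * (1/2) ^ r + exp (- real s))))
   \<le> measure (geos indices) {y. good y}" (is "1 - (?a + real K * ?b) \<le> _")
proof -
  have sub: "- {y. good y} \<subseteq> {y. \<not> inj_on (vid y) V} \<union> (\<Union>\<tau><K. {y. bad \<tau> y})"
  proof
    fix y assume "y \<in> - {y. good y}"
    then have ng: "\<not> good y" by simp
    show "y \<in> {y. \<not> inj_on (vid y) V} \<union> (\<Union>\<tau><K. {y. bad \<tau> y})"
    proof (cases "inj_on (vid y) V")
      case True
      then obtain \<tau> where \<tau>: "\<tau> < K" "\<not> 8 * card (undecided y (Suc \<tau>)) \<le> 7 * card (undecided y \<tau>)"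
        using ng by (auto simp: good_def)
      have Suc: "undecided y (Suc \<tau>) = carving.rest h r R lam (graph y) (undecided y \<tau>) (samples y \<tau>) (radii y \<tau>)"
        by (simp add: repeated_carving.alive.simps)
      have ne: "undecided y \<tau> \<noteq> {}"
        using \<tau>(2) unfolding Suc by (auto simp: carving.rest_def)
      interpret alive_set h r R lam s "graph y" "undecided y \<tau>" by (rule alive_set[OF ne])
      have "bad \<tau> y"
        using card_rest_le \<tau>(2) True ne unfolding bad_def Suc by blast
      then show ?thesis using \<tau> by blast
    qed simp
  qed
  have "measure (geos indices) (- {y. good y}) \<le>
     measure (geos indices) ({y. \<not> inj_on (vid y) V} \<union> (\<Union>\<tau><K. {y. bad \<tau> y}))"
    using sub by (intro measure_pmf.finite_measure_mono) auto
  also have "\<dots> \<le> measure (geos indices) {y. \<not> inj_on (vid y) V} + measure (geos indices) (\<Union>\<tau><K. {y. bad \<tau> y})"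
    by (rule measure_Un_le) auto
  also have "\<dots> \<le> ?a + (\<Sum>\<tau><K. measure (geos indices) {y. bad \<tau> y})"
    by (intro add_mono prob_not_inj measure_UNION_le) auto
  also have "\<dots> \<le> ?a + (\<Sum>\<tau><K. ?b)"
    by (intro add_mono sum_mono prob_bad order_refl) auto
  also have "\<dots> = ?a + real K * ?b" by simp
  also have "measure (geos indices) (- {y. good y}) = 1 - measure (geos indices) {y. good y}"
    using measure_pmf.prob_compl[of "{y. good y}" "geos indices"] by (simp add: Compl_eq_Diff_UNIV)
  finally show ?thesis by linarith
qed

end

section \<open>The decomposition algorithm\<close>

lemma gdist_le:
  assumes G: "pair_graph G" and u: "u \<in> pverts G" and uv: "(u, v) \<in> parcs G ^^ n"
  shows "gdist G u v \<le> ereal (real n)"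
proof -
  interpret pair_graph G by (rule G)
  have "\<exists>p. awalk u p v \<and> awalk_cost (\<lambda>_. 1) p = real n"
    using u uv
  proof (induction n arbitrary: u)
    case 0
    then show ?case by (auto intro!: exI[of _ "[]"] simp: awalk_Nil_iff)
  next
    case (Suc n)
    then obtain w where w: "(u, w) \<in> parcs G" "(w, v) \<in> parcs G ^^ n"
      using relpow_Suc_D2 by metis
    then obtain p where "awalk w p v" "awalk_cost (\<lambda>_. 1) p = real n"
      using Suc.IH[of w] in_arcsD2 by blast
    then show ?case
      using w by (intro exI[of _ "(u, w) # p"]) (simp add: awalk_Cons_iff)
  qed
  then obtain p where p: "awalk u p v" "awalk_cost (\<lambda>_. 1) p = real n" by blast
  show ?thesis
    using min_cost_le_walk_cost[OF p(1), of "\<lambda>_. 1"] p(2) by (simp add: gdist_def)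
qed

lemma outputs_ldd_cong:
  assumes "\<And>v. v \<in> pverts G \<Longrightarrow> f v = g v"
  shows "outputs_ldd G \<epsilon> d f = outputs_ldd G \<epsilon> d g"
proof -
  have "{v \<in> pverts G. f v = z} = {v \<in> pverts G. g v = z}" for z
    using assms by auto
  moreover have "{i. \<exists>v\<in>pverts G. f v = Some i} = {i. \<exists>v\<in>pverts G. g v = Some i}"
    using assms by auto
  ultimately show ?thesis
    by (simp add: outputs_ldd_def)
qed

lemma outputs_lddI:
  fixes \<epsilon> d :: real
  assumes G: "pair_graph G"
    and adj: "\<And>u v i j. (u, v) \<in> parcs G \<Longrightarrow> f u = Some i \<Longrightarrow> f v = Some j \<Longrightarrow> i = j"
    and near: "\<And>u v i. u \<in> pverts G \<Longrightarrow> v \<in> pverts G \<Longrightarrow> f u = Some i \<Longrightarrow> f v = Some i \<Longrightarrow> v \<in> nball (parcs G) m u"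
    and m: "real m \<le> d"
    and del: "real (card {v\<in>pverts G. f v = None}) \<le> \<epsilon> * card (pverts G)"
  shows "outputs_ldd G \<epsilon> d f"
proof -
  let ?S = "(\<lambda>i. {v \<in> pverts G. f v = Some i}) ` {i. \<exists>v\<in>pverts G. f v = Some i}"
  have "weak_diameter G S \<le> ereal d" if S: "S \<in> ?S" for S
    unfolding weak_diameter_def
  proof (intro SUP_least)
    fix u v assume uv: "u \<in> S" "v \<in> S"
    obtain i where "S = {v \<in> pverts G. f v = Some i}" using S by auto
    then have u: "u \<in> pverts G" and "v \<in> nball (parcs G) m u" using near uv by auto
    then obtain n where n: "n \<le> m" "(u, v) \<in> parcs G ^^ n" by (auto simp: nball_def)
    have "gdist G u v \<le> ereal (real n)" by (rule gdist_le[OF G u n(2)])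
    also have "\<dots> \<le> ereal d" using n m by simp
    finally show "gdist G u v \<le> ereal d" .
  qed
  then show ?thesis
    unfolding outputs_ldd_def low_diameter_decomposition_def
  proof (intro conjI ballI impI)
    have un: "\<Union>?S = {v \<in> pverts G. f v \<noteq> None}" by auto
    show "{v \<in> pverts G. f v = None} \<union> \<Union>?S = pverts G" "{v \<in> pverts G. f v = None} \<inter> \<Union>?S = {}"
      unfolding un by auto
    show "disjoint ?S" by (auto simp: disjoint_def)
    show "(u, v) \<notin> parcs G" if "S \<in> ?S" "T \<in> ?S" "S \<noteq> T" "u \<in> S" "v \<in> T" for S T u v
      using that adj by auto
    show "real (card {v \<in> pverts G. f v = None}) \<le> \<epsilon> * real (card (pverts G))" by (rule del)
  qed auto
qed

lemma (in random_labels) decide_correct: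
  fixes y :: "'v \<times> nat \<Rightarrow> nat"
  assumes y: "good y"
  defines "reach \<equiv> carving.reach h r R"
  defines "lb \<equiv> \<lambda>v. map (\<lambda>\<beta>. y (v, \<beta>)) [0..<len + 2 * K]"
  defines "f \<equiv> \<lambda>v. decide h r R lam len K (lb v)
    {(lb x, lb z) | x z. (\<exists>n<7 * reach * K + 1. (v, x) \<in> Ar ^^ n) \<and> (x, z) \<in> Ar}"
  shows "(u, v) \<in> Ar \<Longrightarrow> f u = Some i \<Longrightarrow> f v = Some j \<Longrightarrow> i = j"
    and "u \<in> V \<Longrightarrow> v \<in> V \<Longrightarrow> f u = Some i \<Longrightarrow> f v = Some i \<Longrightarrow> v \<in> nball Ar (2 * reach) u"
    and "real (card {v\<in>V. f v = None}) \<le> (8 / h + (7/8) ^ K) * card V"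
proof -
  have inj: "inj_on (vid y) V" using y by (simp add: good_def)
  have vid: "ident len (lb v) = vid y v" for v
    by (simp add: ident_def lb_def vid_def take_map take_upt)
  define X where "X \<tau> i = (if i \<in> vid y ` V then lb (the_inv_into V (vid y) i) ! (len + 2 * \<tau>) else 0)" for \<tau> i
  define Y where "Y \<tau> i = (if i \<in> vid y ` V then lb (the_inv_into V (vid y) i) ! (len + 2 * \<tau> + 1) else 0)" for \<tau> i
  interpret C: finite_repeated_carving h r R lam "graph y" "vid y ` V" X Y
    by (rule finite_repeated_carving)
  have R0: "R > 0" using pos lam R by simp
  have f: "f v = C.out K (vid y v)" if "v \<in> V" for v
    using decide_eq[where lb = lb and len = len and r = r and R = R, unfolded vid, OF inj Ar(1) that pos(1) R0 refl, where K = K and lam = lam]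
    unfolding f_def reach_def X_def[abs_def] Y_def[abs_def] graph_def .
  \<comment> \<open>The restriction to \<open>\<tau> < K\<close> matters: beyond it
    \<open>nth\<close> would leave the label, whose length is \<open>len + 2 * K\<close>.\<close>
  have XY: "X \<tau> = samples y \<tau>" "Y \<tau> = radii y \<tau>" if "\<tau> < K" for \<tau>
    using that by (auto simp: X_def Y_def entry_def lb_def fun_eq_iff)
  have al: "C.alive \<tau> = undecided y \<tau>" if "\<tau> \<le> K" for \<tau>
    by (rule repeated_carving.alive_cong) (use XY that in auto)
  show "i = j" if uv: "(u, v) \<in> Ar" and "f u = Some i" "f v = Some j"
  proof (rule C.out_neighbour)
    show "(vid y u, vid y v) \<in> graph y" using uv by (auto simp: graph_def)
    show "C.out K (vid y u) = Some i" "C.out K (vid y v) = Some j"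
      using that f Ar(1) by auto
  qed
  show "v \<in> nball Ar (2 * reach) u" if uV: "u \<in> V" and vV: "v \<in> V" and "f u = Some i" "f v = Some i"
  proof -
    have "vid y v \<in> nball (graph y) (2 * reach) (vid y u)"
      using C.out_near[of K "vid y u" i "vid y v"] that f by (simp add: reach_def)
    then obtain n where n: "n \<le> 2 * reach" "(vid y u, vid y v) \<in> graph y ^^ n" by (auto simp: nball_def)
    then obtain x where "x \<in> V" "vid y v = vid y x" "(u, x) \<in> Ar ^^ n"
      using relpow_image_inj[OF inj Ar(1) uV] unfolding graph_def by blast
    then show ?thesis using inj_onD[OF inj _ vV] n unfolding nball_def by blast
  qed
  have "{x\<in>vid y ` V. C.out K x = None} = vid y ` {v\<in>V. f v = None}"
    using f by auto
  moreover have "card (vid y ` {v\<in>V. f v = None}) = card {v\<in>V. f v = None}"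
    by (rule card_image) (rule inj_on_subset[OF inj], auto)
  moreover have "real (card {x\<in>vid y ` V. C.out K x = None}) \<le> (8 / h + (7/8) ^ K) * card (vid y ` V)"
  proof (rule C.card_out_None)
    fix \<tau> assume "\<tau> < K"
    then show "8 * card (C.alive (Suc \<tau>)) \<le> 7 * card (C.alive \<tau>)"
      using y al[of \<tau>] al[of "Suc \<tau>"] by (simp add: good_def del: C.alive.simps)
  qed
  ultimately show "real (card {v\<in>V. f v = None}) \<le> (8 / h + (7/8) ^ K) * card V"
    using card_image[OF inj] by simp
qed

section \<open>Numerical bounds and assembly\<close>

lemma half_power_le_exp: "(1/2 :: real) ^ j \<le> exp (- 2/3 * real j)"
proof -
  have "(1/2 :: real) ^ j = exp (real j * ln (1/2))"
    by (subst exp_of_nat_mult) simp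
  also have "\<dots> \<le> exp (- 2/3 * real j)"
    using mult_left_mono[OF ln2_ge_two_thirds, of "real j"] by (simp add: ln_div)
  finally show ?thesis .
qed

lemma nat_ceiling_le: "0 \<le> x \<Longrightarrow> real (nat \<lceil>x\<rceil>) \<le> x + 1"
  using of_int_ceiling_le_add_one[of x] by simp

text \<open>Each kind of loss gets half of \<open>e\<close>: \<open>8 / h \<le> e / 2\<close> from
  \<open>h \<ge> 16 / e\<close>, and \<open>(7/8) ^ K \<le> exp (- K / 8) \<le> e / 2\<close> from
  \<open>K \<ge> 8 * ln (2 / e)\<close>.\<close>

lemma deleted_fraction:
  fixes e :: real
  assumes e: "0 < e" "e \<le> 1"
  shows "8 / real (nat \<lceil>16 / e\<rceil>) + (7/8) ^ nat \<lceil>8 * ln (2 / e)\<rceil> \<le> e"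
proof -
  have "16 / e \<le> real (nat \<lceil>16 / e\<rceil>)" by (rule real_nat_ceiling_ge)
  then have "8 / real (nat \<lceil>16 / e\<rceil>) \<le> 8 / (16 / e)"
    using e by (intro divide_left_mono) auto
  moreover have "(7/8 :: real) ^ nat \<lceil>8 * ln (2 / e)\<rceil> \<le> e / 2"
  proof -
    let ?K = "nat \<lceil>8 * ln (2 / e)\<rceil>"
    have "(7/8 :: real) ^ ?K \<le> exp (-1/8) ^ ?K"
      using exp_ge_add_one_self[of "-1/8"] by (intro power_mono) auto
    also have "\<dots> = exp (- (real ?K / 8))"
      by (simp flip: exp_of_nat_mult)
    also have "\<dots> \<le> exp (- ln (2 / e))"
      using real_nat_ceiling_ge[of "8 * ln (2 / e)"] by simp
    also have "\<dots> = e / 2"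
      using e by (simp add: exp_minus)
    finally show ?thesis .
  qed
  ultimately show ?thesis by simp
qed

text \<open>A crude polynomial bound on the number of carving rounds, for the union bound over them.
  It rests on the lower bound for \<open>e\<close>, since the original parameter may be arbitrarily
  small compared with \<open>N\<close>.\<close>

lemma rounds_le:
  fixes e :: real
  assumes N: "N \<ge> 2" and e: "1 / (2 * real N) \<le> e" "e \<le> 1"
  shows "real (nat \<lceil>8 * ln (2 / e)\<rceil>) \<le> 33 * real N"
proof -
  have e0: "0 < e" using e(1) N by (smt (verit) divide_pos_pos of_nat_0_less_iff zero_less_numeral not_numeral_le_zero neq0_conv)
  have "2 / e \<le> 4 * real N" using e(1) e0 N by (simp add: field_simps)
  moreover have "ln (2 / e) \<le> 2 / e - 1" using e0 by (intro ln_le_minus_one) simp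
  moreover have "0 \<le> ln (2 / e)" using e e0 by simp
  ultimately show ?thesis
    using nat_ceiling_le[of "8 * ln (2 / e)"] by linarith
qed

text \<open>By \<open>n \<le> exp s\<close> every term is at most \<open>exp (- s)\<close>, and
  \<open>1 + 4 * K \<le> N ^ 9\<close> counts them. The summand 10 in \<open>s\<close> pays for this
  power and leaves one unit over.\<close>

lemma failure_bound:
  fixes c :: real
  assumes c: "c > 0" and n: "1 \<le> n" "n \<le> N" "2 \<le> N" and K: "real K \<le> 33 * real N"
  defines "s \<equiv> nat \<lceil>(c + 10) * ln (real N)\<rceil>"
  shows "real n ^ 2 * (1/2) ^ (5 * s) +
     real K * ((real n * (1/2) ^ (7000 * s) + exp (- real s)) + (real n * (1/2) ^ (3 * s) + exp (- real s)))
     \<le> real n powr (- c)"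
proof -
  let ?q = "exp (- real s)"
  have s: "(c + 10) * ln (real N) \<le> real s" unfolding s_def by (rule real_nat_ceiling_ge)
  have lnN: "0 \<le> ln (real N)" using n by simp
  have "ln (real N) \<le> (c + 10) * ln (real N)"
    using mult_right_mono[of 1 "c + 10" "ln (real N)"] c lnN by simp
  then have "ln (real N) \<le> real s" using s by linarith
  then have "real N \<le> exp (real s)" using n by (metis exp_le_cancel_iff exp_ln of_nat_0_less_iff order_less_le_trans zero_less_numeral)
  then have ns: "real n \<le> exp (real s)" using n by linarith
  have 1: "real n * (1/2) ^ (3 * s) \<le> ?q"
  proof -
    have "real n * (1/2) ^ (3 * s) \<le> exp (real s) * exp (- 2/3 * real (3 * s))"
      using ns by (intro mult_mono half_power_le_exp) auto
    also have "\<dots> = ?q" by (simp flip: exp_add)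
    finally show ?thesis .
  qed
  have 2: "real n * (1/2) ^ (7000 * s) \<le> ?q"
    using power_decreasing[of "3 * s" "7000 * s" "1/2 :: real"] mult_left_mono[of "(1/2) ^ (7000 * s)" "(1/2) ^ (3 * s)" "real n"] 1
    by auto
  have 3: "real n ^ 2 * (1/2) ^ (5 * s) \<le> ?q"
  proof -
    have "real n ^ 2 * (1/2) ^ (5 * s) \<le> exp (real s) ^ 2 * exp (- 2/3 * real (5 * s))"
      using ns by (intro mult_mono half_power_le_exp power_mono) auto
    also have "\<dots> = exp (2 * real s - 10/3 * real s)"
      by (simp add: power2_eq_square flip: exp_add)
    also have "\<dots> \<le> ?q" by simp
    finally show ?thesis .
  qed
  have "real n ^ 2 * (1/2) ^ (5 * s) +
     real K * ((real n * (1/2) ^ (7000 * s) + ?q) + (real n * (1/2) ^ (3 * s) + ?q)) \<le> ?q + real K * ((?q + ?q) + (?q + ?q))"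
    using 1 2 3 by (intro add_mono mult_left_mono order_refl) auto
  also have "\<dots> = (1 + 4 * real K) * ?q" by (simp add: algebra_simps)
  also have "\<dots> \<le> real N ^ 9 * ?q"
  proof (rule mult_right_mono)
    have "2 ^ 8 \<le> real N ^ 8" using n by (intro power_mono) auto
    then have "256 * real N \<le> real N ^ 8 * real N" by (intro mult_right_mono) auto
    moreover have "real N ^ 9 = real N ^ 8 * real N" by (simp flip: power_Suc2)
    moreover have "1 \<le> real N" using n by simp
    ultimately show "1 + 4 * real K \<le> real N ^ 9" using K by linarith
  qed simp
  also have "\<dots> \<le> real N powr 9 * real N powr (- (c + 10))"
  proof (rule mult_mono)
    show "?q \<le> real N powr (- (c + 10))"
      using s n by (simp add: powr_def algebra_simps)
    show "real N ^ 9 \<le> real N powr 9" using n by (simp add: powr_numeral)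
  qed auto
  also have "\<dots> = real N powr (- c - 1)"
  proof -
    have "9 + - (c + 10) = - c - 1" by simp
    then show ?thesis by (simp only: powr_add[symmetric])
  qed
  also have "\<dots> \<le> real N powr (- c)" using n by (intro powr_mono) auto
  also have "\<dots> \<le> real n powr (- c)" using n c by (intro powr_mono2') auto
  finally show ?thesis .
qed


lemma measurable_gather: "measurable_algorithm (gather b T F)"
  unfolding measurable_algorithm_def
proof (intro conjI allI)
  fix k
  have "(\<lambda>\<rho>. to_nat (label b \<rho>, [] :: (nat list \<times> nat list) list)) \<in> tape_space \<rightarrow>\<^sub>M count_space UNIV"
    by (rule measurable_compose[OF measurable_label]) simp
  then show "init (gather b T F) k \<in> tape_space \<rightarrow>\<^sub>M count_space UNIV"
    by (simp add: gather_def)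
qed (simp add: gather_def)

lemma outputs_ldd_gather:
  fixes G :: "'v pair_pre_digraph" and b :: nat
  assumes G: "pair_graph G" and P: "port_numbering G P"
  defines "lb \<equiv> \<lambda>(y :: 'v \<times> nat \<Rightarrow> nat) v. map (\<lambda>\<beta>. y (v, \<beta>)) [0..<b]"
  shows "outputs_ldd G \<epsilon> d (outcome (gather b T F) P \<omega>) = outputs_ldd G \<epsilon> d (\<lambda>v. F (lb (streaks (pverts G) b \<omega>) v)
    {(lb (streaks (pverts G) b \<omega>) x, lb (streaks (pverts G) b \<omega>) z) | x z. (\<exists>n<T. (v, x) \<in> parcs G ^^ n) \<and> (x, z) \<in> parcs G})"
proof (rule outputs_ldd_cong)
  interpret pair_graph G by (rule G)
  fix v assume v: "v \<in> pverts G"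
  have arcs: "parcs G \<subseteq> pverts G \<times> pverts G" using wellformed' by auto
  have lb: "label b (\<omega> x) = lb (streaks (pverts G) b \<omega>) x" if "x \<in> pverts G" for x
    using that by (auto simp: label_def lb_def streaks_def)
  have "outcome (gather b T F) P \<omega> v = F (label b (\<omega> v))
    {(label b (\<omega> x), label b (\<omega> z)) | x z. (\<exists>n<T. (v, x) \<in> parcs G ^^ n) \<and> (x, z) \<in> parcs G}"
    by (rule outcome_gather[OF _ arcs v]) (use P in \<open>auto simp: port_numbering_def\<close>)
  also have "{(label b (\<omega> x), label b (\<omega> z)) | x z. (\<exists>n<T. (v, x) \<in> parcs G ^^ n) \<and> (x, z) \<in> parcs G} =
    {(lb (streaks (pverts G) b \<omega>) x, lb (streaks (pverts G) b \<omega>) z) | x z. (\<exists>n<T. (v, x) \<in> parcs G ^^ n) \<and> (x, z) \<in> parcs G}"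
    using lb wellformed' by (intro Collect_cong ex_cong1) auto
  finally show "outcome (gather b T F) P \<omega> v = F (lb (streaks (pverts G) b \<omega>) v)
    {(lb (streaks (pverts G) b \<omega>) x, lb (streaks (pverts G) b \<omega>) z) | x z. (\<exists>n<T. (v, x) \<in> parcs G ^^ n) \<and> (x, z) \<in> parcs G}"
    using lb[OF v] by simp
qed

lemma gather_event_measurable:
  assumes G: "pair_graph G" and P: "port_numbering G P"
  shows "{\<omega> \<in> space (tapes (pverts G)). outputs_ldd G \<epsilon> d (outcome (gather b T F) P \<omega>)} \<in> sets (tapes (pverts G))"
proof -
  interpret pair_graph G by (rule G)
  let ?S = "{y. outputs_ldd G \<epsilon> d (\<lambda>v. F (map (\<lambda>\<beta>. y (v, \<beta>)) [0..<b])
    {(map (\<lambda>\<beta>. y (x, \<beta>)) [0..<b], map (\<lambda>\<beta>. y (z, \<beta>)) [0..<b]) | x z. (\<exists>n<T. (v, x) \<in> parcs G ^^ n) \<and> (x, z) \<in> parcs G})}"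
  show ?thesis
    using tapes_event(1)[OF pair_finite_verts, of b ?S] unfolding outputs_ldd_gather[OF G P] by simp
qed

definition ldd_algorithm :: "nat \<Rightarrow> nat \<Rightarrow> nat \<Rightarrow> (nat, bool list, nat option) local_algorithm" where
  "ldd_algorithm h s K = (let r = 3 * s; lam = 7000 * s; R = 64 * lam in
     gather (5 * s + 2 * K) (7 * carving.reach h r R * K + 1) (decide h r R lam (5 * s) K))"

text \<open>\<open>del\<close> speaks of integers \<open>k\<close> instead of fractions, so that for
  very small \<open>\<epsilon>\<close> a count below 1 may be rounded down to 0.\<close>

lemma ldd_algorithm_correct:
  fixes G :: "'v pair_pre_digraph" and \<epsilon> d :: real
  assumes G: "pair_graph G" and P: "port_numbering G P" and pos: "h > 0" "s > 0"
    and del: "\<And>k :: nat. real k \<le> (8 / h + (7/8) ^ K) * card (pverts G) \<Longrightarrow> real k \<le> \<epsilon> * card (pverts G)"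
    and d: "real (2 * carving.reach h (3 * s) (64 * (7000 * s))) \<le> d"
  shows "1 - (real (card (pverts G)) ^ 2 * (1/2) ^ (5 * s) +
     real K * ((real (card (pverts G)) * (1/2) ^ (7000 * s) + exp (- real s)) + (real (card (pverts G)) * (1/2) ^ (3 * s) + exp (- real s))))
   \<le> measure (tapes (pverts G)) {\<omega> \<in> space (tapes (pverts G)). outputs_ldd G \<epsilon> d (outcome (ldd_algorithm h s K) P \<omega>)}"
    (is "?lhs \<le> _")
proof -
  interpret pair_graph G by (rule G)
  define r where "r = 3 * s"
  define lam where "lam = 7000 * s"
  define R where "R = 64 * lam"
  interpret L: random_labels "pverts G" "parcs G" h r R lam s "5 * s" K
    by unfold_locales (use pos wellformed' arcs_symmetric in \<open>auto simp: r_def lam_def R_def intro: symI\<close>)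
  let ?b = "5 * s + 2 * K"
  define S where "S = {y. outputs_ldd G \<epsilon> d (\<lambda>v. decide h r R lam (5 * s) K (map (\<lambda>\<beta>. y (v, \<beta>)) [0..<?b])
    {(map (\<lambda>\<beta>. y (x, \<beta>)) [0..<?b], map (\<lambda>\<beta>. y (z, \<beta>)) [0..<?b]) | x z.
      (\<exists>n<7 * carving.reach h r R * K + 1. (v, x) \<in> parcs G ^^ n) \<and> (x, z) \<in> parcs G})}"
  have good: "y \<in> S" if y: "L.good y" for y
    unfolding S_def mem_Collect_eq
  proof (rule outputs_lddI[OF G _ _ _ del])
    show "real (2 * carving.reach h r R) \<le> d" using d by (simp add: r_def R_def lam_def)
  qed (use L.decide_correct[OF y] in blast)+
  have "?lhs \<le> measure (geos L.indices) {y. L.good y}"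
    using L.prob_good by (simp add: r_def lam_def)
  also have "\<dots> \<le> measure (geos L.indices) S"
    using good by (intro measure_pmf.finite_measure_mono) auto
  also have "\<dots> \<le> measure (tapes (pverts G)) {\<omega> \<in> space (tapes (pverts G)). streaks (pverts G) ?b \<omega> \<in> S}"
    by (rule tapes_event(2)[OF pair_finite_verts])
  also have "{\<omega> \<in> space (tapes (pverts G)). streaks (pverts G) ?b \<omega> \<in> S} =
     {\<omega> \<in> space (tapes (pverts G)). outputs_ldd G \<epsilon> d (outcome (ldd_algorithm h s K) P \<omega>)}"
    unfolding ldd_algorithm_def Let_def outputs_ldd_gather[OF G P] S_def r_def R_def lam_def by simp
  finally show ?thesis .
qed

text \<open>Here \<open>wid = 448006 * s\<close>, so
  \<open>reach = 896012 * s * h + h\<close>.\<close>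

lemma reach_bound:
  assumes "s > 0" shows "carving.reach h (3 * s) (64 * (7000 * s)) \<le> 900000 * (s * h)"
proof -
  have "h \<le> s * h" using assms by simp
  then show ?thesis by (simp add: carving.reach_def carving.wid_def algebra_simps)
qed

(* Every finite graph has an isomorphic copy on natural numbers, and an algorithm does not see the
   names of the vertices. That all vertices know epsilon and N (the estimate of n) is expressed by
   letting the code that they all run depend on these two parameters. *)
theorem theorem1p5:
  fixes c c' :: real
  assumes "c \<ge> 1" and "c' > 0"
  shows "\<exists>(A :: real \<Rightarrow> nat \<Rightarrow> (nat, bool list, nat option) local_algorithm) (Cd :: real) (Cr :: real).
    Cd > 0 \<and> Cr > 0 \<and>
    (\<forall>\<epsilon> N. measurable_algorithm (A \<epsilon> N)) \<and>
    (\<forall>(\<epsilon> :: real) (N :: nat) (n :: nat) (G :: nat pair_pre_digraph) (P :: nat \<Rightarrow> nat list).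
       0 < \<epsilon> \<and> \<epsilon> < 1 \<and> pair_graph G \<and> n = card (pverts G) \<and> n \<ge> 1 \<and>
       n \<le> N \<and> real N \<le> real n powr c \<and> port_numbering G P \<longrightarrow>
         real (rounds (A \<epsilon> N)) \<le> Cr * (log_inv \<epsilon> ^ 3 * ln (real n) / \<epsilon>) \<and>
         {\<omega> \<in> space (tapes (pverts G)).
            outputs_ldd G \<epsilon> (Cd * (ln (real n) / \<epsilon>)) (outcome (A \<epsilon> N) P \<omega>)}
           \<in> sets (tapes (pverts G)) \<and>
         measure (tapes (pverts G)) {\<omega> \<in> space (tapes (pverts G)).
            outputs_ldd G \<epsilon> (Cd * (ln (real n) / \<epsilon>)) (outcome (A \<epsilon> N) P \<omega>)}
           \<ge> 1 - real n powr (- c'))"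
proof -
  \<comment> \<open>A parameter below \<open>1 / (2 * N)\<close> is raised to this value. Then at
    most \<open>n / (2 * N) \<le> 1/2\<close> vertices are deleted, hence none, which meets every
    smaller \<open>\<epsilon>\<close>; and \<open>K\<close> stays polynomial in
    \<open>N\<close>.\<close>
  define e where "e \<epsilon> N = max \<epsilon> (1 / (2 * real N))" for \<epsilon> :: real and N :: nat
  define h where "h \<epsilon> N = nat \<lceil>16 / e \<epsilon> N\<rceil>" for \<epsilon> and N :: nat
  define s where "s N = nat \<lceil>(c' + 10) * ln (real N)\<rceil>" for N :: nat
  define K where "K \<epsilon> N = nat \<lceil>8 * ln (2 / e \<epsilon> N)\<rceil>" for \<epsilon> and N :: nat
  \<comment> \<open>An admissible input with \<open>N < 2\<close> has \<open>n = 1\<close>. Then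
    \<open>ln n = 0\<close> allows no communication, and the required success probability is
    \<open>1 - 1 = 0\<close>.\<close>
  define A where "A \<epsilon> N = (if N < 2 then gather 0 0 (\<lambda>_ _. None) else ldd_algorithm (h \<epsilon> N) (s N) (K \<epsilon> N))"
    for \<epsilon> and N :: nat
  \<comment> \<open>\<open>\<kappa> * ln n\<close> bounds \<open>s N\<close>: passing from 10 to 12
    absorbs the rounding, as \<open>ln N \<ge> 1/2\<close>, and \<open>c\<close> comes from
    \<open>ln N \<le> c * ln n\<close>. Below, 900000 bounds \<open>reach / (s * h)\<close>, each 17
    bounds \<open>h * \<epsilon>\<close> or \<open>K / log_inv \<epsilon>\<close>, and the summand 2
    pays for the extra round.\<close>
  define \<kappa> where "\<kappa> = (c' + 12) * c"
  define Cd where "Cd = 2 * 900000 * 17 * \<kappa>"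
  define Cr where "Cr = 7 * 900000 * 17 * 17 * \<kappa> + 2"
  have \<kappa>: "\<kappa> > 0" using assms by (simp add: \<kappa>_def)
  have "measurable_algorithm (A \<epsilon> N)" for \<epsilon> N
    by (simp add: A_def ldd_algorithm_def Let_def measurable_gather)
  moreover have "real (rounds (A \<epsilon> N)) \<le> Cr * (log_inv \<epsilon> ^ 3 * ln (real n) / \<epsilon>) \<and>
         {\<omega> \<in> space (tapes (pverts G)). outputs_ldd G \<epsilon> (Cd * (ln (real n) / \<epsilon>)) (outcome (A \<epsilon> N) P \<omega>)}
           \<in> sets (tapes (pverts G)) \<and>
         measure (tapes (pverts G)) {\<omega> \<in> space (tapes (pverts G)).
            outputs_ldd G \<epsilon> (Cd * (ln (real n) / \<epsilon>)) (outcome (A \<epsilon> N) P \<omega>)}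
           \<ge> 1 - real n powr (- c')"
    if \<epsilon>: "0 < \<epsilon>" "\<epsilon> < 1" and G: "pair_graph G" and n: "n = card (pverts G)" "n \<ge> 1" "n \<le> N" "real N \<le> real n powr c"
      and P: "port_numbering G P" for \<epsilon> N n and G :: "nat pair_pre_digraph" and P
  proof -
    have meas: "{\<omega> \<in> space (tapes (pverts G)). outputs_ldd G \<epsilon> (Cd * (ln (real n) / \<epsilon>)) (outcome (A \<epsilon> N) P \<omega>)}
           \<in> sets (tapes (pverts G))"
      unfolding A_def ldd_algorithm_def Let_def if_distrib[of "\<lambda>A. outcome A P _"]
      by (cases "N < 2") (simp_all add: gather_event_measurable[OF G P])
    show ?thesis
    proof (cases "N < 2")
      case True
      then have "n = 1" "N = 1" using n by auto
      then show ?thesis using meas by (simp add: A_def gather_def)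
    next
      case False
      then have N: "2 \<le> N" by simp
      have n2: "2 \<le> n"
      proof (rule ccontr)
        assume "\<not> 2 \<le> n"
        then have "n = 1" using n by simp
        then show False using n N by simp
      qed
      have e: "0 < e \<epsilon> N" "e \<epsilon> N \<le> 1" "\<epsilon> \<le> e \<epsilon> N" "1 / (2 * real N) \<le> e \<epsilon> N"
        using \<epsilon> N by (auto simp: e_def)
      have ln2: "1/2 \<le> ln (2 :: real)" using ln2_ge_two_thirds by simp
      have lnn: "1/2 \<le> ln (real n)" using ln2 n2 ln_le_cancel_iff[of 2 "real n"] by linarith
      have lnN: "ln (real N) \<le> c * ln (real n)" "1/2 \<le> ln (real N)"
      proof -
        have "ln (real N) \<le> ln (real n powr c)" using n N n2 by (subst ln_le_cancel_iff) auto
        then show "ln (real N) \<le> c * ln (real n)" using n2 by (simp add: ln_powr)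
        show "1/2 \<le> ln (real N)" using ln2 N ln_le_cancel_iff[of 2 "real N"] by linarith
      qed
      have s: "real (s N) \<le> \<kappa> * ln (real n)"
      proof -
        have "real (s N) \<le> (c' + 10) * ln (real N) + 1"
          unfolding s_def using assms lnN by (intro nat_ceiling_le) auto
        also have "\<dots> \<le> (c' + 12) * ln (real N)"
          using lnN by (simp add: algebra_simps)
        also have "\<dots> \<le> (c' + 12) * (c * ln (real n))"
          using assms lnN by (intro mult_left_mono) auto
        finally show ?thesis by (simp add: \<kappa>_def)
      qed
      have s0: "0 < s N" unfolding s_def using assms lnN by simp
      have h0: "0 < h \<epsilon> N" unfolding h_def using e by simp
      have h: "real (h \<epsilon> N) \<le> 17 / \<epsilon>"
      proof -
        have "real (h \<epsilon> N) \<le> 16 / e \<epsilon> N + 1"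
          unfolding h_def using e by (intro nat_ceiling_le) auto
        also have "\<dots> \<le> 17 / e \<epsilon> N" using e by (simp add: field_simps)
        also have "\<dots> \<le> 17 / \<epsilon>" using e \<epsilon> by (intro divide_left_mono) auto
        finally show ?thesis .
      qed
      define reach where "reach = carving.reach (h \<epsilon> N) (3 * s N) (64 * (7000 * s N))"
      have reach: "real reach \<le> 900000 * (17 * \<kappa> * (ln (real n) / \<epsilon>))"
      proof -
        have "real reach \<le> real (900000 * (s N * h \<epsilon> N))"
          unfolding reach_def by (intro of_nat_mono reach_bound s0)
        also have "\<dots> = 900000 * (real (s N) * real (h \<epsilon> N))" by simp
        also have "\<dots> \<le> 900000 * ((\<kappa> * ln (real n)) * (17 / \<epsilon>))"
          using s h \<kappa> lnn by (intro mult_left_mono mult_mono) auto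
        finally show ?thesis by (simp add: algebra_simps)
      qed
      have K: "real (K \<epsilon> N) \<le> 17 * log_inv \<epsilon>"
      proof -
        have "real (K \<epsilon> N) \<le> 8 * ln (2 / e \<epsilon> N) + 1"
          unfolding K_def using e by (intro nat_ceiling_le) auto
        also have "ln (2 / e \<epsilon> N) \<le> ln (2 * (1 / \<epsilon>))"
          using e \<epsilon> by (subst ln_le_cancel_iff) (auto simp: divide_left_mono)
        also have "ln (2 * (1 / \<epsilon>)) = ln 2 + ln (1 / \<epsilon>)"
          using \<epsilon> by (intro ln_mult_pos) auto
        also have "\<dots> \<le> 1 + log_inv \<epsilon>"
          using ln_2_less_1 by (simp add: log_inv_def)
        finally have "real (K \<epsilon> N) \<le> 8 * (1 + log_inv \<epsilon>) + 1" by simp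
        then show ?thesis by (simp add: log_inv_def)
      qed
      have l: "1 \<le> log_inv \<epsilon>" "log_inv \<epsilon> \<le> log_inv \<epsilon> ^ 3"
        using power_increasing[of 1 3 "log_inv \<epsilon>"] by (auto simp: log_inv_def)
      let ?x = "log_inv \<epsilon> ^ 3 * ln (real n) / \<epsilon>"
      have x: "1 \<le> 2 * ?x"
      proof -
        have "1 * (1/2) / 1 \<le> log_inv \<epsilon> ^ 3 * ln (real n) / \<epsilon>"
          using l lnn \<epsilon> by (intro frac_le mult_mono) auto
        then show ?thesis by linarith
      qed
      have "real (rounds (A \<epsilon> N)) = 7 * real reach * real (K \<epsilon> N) + 1"
        using False by (simp add: A_def ldd_algorithm_def Let_def gather_def reach_def)
      \<comment> \<open>The construction spends a single factor \<open>log_inv \<epsilon>\<close>;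
        being at least 1, it is at most its cube.\<close>
      also have "\<dots> \<le> 7 * (900000 * (17 * \<kappa> * (ln (real n) / \<epsilon>))) * (17 * log_inv \<epsilon> ^ 3) + 2 * ?x"
        using reach K l x \<kappa> lnn \<epsilon> by (intro add_mono mult_mono mult_nonneg_nonneg) auto
      also have "\<dots> = Cr * ?x"
        by (simp add: Cr_def algebra_simps add_divide_distrib)
      finally have rounds: "real (rounds (A \<epsilon> N)) \<le> Cr * ?x" .
      have del: "real k \<le> \<epsilon> * real (card (pverts G))"
        if k: "real k \<le> (8 / real (h \<epsilon> N) + (7/8) ^ K \<epsilon> N) * real (card (pverts G))" for k :: nat
      proof -
        have "real k \<le> e \<epsilon> N * real n"
          using k mult_right_mono[OF deleted_fraction[OF e(1,2)], of "real n"] unfolding h_def K_def n(1) by linarith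
        show ?thesis
        proof (cases "e \<epsilon> N = \<epsilon>")
          case True
          then show ?thesis using \<open>real k \<le> e \<epsilon> N * real n\<close> n by simp
        next
          case False
          then have "e \<epsilon> N = 1 / (2 * real N)" by (simp add: e_def max_def split: if_splits)
          then have "real k \<le> real n / (2 * real N)" using \<open>real k \<le> e \<epsilon> N * real n\<close> by simp
          also have "\<dots> \<le> 1 / 2" using n N by (simp add: field_simps)
          finally have "k = 0" by simp
          then show ?thesis using \<epsilon> by simp
        qed
      qed
      have d: "real (2 * carving.reach (h \<epsilon> N) (3 * s N) (64 * (7000 * s N))) \<le> Cd * (ln (real n) / \<epsilon>)"
        using reach by (simp add: Cd_def reach_def)
      have "1 - real n powr (- c') \<le> measure (tapes (pverts G)) {\<omega> \<in> space (tapes (pverts G)).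
          outputs_ldd G \<epsilon> (Cd * (ln (real n) / \<epsilon>)) (outcome (ldd_algorithm (h \<epsilon> N) (s N) (K \<epsilon> N)) P \<omega>)}"
        using failure_bound[OF assms(2) n(2,3) N, of "K \<epsilon> N", folded s_def]
          rounds_le[OF N e(4,2), folded K_def] ldd_algorithm_correct[where K = "K \<epsilon> N" and \<epsilon> = \<epsilon>, OF G P h0 s0 del d, folded n(1)] by simp
      then show ?thesis using rounds meas False by (simp add: A_def)
    qed
  qed
  moreover have "Cd > 0" "Cr > 0" using \<kappa> by (simp_all add: Cd_def Cr_def)
  ultimately show ?thesis by blast
qed

end
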